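(* Let $Q\subset\mathbb{R}^2$ be an LDP-polygon, let $X_Q$ be the associated toric log Del Pezzo surface, let $\ell$ be the index of $X_Q$, and let $\widetilde{X}_Q\longrightarrow X_Q$ be its minimal desingularization. Then the Picard number $\rho(\widetilde{X}_Q)$ (the rank of the Picard group of $\widetilde{X}_Q$) satisfies $$\rho(\widetilde{X}_Q)\leq\begin{cases}7, & \text{if }\ell=1,\\ 8\ell^2-6\ell+3, & \text{if }\ell\geq 2.\end{cases}$$
   Context: All surfaces are over $\mathbb{C}$. A normal complex surface $X$ with at worst log terminal (i.e. quotient) singularities is a log Del Pezzo surface if its anticanonical divisor $-K_X$ is a $\mathbb{Q}$-Cartier ample divisor; its index is the smallest positive integer $\ell$ such that $\ell K_X$ is Cartier. It is toric if it carries an algebraic action of a $2$-dimensional algebraic torus with an open dense orbit. An LDP-polygon is a convex polygon $Q\subset\mathbb{R}^2$ that contains the origin in its interior and whose vertices are primitive points of $\mathbb{Z}^2$. Let $\mathcal{F}(Q)$ be the set of its edges (facets). For $F\in\mathcal{F}(Q)$ put $\sigma_F=\{\lambda\mathbf{x}\mid \mathbf{x}\in F,\ \lambda\in\mathbb{R}_{\geq 0}\}$. $X_Q$ is the compact toric surface defined (with respect to the lattice $\mathbb{Z}^2$) by the fan $\Delta_Q$ consisting of the cones $\sigma_F$, $F\in\mathcal{F}(Q)$, together with their faces. Every toric log Del Pezzo surface is isomorphic to $X_Q$ for some LDP-polygon $Q$. For $F\in\mathcal{F}(Q)$ with primitive outer normal vector $\boldsymbol{\eta}_F\in(\mathbb{Z}^2)^\vee$,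 the local index of $F$ is the positive integer $l_F$ which is the constant value of $\langle\boldsymbol{\eta}_F,\cdot\rangle$ on $F$. The index of $X_Q$ equals $\ell=\mathrm{lcm}\{l_F\mid F\in\mathcal{F}(Q)\}$. The minimal desingularization $\widetilde{X}_Q$ is the smooth compact toric surface whose fan $\widetilde{\Delta}_Q$ is the coarsest refinement of $\Delta_Q$ into cones each generated by a $\mathbb{Z}$-basis of $\mathbb{Z}^2$. *)

theory Defs
  imports
    "HOL-Analysis.Analysis"
    "HOL-Library.Extended_Nat"
    "HOL-Computational_Algebra.Polynomial_Factorial"
    "HOL-Computational_Algebra.Field_as_Ring"
    "HOL-Algebra.Ideal"
    "HOL-Algebra.Coset"
    "HOL-Algebra.FiniteProduct"
begin

section \<open>Lattice polygons, cones and fans in the plane\<close>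

text \<open>Both the lattice \<open>N\<close> of one-parameter subgroups and the dual lattice \<open>M\<close> of characters are
  \<^typ>\<open>int \<times> int\<close>; they are paired by the standard inner product of the plane.\<close>

definition lvec :: "int \<times> int \<Rightarrow> real \<times> real" where
  "lvec v = (of_int (fst v), of_int (snd v))"

definition primitive :: "int \<times> int \<Rightarrow> bool" where
  "primitive v \<longleftrightarrow> coprime (fst v) (snd v)"

definition LDP_polygon :: "(real \<times> real) set \<Rightarrow> bool" where
  "LDP_polygon Q \<longleftrightarrow> polytope Q \<and> 0 \<in> interior Q \<and>
     (\<forall>x. x extreme_point_of Q \<longrightarrow> (\<exists>v. primitive v \<and> x = lvec v))"

text \<open>In the library the empty set is a face of every convex set; it is not a face of a cone in the
  sense of toric geometry.\<close>

definition polygon_fan :: "(real \<times> real) set \<Rightarrow> (real \<times> real) set set" where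
  "polygon_fan Q = {\<tau>. \<tau> \<noteq> {} \<and> (\<exists>F. F facet_of Q \<and> \<tau> face_of (conic hull F))}"

definition strongly_convex_rational_cone :: "(real \<times> real) set \<Rightarrow> bool" where
  "strongly_convex_rational_cone \<sigma> \<longleftrightarrow>
     (\<exists>S. finite S \<and> \<sigma> = convex_cone hull (lvec ` S)) \<and> \<sigma> \<inter> uminus ` \<sigma> = {0}"

definition fan :: "(real \<times> real) set set \<Rightarrow> bool" where
  "fan \<Sigma> \<longleftrightarrow> finite \<Sigma> \<and> \<Sigma> \<noteq> {} \<and>
     (\<forall>\<sigma>\<in>\<Sigma>. strongly_convex_rational_cone \<sigma>) \<and>
     (\<forall>\<sigma>\<in>\<Sigma>. \<forall>\<tau>. \<tau> face_of \<sigma> \<and> \<tau> \<noteq> {} \<longrightarrow> \<tau> \<in> \<Sigma>) \<and>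
     (\<forall>\<sigma>\<in>\<Sigma>. \<forall>\<tau>\<in>\<Sigma>. \<sigma> \<inter> \<tau> face_of \<sigma> \<and> \<sigma> \<inter> \<tau> face_of \<tau>)"

definition lattice_basis :: "int \<times> int \<Rightarrow> int \<times> int \<Rightarrow> bool" where
  "lattice_basis u v \<longleftrightarrow>
     (\<forall>w. \<exists>!c :: int \<times> int. w = (fst c * fst u + snd c * fst v, fst c * snd u + snd c * snd v))"

text \<open>The cone is generated by part of a lattice basis, so that faces of smooth cones are smooth.
  For two-dimensional cones this means generated by a full basis.\<close>

definition smooth_cone :: "(real \<times> real) set \<Rightarrow> bool" where
  "smooth_cone \<sigma> \<longleftrightarrow> (\<exists>u v B. lattice_basis u v \<and> B \<subseteq> {u, v} \<and> \<sigma> = convex_cone hull (lvec ` B))"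

definition refines :: "(real \<times> real) set set \<Rightarrow> (real \<times> real) set set \<Rightarrow> bool" where
  "refines \<Sigma>' \<Sigma> \<longleftrightarrow> \<Union>\<Sigma>' = \<Union>\<Sigma> \<and> (\<forall>\<sigma>'\<in>\<Sigma>'. \<exists>\<sigma>\<in>\<Sigma>. \<sigma>' \<subseteq> \<sigma>)"

definition smooth_refinement :: "(real \<times> real) set set \<Rightarrow> (real \<times> real) set set \<Rightarrow> bool" where
  "smooth_refinement \<Sigma>' \<Sigma> \<longleftrightarrow> fan \<Sigma>' \<and> (\<forall>\<sigma>\<in>\<Sigma>'. smooth_cone \<sigma>) \<and> refines \<Sigma>' \<Sigma>"

definition coarsest_smooth_refinement :: "(real \<times> real) set set \<Rightarrow> (real \<times> real) set set \<Rightarrow> bool" where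
  "coarsest_smooth_refinement \<Sigma>' \<Sigma> \<longleftrightarrow>
     smooth_refinement \<Sigma>' \<Sigma> \<and> (\<forall>\<Sigma>''. smooth_refinement \<Sigma>'' \<Sigma> \<longrightarrow> refines \<Sigma>'' \<Sigma>')"

section \<open>Toric surfaces\<close>

text \<open>An integral separated scheme is determined by its function field \<open>K\<close> together with the set of
  its local rings, regarded as subrings of \<open>K\<close>: distinct points have distinct local rings, and a
  point specialises to another one iff its local ring contains that of the other (Chevalley schemes,
  EGA I, 8.3). A surface is accordingly represented by a set of subrings of its function field.
  All toric surfaces have the function field \<open>K = Frac \<complex>[x,y]\<close> of the torus.\<close>

type_synonym ratfun = "complex poly poly fract"

definition const_fn :: "complex \<Rightarrow> ratfun" where
  "const_fn c = to_fract [:[:c:]:]"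

definition fn_x :: ratfun where "fn_x = to_fract [:[:0, 1:]:]"

definition fn_y :: ratfun where "fn_y = to_fract [:0, 1:]"

definition character :: "int \<times> int \<Rightarrow> ratfun" where
  "character m = fn_x powi fst m * fn_y powi snd m"

definition dual_semigroup :: "(real \<times> real) set \<Rightarrow> (int \<times> int) set" where
  "dual_semigroup \<sigma> = {m. \<forall>v\<in>\<sigma>. 0 \<le> lvec m \<bullet> v}"

definition semigroup_algebra :: "(int \<times> int) set \<Rightarrow> ratfun set" where
  "semigroup_algebra S =
     {\<Sum>m\<in>I. const_fn (c m) * character m | I c. finite I \<and> I \<subseteq> S}"

definition ring_of :: "ratfun set \<Rightarrow> ratfun ring" where
  "ring_of A = \<lparr>carrier = A, mult = (*), one = 1, zero = 0, add = (+)\<rparr>"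

definition localization_at :: "ratfun set \<Rightarrow> ratfun set \<Rightarrow> ratfun set" where
  "localization_at A P = {a / s | a s. a \<in> A \<and> s \<in> A - P}"

text \<open>The local rings of the affine charts \<open>Spec \<complex>[\<sigma>\<^sup>\<or> \<inter> M]\<close>; the gluing of the charts is the
  identification of points with the same local ring.\<close>

definition toric_surface :: "(real \<times> real) set set \<Rightarrow> ratfun set set" where
  "toric_surface \<Sigma> =
     (\<Union>\<sigma>\<in>\<Sigma>. {localization_at (semigroup_algebra (dual_semigroup \<sigma>)) P | P.
               primeideal P (ring_of (semigroup_algebra (dual_semigroup \<sigma>)))})"

section \<open>Divisors, Picard group and index\<close>

text \<open>In this section \<open>X\<close> is a normal surface with function field \<^typ>\<open>ratfun\<close>, given by its set of
  local rings. The basic open sets are the domains of definition of rational functions.\<close>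

definition zariski :: "ratfun set set \<Rightarrow> ratfun set topology" where
  "zariski X = topology_generated_by (range (\<lambda>f. {R \<in> X. f \<in> R}))"

text \<open>A prime divisor is represented by the local ring of its generic point, a point of
  codimension one: the only point that properly specialises to it is the generic point of \<open>X\<close>, whose
  local ring is the whole function field.\<close>

definition prime_divisors :: "ratfun set set \<Rightarrow> ratfun set set" where
  "prime_divisors X = {R \<in> X. R \<noteq> UNIV \<and> \<not> (\<exists>R'\<in>X. R \<subset> R' \<and> R' \<subset> UNIV)}"

definition unit_set :: "ratfun set \<Rightarrow> ratfun set" where
  "unit_set R = {u \<in> R. u \<noteq> 0 \<and> inverse u \<in> R}"

definition uniformizer :: "ratfun set \<Rightarrow> ratfun \<Rightarrow> bool" where
  "uniformizer R t \<longleftrightarrow> t \<noteq> 0 \<and> R - unit_set R = {t * a | a. a \<in> R}"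

text \<open>Order of a nonzero rational function with respect to a discrete valuation ring.\<close>

definition ord_at :: "ratfun set \<Rightarrow> ratfun \<Rightarrow> int" where
  "ord_at R f = (THE n. \<exists>t u. uniformizer R t \<and> u \<in> unit_set R \<and> f = u * t powi n)"

type_synonym divisor = "ratfun set \<Rightarrow> int"

text \<open>Weil divisors are finitely supported functions on prime divisors, extended by zero.\<close>

definition weil_divisors :: "ratfun set set \<Rightarrow> divisor set" where
  "weil_divisors X = {D. finite {R. D R \<noteq> 0} \<and> {R. D R \<noteq> 0} \<subseteq> prime_divisors X}"

definition principal_divisor :: "ratfun set set \<Rightarrow> ratfun \<Rightarrow> divisor" where
  "principal_divisor X f = (\<lambda>R. if R \<in> prime_divisors X then ord_at R f else 0)"

text \<open>Cartier divisors are the locally principal Weil divisors. A prime divisor meets an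
  open set iff the open set contains its generic point.\<close>

definition cartier :: "ratfun set set \<Rightarrow> divisor \<Rightarrow> bool" where
  "cartier X D \<longleftrightarrow> D \<in> weil_divisors X \<and>
     (\<forall>P\<in>X. \<exists>V f. openin (zariski X) V \<and> P \<in> V \<and> f \<noteq> 0 \<and>
        (\<forall>R \<in> prime_divisors X \<inter> V. D R = principal_divisor X f R))"

definition cartier_group :: "ratfun set set \<Rightarrow> divisor monoid" where
  "cartier_group X = \<lparr>carrier = {D. cartier X D}, mult = (\<lambda>D E R. D R + E R), one = (\<lambda>R. 0)\<rparr>"

definition picard_group :: "ratfun set set \<Rightarrow> divisor set monoid" where
  "picard_group X = cartier_group X Mod (principal_divisor X ` {f. f \<noteq> 0})"

definition independent_in :: "('a, 'b) monoid_scheme \<Rightarrow> 'a set \<Rightarrow> bool" where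
  "independent_in G B \<longleftrightarrow> finite B \<and> B \<subseteq> carrier G \<and>
     (\<forall>c :: 'a \<Rightarrow> int. finprod G (\<lambda>b. b [^]\<^bsub>G\<^esub> c b) B = \<one>\<^bsub>G\<^esub> \<longrightarrow> (\<forall>b\<in>B. c b = 0))"

definition abelian_rank :: "('a, 'b) monoid_scheme \<Rightarrow> enat" where
  "abelian_rank G = (SUP B \<in> {B. independent_in G B}. enat (card B))"

definition picard_number :: "ratfun set set \<Rightarrow> enat" where
  "picard_number X = abelian_rank (picard_group X)"

text \<open>The partial derivatives on \<open>\<complex>(x,y)\<close> extend those on \<open>\<complex>[x][y]\<close> by the quotient rule.\<close>

definition quotient_rule :: "(complex poly poly \<Rightarrow> complex poly poly) \<Rightarrow> ratfun \<Rightarrow> ratfun" where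
  "quotient_rule d f =
     (case quot_of_fract f of (a, b) \<Rightarrow> to_fract (d a * b - a * d b) / to_fract (b ^ 2))"

definition deriv_x :: "ratfun \<Rightarrow> ratfun" where
  "deriv_x = quotient_rule (map_poly pderiv)"

definition deriv_y :: "ratfun \<Rightarrow> ratfun" where
  "deriv_y = quotient_rule pderiv"

text \<open>\<open>du \<and> dv = jacobian u v \<sqdot> dx \<and> dy\<close>\<close>

definition jacobian :: "ratfun \<Rightarrow> ratfun \<Rightarrow> ratfun" where
  "jacobian u v = deriv_x u * deriv_y v - deriv_y u * deriv_x v"

text \<open>Order of the rational 2-form \<open>dx \<and> dy\<close> along a prime divisor with local ring \<open>R\<close>: if
  \<open>du \<and> dv\<close> with \<open>u, v \<in> R\<close> generates the free rank one \<open>R\<close>-module of regular 2-forms, which is spanned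
  by all \<open>du' \<and> dv'\<close> with \<open>u', v' \<in> R\<close>, then \<open>dx \<and> dy = (jacobian u v)\<^sup>-\<^sup>1 \<sqdot> du \<and> dv\<close>.\<close>

definition ord_form :: "ratfun set \<Rightarrow> int" where
  "ord_form R = (THE n. \<exists>u\<in>R. \<exists>v\<in>R. jacobian u v \<noteq> 0 \<and>
     (\<forall>u'\<in>R. \<forall>v'\<in>R. jacobian u' v' / jacobian u v \<in> R) \<and> n = - ord_at R (jacobian u v))"

text \<open>The divisor of \<open>dx \<and> dy\<close>, a representative of the canonical class. Whether a multiple of it is
  Cartier does not depend on the choice of the rational 2-form.\<close>

definition canonical_divisor :: "ratfun set set \<Rightarrow> divisor" where
  "canonical_divisor X = (\<lambda>R. if R \<in> prime_divisors X then ord_form R else 0)"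

definition surface_index :: "ratfun set set \<Rightarrow> nat" where
  "surface_index X = (LEAST l. 0 < l \<and> cartier X (\<lambda>R. int l * canonical_divisor X R))"

end

theory Submission
  imports Defs
begin

text \<open>
  Write \<open>- b\<^sub>u\<close> for the self-intersection number of the divisor of a ray \<open>u\<close> of a complete smooth fan;
  by Noether's formula \<open>\<Sum>(3 - b\<^sub>u) = 12\<close>. Every smooth cycle \<open>U\<close> of lattice vectors that contains the
  set \<open>V\<close> of vertices of \<open>Q\<close> spans a smooth refinement of the fan of \<open>Q\<close>, so the rays of the
  minimal one are in \<open>U\<close>; choose \<open>U\<close> inside \<open>Q\<close> and of least cardinality.

  A local equation of \<open>l K\<close> at the closed point of the chart of an edge has along the two boundary
  divisors the orders of a character. Hence each edge has an integral functional that is equal to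
  \<open>l\<close> on it, and these functionals glue to a function \<open>h\<close> with \<open>h \<ge> 1\<close> on \<open>U\<close>, \<open>h = l\<close> on \<open>V\<close> and
  \<open>b\<^sub>u h(u) = h(u') + h(u'')\<close> for the neighbours \<open>u'\<close>, \<open>u''\<close> of \<open>u \<in> U - V\<close>. Minimality gives
  \<open>b\<^sub>u \<ge> 2\<close> on \<open>U - V\<close>, and as the second differences of \<open>h\<close> add up to zero, the sum of \<open>b\<^sub>u - 2\<close> over
  \<open>U - V\<close> is at most \<open>2 (l - 1) |V|\<close>. Convexity of \<open>Q\<close> gives \<open>b\<^sub>v \<le> 1\<close> on \<open>V\<close>, and \<open>|V| \<le> 4 l + 2\<close> because
  the functional of some edge is nonnegative on the sum of the vertices while each of its level
  lines contains at most two of them. Finally the Picard number is at most the number of rays minus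
  two, since the torus has trivial class group.
\<close>

section \<open>Smooth cycles of lattice vectors\<close>

text \<open>Both requirements on \<open>U\<close> have a purpose. Lying in \<open>Q\<close> puts the
  neighbours of a vertex into \<open>Q\<close>, and a vertex with \<open>b = 2\<close> would be
  their midpoint. Least cardinality forbids contracting a ray outside \<open>V\<close>. The function
  \<open>h\<close> is \<open>l\<close> times the gauge of \<open>Q\<close>; integrality of the edge
  functionals turns \<open>h > 0\<close> into \<open>h \<ge> 1\<close>, and this is where the index
  enters.

  Noether's formula is proved by contracting (-1)-curves. A cycle need not have one (the three rays
  of the projective plane), so rays are inserted until some \<open>e\<close> and \<open>- e\<close>
  both occur. The determinant against \<open>e\<close> is then a height on either side of a line, a
  ray of maximal height can be contracted, and in the end the four rays of a Hirzebruch surface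
  remain.

  A local equation of \<open>l K\<close> is an arbitrary rational function, not a character. Up to
  units its prime factors are coordinates or curves that miss the closed point, and the Newton
  polygon of such a curve has a point that is extremal for both boundary divisors at once.\<close>

definition cross :: "'a::comm_ring_1 \<times> 'a \<Rightarrow> 'a \<times> 'a \<Rightarrow> 'a" where
  "cross u v = fst u * snd v - snd u * fst v"

lemma cross_self [simp]: "cross u u = 0"
  by (simp add: cross_def)

lemma cross_swap: "cross v u = - cross u v"
  by (simp add: cross_def)

lemma cross_zero [simp]: "cross 0 u = 0" "cross u 0 = 0"
  by (simp_all add: cross_def)

lemma cross_add: "cross (u + v) w = cross u w + cross v w" "cross w (u + v) = cross w u + cross w v"
  by (simp_all add: cross_def algebra_simps)

lemma cross_diff: "cross (u - v) w = cross u w - cross v w" "cross w (u - v) = cross w u - cross w v"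
  by (simp_all add: cross_def algebra_simps)

lemma cross_uminus [simp]: "cross (- u) w = - cross u w" "cross w (- u) = - cross w u"
  by (simp_all add: cross_def)

text \<open>The three-term Pluecker relation. It stands in for angular transitivity: the signs of
  five of the six determinants can force the sign of the remaining one.\<close>

lemma cross_pluecker: "cross a b * cross u s + cross a u * cross s b = cross a s * cross u b"
  by (simp add: cross_def algebra_simps)

text \<open>By Cramer's rule \<open>cross w v\<close> and \<open>cross u w\<close> are the
  coordinates of \<open>w\<close> in the unimodular basis \<open>u\<close>,
  \<open>v\<close>.\<close>

lemma cross_eqI:
  assumes "cross u v = 1" "cross u w = cross u w'" "cross w v = cross w' v"
  shows "w = w'"
proof (rule prod_eqI)
  have e: "fst w = cross w v * fst u + cross u w * fst v" "snd w = cross w v * snd u + cross u w * snd v"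
    for w
  proof -
    have "cross w v * fst u + cross u w * fst v = fst w * cross u v"
      "cross w v * snd u + cross u w * snd v = snd w * cross u v"
      by (simp_all add: cross_def algebra_simps)
    then show "fst w = cross w v * fst u + cross u w * fst v" "snd w = cross w v * snd u + cross u w * snd v"
      using assms(1) by simp_all
  qed
  show "fst w = fst w'" "snd w = snd w'"
    using e[of w] e[of w'] assms(2,3) by simp_all
qed

text \<open>The witnesses \<open>a\<close> and \<open>b\<close> express that \<open>u\<close> and
  \<open>w\<close> are primitive, in the form in which a cycle supplies it. Writing
  \<open>w = k u\<close>, the factor \<open>k\<close> divides 1.\<close>

lemma parallel_unimodular:
  fixes u w :: "int \<times> int"
  assumes "cross u a = 1" "cross w b = 1" "cross w u = 0"
  shows "w = u \<or> w = - u"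
proof -
  define k where "k = cross w a"
  have w: "w = (k * fst u, k * snd u)"
  proof (rule cross_eqI[OF assms(1)])
    show "cross u w = cross u (k * fst u, k * snd u)"
      using assms(3) by (simp add: cross_def algebra_simps)
    have "cross (k * fst u, k * snd u) a = k * cross u a" by (simp add: cross_def algebra_simps)
    then show "cross w a = cross (k * fst u, k * snd u) a" using assms(1) k_def by simp
  qed
  then have "cross w b = k * cross u b" by (simp add: cross_def algebra_simps)
  then have "k * cross u b = 1" using assms(2) by simp
  then have "k = 1 \<or> k = -1" by (simp add: zmult_eq_1_iff) blast
  then show ?thesis using w by (cases u) auto
qed

text \<open>When \<open>cross u v\<close> is positive, these two signs describe the open cone
  spanned by \<open>u\<close> and \<open>v\<close>.\<close>

definition lies_between :: "int \<times> int \<Rightarrow> int \<times> int \<Rightarrow> int \<times> int \<Rightarrow> bool" where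
  "lies_between u w v \<longleftrightarrow> 0 < cross u w \<and> 0 < cross w v"

definition is_next :: "(int \<times> int) set \<Rightarrow> int \<times> int \<Rightarrow> int \<times> int \<Rightarrow> bool" where
  "is_next U u v \<longleftrightarrow> v \<in> U \<and> cross u v = 1 \<and> (\<forall>w\<in>U. \<not> lies_between u w v)"

text \<open>The primitive generators of the rays of a complete smooth fan. The divisor of \<open>u\<close> has
  self-intersection number \<open>- cross (prv U u) (nxt U u)\<close>.\<close>

definition smooth_cycle :: "(int \<times> int) set \<Rightarrow> bool" where
  "smooth_cycle U \<longleftrightarrow> finite U \<and> U \<noteq> {} \<and> (\<forall>u\<in>U. \<exists>v. is_next U u v)"

definition nxt :: "(int \<times> int) set \<Rightarrow> int \<times> int \<Rightarrow> int \<times> int" where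
  "nxt U u = (THE v. is_next U u v)"

definition prv :: "(int \<times> int) set \<Rightarrow> int \<times> int \<Rightarrow> int \<times> int" where
  "prv U = inv_into U (nxt U)"

text \<open>If \<open>cross v v'\<close> were nonzero, one of the two candidates would lie strictly
  between \<open>u\<close> and the other.\<close>

lemma is_next_unique:
  assumes "is_next U u v" "is_next U u v'"
  shows "v = v'"
proof -
  have "cross u v = 1" "cross u v' = 1" using assms by (auto simp: is_next_def)
  moreover have "\<not> cross v' v > 0" "\<not> cross v v' > 0"
    using assms by (auto simp: is_next_def lies_between_def)
  ultimately show ?thesis
    using cross_eqI[of u v v v'] cross_swap[of v v'] by simp
qed

lemma nxt_eqI: "is_next U u v \<Longrightarrow> nxt U u = v"
  unfolding nxt_def using is_next_unique by blast

lemma is_next_nxt: "smooth_cycle U \<Longrightarrow> u \<in> U \<Longrightarrow> is_next U u (nxt U u)"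
  using nxt_eqI smooth_cycle_def by metis

context
  fixes U assumes U: "smooth_cycle U"
begin

lemma finite_cycle: "finite U" and cycle_nonempty: "U \<noteq> {}"
  using U by (auto simp: smooth_cycle_def)

lemma nxt_in: "u \<in> U \<Longrightarrow> nxt U u \<in> U"
  using is_next_nxt[OF U] by (auto simp: is_next_def)

lemma cross_nxt: "u \<in> U \<Longrightarrow> cross u (nxt U u) = 1"
  using is_next_nxt[OF U] by (auto simp: is_next_def)

lemma not_between_nxt: "u \<in> U \<Longrightarrow> w \<in> U \<Longrightarrow> \<not> lies_between u w (nxt U u)"
  using is_next_nxt[OF U] by (auto simp: is_next_def)

lemma inj_on_nxt: "inj_on (nxt U) U"
proof (rule inj_onI)
  fix u u' assume a: "u \<in> U" "u' \<in> U" "nxt U u = nxt U u'"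
  let ?v = "nxt U u"
  have c: "cross u ?v = 1" "cross u' ?v = 1" using cross_nxt[OF a(1)] cross_nxt[OF a(2)] a(3) by simp_all
  then have "\<not> cross u u' > 0" "\<not> cross u' u > 0"
    using not_between_nxt[OF a(1,2)] not_between_nxt[OF a(2,1)] a(3) by (auto simp: lies_between_def)
  then show "u = u'" using cross_eqI[of u ?v u u'] c cross_swap[of u u'] by simp
qed

lemma bij_betw_nxt: "bij_betw (nxt U) U U"
  by (simp add: bij_betw_def endo_inj_surj finite_cycle image_subsetI inj_on_nxt nxt_in)

lemma prv_in: "u \<in> U \<Longrightarrow> prv U u \<in> U"
  unfolding prv_def by (metis bij_betw_imp_surj_on bij_betw_nxt inv_into_into)

lemma nxt_prv [simp]: "u \<in> U \<Longrightarrow> nxt U (prv U u) = u"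
  unfolding prv_def by (metis bij_betw_imp_surj_on bij_betw_nxt f_inv_into_f)

lemma prv_nxt [simp]: "u \<in> U \<Longrightarrow> prv U (nxt U u) = u"
  unfolding prv_def by (simp add: inj_on_nxt)

lemma cross_prv: "u \<in> U \<Longrightarrow> cross (prv U u) u = 1"
  using cross_nxt[OF prv_in] by simp

lemma not_between_prv: "u \<in> U \<Longrightarrow> w \<in> U \<Longrightarrow> \<not> lies_between (prv U u) w u"
  using not_between_nxt[OF prv_in] by simp

lemma cycle_parallel: "u \<in> U \<Longrightarrow> w \<in> U \<Longrightarrow> cross w u = 0 \<Longrightarrow> w = u \<or> w = - u"
  using parallel_unimodular cross_nxt by blast

lemma uminus_cycle_neq: "u \<in> U \<Longrightarrow> u \<noteq> - u"
  using cross_nxt[of u] by (auto simp: cross_def prod_eq_iff)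

end

text \<open>The sum of \<open>b - 3\<close> over all rays, where the \<open>b\<close> of each ray is
  attributed to its predecessor.\<close>

definition cycle_sum :: "(int \<times> int) set \<Rightarrow> int" where
  "cycle_sum U = (\<Sum>u\<in>U. cross u (nxt U (nxt U u))) - 3 * int (card U)"

text \<open>Since \<open>b = 1\<close> makes \<open>u\<close> the sum of its neighbours
  \<open>p\<close> and \<open>n\<close>, the gap left by \<open>u\<close> is again unimodular.
  Contracting this (-1)-curve lowers the \<open>b\<close> of both neighbours by one and removes the
  value \<open>b = 1\<close> itself, so the total of the \<open>b\<close> drops by 3, as does three
  times the cardinality.\<close>

lemma
  assumes U: "smooth_cycle U" and u: "u \<in> U" and b: "cross (prv U u) (nxt U u) = 1"
  shows smooth_cycle_remove: "smooth_cycle (U - {u})"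
    and nxt_remove: "\<And>w. w \<in> U - {u} \<Longrightarrow> nxt (U - {u}) w = (if w = prv U u then nxt U u else nxt U w)"
    and cycle_sum_remove: "cycle_sum (U - {u}) = cycle_sum U"
proof -
  define p where "p = prv U u"
  define n where "n = nxt U u"
  define pp where "pp = prv U p"
  note defs = p_def n_def pp_def
  have inU: "p \<in> U" "n \<in> U" "pp \<in> U" using prv_in[OF U u] nxt_in[OF U u] prv_in[OF U prv_in[OF U u]] by (simp_all add: defs)
  have nx: "nxt U p = u" "nxt U pp = p" "nxt U u = n"
    using nxt_prv[OF U u] nxt_prv[OF U inU(1)] by (simp_all add: defs)
  have c: "cross p u = 1" "cross u n = 1" "cross pp p = 1" "cross p n = 1"
    using cross_prv[OF U u] cross_nxt[OF U u] cross_prv[OF U inU(1)] b by (simp_all add: defs)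
  have n_eq: "n = u - p"
    by (rule cross_eqI[OF c(1)]) (use c cross_swap[of n u] cross_swap[of u p] in \<open>simp_all add: cross_diff\<close>)
  have pu: "p \<noteq> u" "n \<noteq> u" "pp \<noteq> p" "p \<noteq> n" using c by auto
  have ppu: "pp \<noteq> u" using c cross_swap[of p u] by auto
  have nextp: "is_next (U - {u}) p n"
  proof -
    have "\<not> lies_between p w n" if w: "w \<in> U - {u}" for w
    proof
      assume bt: "lies_between p w n"
      have "\<not> lies_between p w u" using not_between_nxt[OF U inU(1), of w] nx w by auto
      moreover have "\<not> lies_between u w n" using not_between_nxt[OF U u, of w] nx w by auto
      \<comment> \<open>\<open>w\<close> lies in neither of the two cells that meet in
        \<open>u\<close>, so it is on the line of \<open>u\<close>; and \<open>- u\<close> is on the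
        wrong side of \<open>p\<close>.\<close>
      ultimately have "cross w u = 0" using bt cross_swap[of w u] by (auto simp: lies_between_def)
      then have "w = - u" using cycle_parallel[OF U u, of w] w by auto
      then show False using bt c by (simp add: lies_between_def)
    qed
    then show ?thesis using inU pu c by (auto simp: is_next_def)
  qed
  have nextw: "is_next (U - {u}) w (nxt U w)" if w: "w \<in> U" "w \<noteq> u" "w \<noteq> p" for w
  proof -
    have "nxt U w \<noteq> u" using w inj_onD[OF inj_on_nxt[OF U], of w p] nx inU by auto
    then show ?thesis using is_next_nxt[OF U, of w] w by (auto simp: is_next_def)
  qed
  show cyc: "smooth_cycle (U - {u})"
    unfolding smooth_cycle_def using finite_cycle[OF U] inU pu nextp nextw by fast
  have nx': "nxt (U - {u}) w = (if w = p then n else nxt U w)" if "w \<in> U - {u}" for w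
    using nxt_eqI[OF nextp] nxt_eqI[OF nextw, of w] that by auto
  then show "\<And>w. w \<in> U - {u} \<Longrightarrow> nxt (U - {u}) w = (if w = prv U u then nxt U u else nxt U w)"
    by (simp add: defs)
  let ?f = "\<lambda>w. cross w (nxt U (nxt U w))"
  let ?g = "\<lambda>w. cross w (nxt (U - {u}) (nxt (U - {u}) w))"
  \<comment> \<open>Besides the summand at \<open>u\<close> itself, only those at \<open>p\<close>
    and \<open>pp\<close> change, since \<open>u\<close> is the first successor of \<open>p\<close>
    and the second successor of \<open>pp\<close>.\<close>
  let ?R = "U - {u, p, pp}"
  have fin: "finite ?R" using finite_cycle[OF U] by simp
  have eq: "?g w = ?f w" if w: "w \<in> ?R" for w
  proof -
    have "nxt U w \<noteq> u" "nxt U w \<noteq> p"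
      using w inj_onD[OF inj_on_nxt[OF U], of w p] inj_onD[OF inj_on_nxt[OF U], of w pp] nx inU by auto
    then show ?thesis using w nx'[of w] nx'[of "nxt U w"] nxt_in[OF U, of w] by auto
  qed
  have R: "U = insert u (insert p (insert pp ?R))" "U - {u} = insert p (insert pp ?R)"
    using u inU pu ppu by auto
  have "(\<Sum>w\<in>U. ?f w) = ?f u + (?f p + (?f pp + sum ?f ?R))"
    by (subst R(1)) (use fin pu ppu in simp)
  moreover have "(\<Sum>w\<in>U - {u}. ?g w) = ?g p + (?g pp + sum ?g ?R)"
    by (subst R(2)) (use fin pu ppu in simp)
  moreover have "sum ?g ?R = sum ?f ?R" using eq by (rule sum.cong[OF refl])
  moreover have "?g p = cross p (nxt U n)" using nx'[of p] nx'[of n] inU pu by auto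
  moreover have "?g pp = cross pp n" using nx'[of pp] nx'[of p] nx inU pu ppu by auto
  moreover have "cross p (nxt U n) = cross u (nxt U n) - 1"
  proof -
    have "p = u - n" using n_eq by simp
    then show ?thesis using cross_nxt[OF U inU(2)] by (simp add: cross_diff)
  qed
  moreover have "cross pp n = cross pp u - 1" using n_eq c by (simp add: cross_diff)
  moreover have "card U = Suc (card (U - {u}))"
    using u finite_cycle[OF U] by (metis card_Suc_Diff1)
  ultimately show "cycle_sum (U - {u}) = cycle_sum U"
    unfolding cycle_sum_def using nx c by simp
qed

section \<open>Cells of a cycle and real directions\<close>

lemma cross_lvec [simp]: "cross (lvec u) (lvec v) = of_int (cross u v)"
  by (simp add: cross_def lvec_def)

lemma cross_basis_expand:
  assumes "cross u n = 1"
  shows "cross a x = cross x n * cross a u + cross u x * cross a n"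
    "cross x a = cross x n * cross u a + cross u x * cross n a"
proof -
  have "cross x n * cross a u + cross u x * cross a n = cross u n * cross a x"
    "cross x n * cross u a + cross u x * cross n a = cross u n * cross x a"
    by (simp_all add: cross_def algebra_simps)
  then show "cross a x = cross x n * cross a u + cross u x * cross a n"
    "cross x a = cross x n * cross u a + cross u x * cross n a" using assms by simp_all
qed

text \<open>This is the relation \<open>p + n = b u\<close> between consecutive rays, paired with
  the functional \<open>cross e\<close>.\<close>

lemma three_term:
  assumes "cross p u = 1" "cross u n = 1"
  shows "cross e p + cross e n = cross p n * cross e u"
proof -
  have "cross e p * cross u n + cross e n * cross p u = cross p n * cross e u"
    by (simp add: cross_def algebra_simps)
  then show ?thesis using assms by simp
qed

text \<open>The cone of \<open>a\<close> and \<open>b\<close> meets the open cell of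
  \<open>u\<close> and \<open>n\<close> in \<open>x\<close>. Its boundary rays do not cut that cell,
  because neither \<open>a\<close> nor \<open>b\<close> is inside, so the whole cell is in the cone.
  The strict signs exclude the rays opposite to \<open>b\<close> and \<open>a\<close>.\<close>

lemma cell_in_cone:
  fixes a b u n :: "int \<times> int" and x :: "real \<times> real"
  assumes ab: "0 < cross a b" and un: "cross u n = 1"
    and nb: "\<not> lies_between u a n" "\<not> lies_between u b n"
    and x: "0 < cross (lvec u) x" "0 < cross x (lvec n)" "0 \<le> cross (lvec a) x" "0 \<le> cross x (lvec b)"
  shows "0 \<le> cross a u" "0 < cross u b" "0 < cross a n" "0 \<le> cross n b"
proof -
  have un': "cross (lvec u) (lvec n) = 1" using un by simp
  note ex = cross_basis_expand[OF un']
  have pl: "cross (lvec a) (lvec b) * cross (lvec u) x + cross (lvec a) (lvec u) * cross x (lvec b)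
      = cross (lvec a) x * cross (lvec u) (lvec b)"
    by (rule cross_pluecker)
  have pl2: "cross (lvec a) (lvec b) * cross x (lvec n) + cross (lvec a) x * cross (lvec n) (lvec b)
      = cross (lvec a) (lvec n) * cross x (lvec b)"
    by (rule cross_pluecker)
  show au: "0 \<le> cross a u"
  proof (rule ccontr)
    assume "\<not> 0 \<le> cross a u"
    then have c: "cross a u < 0" by simp
    have "cross x (lvec n) * cross (lvec a) (lvec u) < 0"
      using c x(2) by (simp add: mult_pos_neg)
    then have "0 < cross (lvec u) x * cross (lvec a) (lvec n)"
      using ex(1)[of "lvec a" x] x(3) by linarith
    then have "0 < cross a n" using x(1) by (simp add: zero_less_mult_iff)
    then show False using nb(1) c cross_swap[of a u] by (simp add: lies_between_def)
  qed
  have "0 < cross (lvec a) (lvec b) * cross (lvec u) x" using ab x by simp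
  moreover have "0 \<le> cross (lvec a) (lvec u) * cross x (lvec b)" using au x by simp
  ultimately have "0 < cross (lvec a) x * cross (lvec u) (lvec b)" using pl by linarith
  then show ub: "0 < cross u b" using x by (simp add: zero_less_mult_iff)
  show nbn: "0 \<le> cross n b" using nb(2) ub cross_swap[of n b] by (simp add: lies_between_def)
  have "0 < cross (lvec a) (lvec b) * cross x (lvec n)" using ab x by simp
  moreover have "0 \<le> cross (lvec a) x * cross (lvec n) (lvec b)" using nbn x by simp
  ultimately have "0 < cross (lvec a) (lvec n) * cross x (lvec b)" using pl2 by linarith
  then show "0 < cross a n" using x by (simp add: zero_less_mult_iff)
qed

text \<open>By \<open>cell_in_cone\<close> an open cell that meets a closed cell is contained in it.
  Its first ray \<open>u\<close> would then be strictly inside the cell of \<open>w\<close>, unless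
  both cells begin with the same ray.\<close>

lemma cell_unique:
  assumes U: "smooth_cycle U" and u: "u \<in> U" and w: "w \<in> U"
    and x: "0 < cross (lvec u) x" "0 < cross x (lvec (nxt U u))"
      "0 \<le> cross (lvec w) x" "0 \<le> cross x (lvec (nxt U w))"
  shows "u = w"
proof -
  have c: "cross w (nxt U w) = 1" "cross u (nxt U u) = 1" using U u w cross_nxt by auto
  have "0 \<le> cross w u" "0 < cross u (nxt U w)"
    using cell_in_cone[OF _ c(2) _ _ x] c(1) not_between_nxt[OF U u] w nxt_in[OF U w] by auto
  moreover have "\<not> lies_between w u (nxt U w)" by (rule not_between_nxt[OF U w u])
  ultimately have "cross w u = 0" by (auto simp: lies_between_def)
  then have "w = u \<or> w = - u" using cycle_parallel[OF U u w] by simp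
  then show ?thesis using c(1) \<open>0 < cross u (nxt U w)\<close> by auto
qed

text \<open>On an open half-plane bounded by the line of \<open>x\<close> the sign of
  \<open>cross\<close> is a total preorder by angle, transitive by the Pluecker relation.\<close>

lemma angularly_last:
  fixes x :: "real \<times> real"
  assumes "finite S" "S \<noteq> {}" "\<And>w. w \<in> S \<Longrightarrow> 0 < cross (lvec w) x"
  shows "\<exists>u\<in>S. \<forall>w\<in>S. cross u w \<le> 0"
  using assms
proof (induction S rule: finite_ne_induct)
  case (singleton a)
  then show ?case by simp
next
  case (insert a S)
  then obtain u where u: "u \<in> S" "\<forall>w\<in>S. cross u w \<le> 0" by auto
  show ?case
  proof (cases "cross u a \<le> 0")
    case True
    then show ?thesis using u by auto
  next
    case False
    have "cross a w \<le> 0" if w: "w \<in> S" for w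
    proof (rule ccontr)
      assume "\<not> cross a w \<le> 0"
      then have aw: "0 < cross a w" by simp
      have "0 < cross (lvec u) x * cross (lvec a) (lvec w)" "0 < cross (lvec u) (lvec a) * cross (lvec w) x"
        using insert.prems u w aw False by auto
      then have "0 < cross (lvec u) (lvec w) * cross (lvec a) x"
        using cross_pluecker[of "lvec u" x "lvec a" "lvec w"] by linarith
      then have "0 < cross u w" using insert.prems[of a] by (simp add: zero_less_mult_iff)
      then show False using u w by force
    qed
    then show ?thesis by auto
  qed
qed

text \<open>Among the rays in the half-plane clockwise of \<open>x\<close> the last one begins the
  cell of \<open>x\<close>, because its successor has left that half-plane. The ray \<open>w\<close>
  shows that there is one to choose.\<close>

lemma cell_exists:
  assumes U: "smooth_cycle U" and "w \<in> U" "0 < cross (lvec w) x"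
  shows "\<exists>u\<in>U. 0 < cross (lvec u) x \<and> 0 \<le> cross x (lvec (nxt U u))"
proof -
  let ?S = "{w\<in>U. 0 < cross (lvec w) x}"
  have "\<exists>u\<in>?S. \<forall>w\<in>?S. cross u w \<le> 0"
  proof (rule angularly_last[where x = x])
    show "finite ?S" using finite_cycle[OF U] by simp
    show "?S \<noteq> {}" using assms by blast
  qed simp
  then obtain u where u: "u \<in> ?S" "\<forall>w\<in>?S. cross u w \<le> 0" by blast
  then have uU: "u \<in> U" "0 < cross (lvec u) x" by simp_all
  have "nxt U u \<notin> ?S"
  proof
    assume "nxt U u \<in> ?S"
    then have "cross u (nxt U u) \<le> 0" using u by blast
    then show False using cross_nxt[OF U uU(1)] by simp
  qed
  then have "\<not> 0 < cross (lvec (nxt U u)) x" using nxt_in[OF U uU(1)] by simp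
  then have "0 \<le> cross x (lvec (nxt U u))"
    by (simp add: cross_swap[of "lvec (nxt U u)" x])
  then show ?thesis using uU by blast
qed

text \<open>Inserting \<open>u + n\<close> is the star subdivision of a smooth cone, the blow-up of
  a torus-fixed point. The new ray has \<open>b = 1\<close>, so invariance of the sum is the
  contraction lemma read backwards.\<close>

lemma
  assumes U: "smooth_cycle U" and u: "u \<in> U"
  shows smooth_cycle_insert: "smooth_cycle (insert (u + nxt U u) U)"
    and nxt_insert: "nxt (insert (u + nxt U u) U) u = u + nxt U u"
      "nxt (insert (u + nxt U u) U) (u + nxt U u) = nxt U u"
    and cycle_sum_insert: "cycle_sum (insert (u + nxt U u) U) = cycle_sum U"
proof -
  define n where "n = nxt U u"
  define w where "w = u + n"
  have n: "n \<in> U" "cross u n = 1" using nxt_in[OF U u] cross_nxt[OF U u] by (simp_all add: n_def)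
  have c: "cross u w = 1" "cross w n = 1" using n by (simp_all add: w_def cross_add)
  have nb: "\<not> lies_between u z n" if "z \<in> U" for z using not_between_nxt[OF U u that] by (simp add: n_def)
  have wU: "w \<notin> U" using nb[of w] c by (auto simp: lies_between_def)
  have nu: "is_next (insert w U) u w"
  proof -
    have "\<not> lies_between u z w" if z: "z \<in> insert w U" for z
    proof
      assume b: "lies_between u z w"
      have "cross z n = cross z w + cross u z" using cross_swap[of z u] by (simp add: w_def cross_add)
      then have "lies_between u z n" using b by (auto simp: lies_between_def)
      then show False using nb[of z] z b by (auto simp: lies_between_def)
    qed
    then show ?thesis using c by (auto simp: is_next_def)
  qed
  have nw: "is_next (insert w U) w n"
  proof -
    have "\<not> lies_between w z n" if z: "z \<in> insert w U" for z
    proof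
      assume b: "lies_between w z n"
      have "cross u z = cross w z + cross z n" using cross_swap[of z n] by (simp add: w_def cross_add)
      then have "lies_between u z n" using b by (auto simp: lies_between_def)
      then show False using nb[of z] z b by (auto simp: lies_between_def)
    qed
    then show ?thesis using c n by (auto simp: is_next_def)
  qed
  have nz: "is_next (insert w U) z (nxt U z)" if z: "z \<in> U" "z \<noteq> u" for z
  proof -
    have "\<not> lies_between z w (nxt U z)"
    proof
      assume b: "lies_between z w (nxt U z)"
      have "u = z"
        by (rule cell_unique[OF U u z(1), of "lvec w"]) (use b c n_def in \<open>auto simp: lies_between_def\<close>)
      then show False using z by simp
    qed
    then show ?thesis using is_next_nxt[OF U z(1)] by (auto simp: is_next_def)
  qed
  have "\<exists>v. is_next (insert w U) z v" if "z \<in> insert w U" for z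
    using that nu nw nz by (metis insert_iff)
  then have cyc: "smooth_cycle (insert w U)"
    using finite_cycle[OF U] by (simp add: smooth_cycle_def)
  then show "smooth_cycle (insert (u + nxt U u) U)" by (simp add: w_def n_def)
  have x: "nxt (insert w U) u = w" "nxt (insert w U) w = n" using nu nw nxt_eqI by auto
  then show "nxt (insert (u + nxt U u) U) u = u + nxt U u"
      "nxt (insert (u + nxt U u) U) (u + nxt U u) = nxt U u" by (simp_all add: w_def n_def)
  have "prv (insert w U) w = u" using prv_nxt[OF cyc, of u] x(1) u by simp
  then have "cycle_sum (insert w U - {w}) = cycle_sum (insert w U)"
    using cycle_sum_remove[OF cyc, of w] x n by simp
  then show "cycle_sum (insert (u + nxt U u) U) = cycle_sum U"
    using wU by (simp add: w_def n_def)
qed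

text \<open>The Euclidean algorithm: \<open>x\<close> has the coordinates \<open>cross x n\<close>
  and \<open>cross u x\<close> in the basis \<open>u\<close>, \<open>n\<close>, and passing to one
  half of the subdivided cell subtracts the smaller coordinate from the larger. As \<open>x\<close>
  is primitive (witness \<open>a\<close>), the descent ends at a ray equal to
  \<open>x\<close>.\<close>

lemma cycle_refine:
  assumes "smooth_cycle U" "u \<in> U" "cross x a = 1" "0 \<le> cross u x" "0 \<le> cross x (nxt U u)"
  shows "\<exists>U'. smooth_cycle U' \<and> U \<subseteq> U' \<and> x \<in> U' \<and> cycle_sum U' = cycle_sum U"
  using assms
proof (induction "nat (cross u x + cross x (nxt U u))" arbitrary: U u rule: less_induct)
  case less
  note U = less.prems(1) and u = less.prems(2) and xa = less.prems(3)
  define n where "n = nxt U u"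
  have n: "n \<in> U" "cross u n = 1" using nxt_in[OF U u] cross_nxt[OF U u] by (simp_all add: n_def)
  have x: "0 \<le> cross u x" "0 \<le> cross x n" using less.prems by (auto simp: n_def)
  consider "cross u x = 0" | "cross x n = 0" | "0 < cross u x" "0 < cross x n" using x by linarith
  then show ?case
  proof cases
    case 1
    then have "x = u \<or> x = - u"
      using parallel_unimodular[OF n(2) xa] cross_swap[of x u] by simp
    then have "x = u" using x n by auto
    then show ?thesis using U u by auto
  next
    case 2
    have "cross n (nxt U n) = 1" by (rule cross_nxt[OF U n(1)])
    then have "x = n \<or> x = - n" using parallel_unimodular[OF _ xa] 2 by simp
    then have "x = n" using x n by auto
    then show ?thesis using U n by auto
  next
    case 3
    define w where "w = u + n"
    let ?U = "insert w U"
    have U': "smooth_cycle ?U" "nxt ?U u = w" "nxt ?U w = n" "cycle_sum ?U = cycle_sum U"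
      using smooth_cycle_insert[OF U u] nxt_insert[OF U u] cycle_sum_insert[OF U u]
      by (simp_all add: w_def n_def)
    have xw: "cross x w = cross x n - cross u x" using cross_swap[of x u] by (simp add: w_def cross_add)
    have wx: "cross w x = - cross x w" by (rule cross_swap)
    have "\<exists>U'. smooth_cycle U' \<and> ?U \<subseteq> U' \<and> x \<in> U' \<and> cycle_sum U' = cycle_sum ?U"
    proof (cases "0 \<le> cross x w")
      case True
      show ?thesis
        by (rule less.hyps[of u ?U]) (use True U' xa 3 xw u in \<open>simp_all add: n_def\<close>)
    next
      case False
      show ?thesis
        by (rule less.hyps[of w ?U]) (use False U' xa 3 xw wx u in \<open>simp_all add: n_def\<close>)
    qed
    then show ?thesis using U'(4) by auto
  qed
qed

section \<open>Noether's formula by descent to Hirzebruch surfaces\<close>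

lemma upper_neighbours:
  assumes U: "smooth_cycle U" and e: "e \<in> U" "- e \<in> U" and u: "u \<in> U" "0 < cross e u"
  shows "0 \<le> cross e (prv U u)" "0 \<le> cross e (nxt U u)"
  using not_between_prv[OF U u(1) e(1)] not_between_nxt[OF U u(1) e(2)] u(2)
    cross_swap[of "prv U u" e] cross_swap[of u e] by (auto simp: lies_between_def)

text \<open>The determinant against \<open>e\<close> is the height above the line through
  \<open>e\<close> and \<open>- e\<close>. At a ray of maximal height \<open>M\<close> the relation
  \<open>p + n = b u\<close> makes \<open>b M\<close> a sum of two heights between \<open>0\<close>
  and \<open>M\<close>. For \<open>M \<ge> 2\<close> both extremes are impossible and
  \<open>b = 1\<close> is left; for \<open>M = 1\<close> the ray that follows \<open>e\<close> has
  \<open>b = 1\<close>.\<close>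

lemma blow_down_exists:
  assumes U: "smooth_cycle U" and e: "e \<in> U" "- e \<in> U"
    and ab: "a \<in> U" "b \<in> U" "a \<noteq> b" "0 < cross e a" "0 < cross e b"
  shows "\<exists>u\<in>U. 0 < cross e u \<and> cross (prv U u) (nxt U u) = 1"
proof -
  define M where "M = Max (cross e ` U)"
  have fin: "finite (cross e ` U)" using finite_cycle[OF U] by simp
  have le: "cross e u \<le> M" if "u \<in> U" for u using that fin by (simp add: M_def)
  obtain u where u: "u \<in> U" "cross e u = M"
  proof -
    have "M \<in> cross e ` U" using Max_in[OF fin] cycle_nonempty[OF U] by (simp add: M_def)
    then show ?thesis using that by blast
  qed
  have M: "1 \<le> M" using le[OF ab(1)] ab by simp
  define f where "f = nxt U e"
  have f: "f \<in> U" "cross e f = 1" using nxt_in[OF U e(1)] cross_nxt[OF U e(1)] by (auto simp: f_def)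
  \<comment> \<open>In the basis \<open>e\<close>, \<open>f\<close> two vectors of height
    \<open>M\<close> differ by a multiple of \<open>e\<close>, and
    \<open>cross e q = M\<close>.\<close>
  have equal_height: "M dvd cross p q" if "cross e p = M" "cross e q = M" for p q
  proof -
    have "cross p q * cross e f = cross p f * cross e q - cross q f * cross e p"
      by (simp add: cross_def algebra_simps)
    then have "cross p q = M * (cross p f - cross q f)" using that f by (simp add: algebra_simps)
    then show ?thesis by simp
  qed
  show ?thesis
  proof (cases "2 \<le> M")
    case True
    define p where "p = prv U u"
    define n where "n = nxt U u"
    have pn: "p \<in> U" "n \<in> U" "cross p u = 1" "cross u n = 1"
      using U u prv_in[OF U u(1)] nxt_in[OF U u(1)] cross_prv[OF U u(1)] cross_nxt[OF U u(1)] by (auto simp: p_def n_def)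
    have ge: "0 \<le> cross e p" "0 \<le> cross e n"
      using upper_neighbours[OF U e u(1)] u(2) True by (auto simp: p_def n_def)
    have "\<not> M dvd 1" using True by auto
    then have "cross e p \<noteq> M" "cross e n \<noteq> M"
      using equal_height[of p u] equal_height[of u n] u pn by auto
    then have lt: "cross e p < M" "cross e n < M" using le pn by (auto simp: order.strict_iff_order)
    have t: "cross e p + cross e n = cross p n * M" using three_term[OF pn(3,4), of e] u by simp
    have c0: "cross p n < 2"
    proof (rule ccontr)
      assume "\<not> cross p n < 2"
      then have "2 * M \<le> cross p n * M" using M by (intro mult_right_mono) auto
      then show False using t lt by linarith
    qed
    have c1: "0 \<le> cross p n"
    proof (rule ccontr)
      assume "\<not> 0 \<le> cross p n"
      then have "cross p n * M < 0" using M by (simp add: mult_neg_pos)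
      then show False using t ge by linarith
    qed
    have "cross p n \<noteq> 0"
    proof
      assume "cross p n = 0"
      then have "cross e p = 0" using t ge by simp
      then have "p = e \<or> p = - e" using cycle_parallel[OF U e(1) pn(1)] cross_swap[of p e] by simp
      then show False using pn u True by auto
    qed
    then have "cross p n = 1" using c0 c1 by linarith
    moreover have "0 < cross e u" using u True by simp
    ultimately show ?thesis using u(1) p_def n_def by blast
  next
    case False
    then have M1: "M = 1" using M by simp
    \<comment> \<open>All heights are now at most 1. The successor of \<open>f\<close> has height 1
      too: height 0 would make it \<open>- e\<close> and leave \<open>f\<close> as the only ray
      above the line. So the neighbours \<open>e\<close> and \<open>n\<close> of \<open>f\<close>
      have determinant 1.\<close>
    define n where "n = nxt U f"
    have n: "n \<in> U" "cross f n = 1" using nxt_in[OF U f(1)] cross_nxt[OF U f(1)] by (auto simp: n_def)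
    have p: "prv U f = e" using prv_nxt[OF U e(1)] by (simp add: f_def)
    have nge: "0 \<le> cross e n" using upper_neighbours(2)[OF U e f(1)] f by (simp add: n_def)
    have "cross e n \<noteq> 0"
    proof
      assume "cross e n = 0"
      then have "n = e \<or> n = - e" using cycle_parallel[OF U e(1) n(1)] cross_swap[of n e] by simp
      then have ne: "n = - e" using n f cross_swap[of f e] by auto
      obtain v where v: "v \<in> U" "v \<noteq> f" "0 < cross e v" using ab by metis
      have "\<not> lies_between e v f" using not_between_nxt[OF U e(1) v(1)] by (simp add: f_def)
      moreover have "\<not> lies_between f v (- e)" using not_between_nxt[OF U f(1) v(1)] ne by (simp add: n_def)
      ultimately have "cross v f = 0"
        using v(3) cross_swap[of v f] cross_swap[of v e] by (auto simp: lies_between_def)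
      then have "v = f \<or> v = - f" using cycle_parallel[OF U f(1) v(1)] by simp
      then show False using v f by auto
    qed
    then have "cross e n = 1" using nge le[OF n(1)] M1 by linarith
    then have "cross (prv U f) (nxt U f) = 1" using p by (simp add: n_def)
    moreover have "0 < cross e f" using f by simp
    ultimately show ?thesis using f(1) by blast
  qed
qed

lemma next_of_top:
  assumes U: "smooth_cycle U" and e: "e \<in> U" "- e \<in> U"
    and only: "\<And>a b. a \<in> U \<Longrightarrow> b \<in> U \<Longrightarrow> 0 < cross e a \<Longrightarrow> 0 < cross e b \<Longrightarrow> a = b"
  shows "nxt U (nxt U e) = - e"
proof -
  define w where "w = nxt U e"
  have w: "w \<in> U" "cross e w = 1" using nxt_in[OF U e(1)] cross_nxt[OF U e(1)] by (auto simp: w_def)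
  have n: "nxt U w \<in> U" "cross w (nxt U w) = 1" using nxt_in[OF U w(1)] cross_nxt[OF U w(1)] by auto
  have "0 \<le> cross e (nxt U w)" using upper_neighbours(2)[OF U e w(1)] w by simp
  moreover have "\<not> 0 < cross e (nxt U w)" using only[OF n(1) w(1)] w n by auto
  ultimately have "nxt U w = e \<or> nxt U w = - e"
    using cycle_parallel[OF U e(1) n(1)] cross_swap[of "nxt U w" e] by simp
  then show ?thesis using n w cross_swap[of w e] by (auto simp: w_def)
qed

text \<open>As long as one open side of the line through \<open>e\<close> contains two rays, a ray
  can be contracted that is neither \<open>e\<close> nor \<open>- e\<close>. What remains are the
  four rays of a Hirzebruch surface with values \<open>0\<close>, \<open>0\<close>, \<open>k\<close>
  and \<open>- k\<close> of \<open>b\<close>, and the sum is \<open>0 - 3 * 4\<close>.\<close>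

lemma cycle_sum_opposite:
  assumes "smooth_cycle U" "e \<in> U" "- e \<in> U"
  shows "cycle_sum U = - 12"
  using assms
proof (induction "card U" arbitrary: U rule: less_induct)
  case less
  note U = less.prems(1) and e = less.prems(2,3)
  have reduce: "cycle_sum U = - 12"
    if u: "u \<in> U" "cross e u \<noteq> 0" "cross (prv U u) (nxt U u) = 1" for u
  proof -
    have "card (U - {u}) < card U" using u finite_cycle[OF U] by (intro psubset_card_mono) auto
    moreover have "e \<in> U - {u}" "- e \<in> U - {u}" using u e by auto
    ultimately have "cycle_sum (U - {u}) = - 12"
      using less.hyps smooth_cycle_remove[OF U u(1,3)] by blast
    then show ?thesis using cycle_sum_remove[OF U u(1,3)] by simp
  qed
  show ?case
  proof (cases "\<exists>a\<in>U. \<exists>b\<in>U. a \<noteq> b \<and> (0 < cross e a \<and> 0 < cross e b \<or> 0 < cross (- e) a \<and> 0 < cross (- e) b)")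
    case True
    then obtain a b where ab: "a \<in> U" "b \<in> U" "a \<noteq> b"
      and "0 < cross e a \<and> 0 < cross e b \<or> 0 < cross (- e) a \<and> 0 < cross (- e) b" by blast
    then consider "0 < cross e a" "0 < cross e b" | "0 < cross (- e) a" "0 < cross (- e) b" by blast
    then obtain u where "u \<in> U" "cross e u \<noteq> 0" "cross (prv U u) (nxt U u) = 1"
    proof cases
      case 1
      then show ?thesis using blow_down_exists[OF U e ab] that by force
    next
      case 2
      have "- (- e) \<in> U" using e by simp
      then show ?thesis using blow_down_exists[OF U e(2) _ ab 2] that by force
    qed
    then show ?thesis using reduce by blast
  next
    case False
    define w where "w = nxt U e"
    define w' where "w' = nxt U (- e)"
    have w: "w \<in> U" "cross e w = 1" "w' \<in> U" "cross (- e) w' = 1"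
      using nxt_in[OF U e(1)] cross_nxt[OF U e(1)] nxt_in[OF U e(2)] cross_nxt[OF U e(2)] unfolding w_def w'_def by blast+
    have nx: "nxt U w = - e" "nxt U w' = e"
    proof -
      show "nxt U w = - e" unfolding w_def by (rule next_of_top[OF U e]) (use False in blast)
      have "nxt U w' = - (- e)" unfolding w'_def by (rule next_of_top[OF U e(2)]) (use False e in auto)
      then show "nxt U w' = e" by simp
    qed
    have "z \<in> {e, - e, w, w'}" if z: "z \<in> U" for z
    proof -
      consider "cross e z = 0" | "0 < cross e z" | "0 < cross (- e) z" by (cases "cross e z" "0::int" rule: linorder_cases) auto
      then show ?thesis
      proof cases
        case 1
        then show ?thesis using cycle_parallel[OF U e(1) z] cross_swap[of z e] by auto
      next
        case 2
        moreover have "0 < cross e w" using w by linarith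
        ultimately have "z = w" using False z w(1) by blast
        then show ?thesis by simp
      next
        case 3
        moreover have "0 < cross (- e) w'" using w by linarith
        ultimately have "z = w'" using False z w(3) by blast
        then show ?thesis by simp
      qed
    qed
    then have Ueq: "U = {e, - e, w, w'}" using w e by blast
    have d: "e \<noteq> - e" "e \<noteq> w" "e \<noteq> w'" "- e \<noteq> w" "- e \<noteq> w'" "w \<noteq> w'"
      using w uminus_cycle_neq[OF U e(1)] by auto
    define g where "g u = cross u (nxt U (nxt U u))" for u
    have "sum g U = sum g {e, - e, w, w'}" by (rule arg_cong[OF Ueq])
    also have "\<dots> = g e + (g (- e) + (g w + g w'))" using d by simp
    finally have "(\<Sum>u\<in>U. cross u (nxt U (nxt U u))) =
      cross e (nxt U (nxt U e)) + (cross (- e) (nxt U (nxt U (- e))) + (cross w (nxt U (nxt U w)) + cross w' (nxt U (nxt U w'))))"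
      by (simp add: g_def)
    also have "\<dots> = 0" using nx cross_swap[of w w'] by (simp flip: w_def w'_def)
    finally show ?thesis using d by (simp add: cycle_sum_def arg_cong[OF Ueq, of card])
  qed
qed

text \<open>Noether's formula \<open>12 = K\<^sup>2 + e\<close> for complete smooth toric surfaces.\<close>

lemma cycle_sum_eq:
  assumes U: "smooth_cycle U"
  shows "cycle_sum U = - 12"
proof -
  obtain e where e: "e \<in> U" using cycle_nonempty[OF U] by auto
  define n where "n = nxt U e"
  have n: "n \<in> U" "cross e n = 1" using nxt_in[OF U e] cross_nxt[OF U e] by (auto simp: n_def)
  \<comment> \<open>Blowing up inside the cell that contains \<open>- e\<close> turns
    \<open>- e\<close> into a ray and keeps the sum.\<close>
  have "0 < cross (lvec n) (lvec (- e))" using n cross_swap[of n e] by simp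
  then obtain u where u: "u \<in> U" "0 < cross u (- e)" "0 \<le> cross (- e) (nxt U u)"
    using cell_exists[OF U n(1), of "lvec (- e)"] by (auto simp del: cross_uminus)
  moreover have "cross (- e) (- n) = 1" using n by simp
  ultimately obtain U' where U': "smooth_cycle U'" "U \<subseteq> U'" "- e \<in> U'" "cycle_sum U' = cycle_sum U"
    using cycle_refine[OF U u(1), of "- e" "- n"] by auto
  then show ?thesis using cycle_sum_opposite[of U' e] e by auto
qed

section \<open>The two counting estimates\<close>

lemma sum_nxt:
  assumes "smooth_cycle U" shows "(\<Sum>u\<in>U. g (nxt U u)) = (\<Sum>u\<in>U. g u)"
  using sum.reindex_bij_betw[OF bij_betw_nxt[OF assms], of g] by simp

lemma sum_prv:
  assumes U: "smooth_cycle U" shows "(\<Sum>u\<in>U. g (prv U u)) = (\<Sum>u\<in>U. g u)"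
  using sum_nxt[OF U, of "\<lambda>u. g (prv U u)"] prv_nxt[OF U] by simp

text \<open>The bound \<open>h \<ge> 1\<close> enters twice: it allows \<open>b - 2\<close> to be
  replaced by \<open>(b - 2) h\<close>, which is a second difference of \<open>h\<close>, and it
  bounds the second difference at a vertex below by \<open>2 - 2 l\<close>. The 12 is that of
  Noether's formula, and the step from \<open>2 l - 2\<close> to \<open>2 l - 3\<close> is
  \<open>b - 2 \<le> - 1\<close> at each vertex.\<close>

lemma cycle_card_bound:
  fixes h :: "int \<times> int \<Rightarrow> int"
  assumes U: "smooth_cycle U" and VU: "V \<subseteq> U"
    and hV: "\<And>v. v \<in> V \<Longrightarrow> h v = l"
    and pos: "\<And>u. u \<in> U \<Longrightarrow> 1 \<le> h u"
    and lin: "\<And>u. u \<in> U - V \<Longrightarrow> h (prv U u) + h (nxt U u) = cross (prv U u) (nxt U u) * h u"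
    and min: "\<And>u. u \<in> U - V \<Longrightarrow> 2 \<le> cross (prv U u) (nxt U u)"
    and conv: "\<And>v. v \<in> V \<Longrightarrow> cross (prv U v) (nxt U v) \<le> 1"
  shows "int (card U) \<le> 12 + (2 * l - 3) * int (card V)"
proof -
  let ?b = "\<lambda>u. cross (prv U u) (nxt U u)"
  let ?d = "\<lambda>u. h (prv U u) + h (nxt U u) - 2 * h u"
  have fin: "finite U" "finite V" "finite (U - V)" using finite_cycle[OF U] VU finite_subset by auto
  have split: "sum g U = sum g (U - V) + sum g V" for g :: "_ \<Rightarrow> int"
    using fin VU by (metis sum.subset_diff)
  have "(\<Sum>u\<in>U. ?b u) = (\<Sum>u\<in>U. ?b (nxt U u))" using sum_nxt[OF U, of ?b] by simp
  also have "\<dots> = (\<Sum>u\<in>U. cross u (nxt U (nxt U u)))" using prv_nxt[OF U] by simp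
  also have "\<dots> = 3 * int (card U) - 12" using cycle_sum_eq[OF U] by (simp add: cycle_sum_def)
  finally have "int (card U) - 12 = (\<Sum>u\<in>U. ?b u - 2)" by (simp add: sum_subtractf)
  also have "\<dots> = (\<Sum>u\<in>U - V. ?b u - 2) + (\<Sum>u\<in>V. ?b u - 2)" by (rule split)
  also have "\<dots> \<le> (\<Sum>u\<in>U - V. ?d u) + (\<Sum>u\<in>V. - 1)"
  proof (intro add_mono sum_mono)
    fix u assume u: "u \<in> U - V"
    have "(?b u - 2) * 1 \<le> (?b u - 2) * h u"
      using min[OF u] pos[of u] u by (intro mult_left_mono) auto
    then show "?b u - 2 \<le> ?d u" using lin[OF u] by (simp add: algebra_simps)
  next
    fix v assume "v \<in> V" then show "?b v - 2 \<le> - 1" using conv[of v] by simp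
  qed
  also have "(\<Sum>u\<in>U - V. ?d u) = - (\<Sum>v\<in>V. ?d v)"
  proof -
    have "(\<Sum>u\<in>U. ?d u) = 0"
      using sum_nxt[OF U, of h] sum_prv[OF U, of h]
      by (simp add: sum_subtractf sum.distrib flip: sum_distrib_left)
    then show ?thesis using split[of ?d] by simp
  qed
  also have "- (\<Sum>v\<in>V. ?d v) \<le> (\<Sum>v\<in>V. 2 * l - 2)"
  proof -
    have "2 - 2 * l \<le> ?d v" if "v \<in> V" for v
      using hV[OF that] pos[of "prv U v"] pos[of "nxt U v"] prv_in[OF U, of v] nxt_in[OF U, of v] that VU by force
    then have "(\<Sum>v\<in>V. 2 - 2 * l) \<le> (\<Sum>v\<in>V. ?d v)" by (intro sum_mono)
    then show ?thesis by (simp add: algebra_simps)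
  qed
  finally show ?thesis by (simp add: algebra_simps)
qed

text \<open>The extremal configuration has two elements on each level from \<open>- L\<close> to
  \<open>L\<close>. It suggests the weight \<open>g v + L + 1\<close>, which is positive exactly on
  these levels. The total weight is at least \<open>(L + 1) * card V\<close> because the heights
  have nonnegative sum; counted by levels it is at most twice \<open>1 + ... + J\<close>, which is
  \<open>J * (J + 1)\<close>, where \<open>J = 2 * L + 1\<close> is the number of levels.\<close>

lemma card_bound_of_heights:
  fixes g :: "'a \<Rightarrow> int"
  assumes fin: "finite V" and le: "\<And>v. v \<in> V \<Longrightarrow> g v \<le> L" and L: "0 \<le> L"
    and fib: "\<And>h. card {v\<in>V. g v = h} \<le> 2" and sum: "0 \<le> (\<Sum>v\<in>V. g v)"
  shows "int (card V) \<le> 4 * L + 2"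
proof -
  define J where "J = 2 * L + 1"
  have "(\<Sum>v\<in>V. J - (L - g v)) \<le> (\<Sum>v\<in>V. max 0 (J - (L - g v)))" by (intro sum_mono) simp
  also have "\<dots> = (\<Sum>v\<in>{v\<in>V. L - g v \<in> {0..<J}}. J - (L - g v))"
    using fin le by (intro sum.mono_neutral_cong_right) fastforce+
  also have "\<dots> = (\<Sum>h\<in>{0..<J}. \<Sum>v\<in>{v\<in>{v\<in>V. L - g v \<in> {0..<J}}. L - g v = h}. J - (L - g v))"
    using fin by (intro sum.group[symmetric]) auto
  also have "\<dots> \<le> (\<Sum>h\<in>{0..<J}. 2 * (J - h))"
  proof (intro sum_mono)
    fix h assume h: "h \<in> {0..<J}"
    have "{v\<in>{v\<in>V. L - g v \<in> {0..<J}}. L - g v = h} = {v\<in>V. g v = L - h}" using h by auto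
    then have "(\<Sum>v\<in>{v\<in>{v\<in>V. L - g v \<in> {0..<J}}. L - g v = h}. J - (L - g v)) = (\<Sum>v\<in>{v\<in>V. g v = L - h}. J - h)"
      by (intro sum.cong) auto
    also have "\<dots> = int (card {v\<in>V. g v = L - h}) * (J - h)" by simp
    also have "\<dots> \<le> 2 * (J - h)"
      using fib[of "L - h"] h by (intro mult_right_mono) auto
    finally show "(\<Sum>v\<in>{v\<in>{v\<in>V. L - g v \<in> {0..<J}}. L - g v = h}. J - (L - g v)) \<le> 2 * (J - h)" .
  qed
  also have "\<dots> = J * (J + 1)"
  proof -
    have "(\<Sum>h\<in>{0..<int n}. 2 * (int n - h)) = int n * (int n + 1)" for n
    proof (induction n)
      case (Suc n)
      have "{0..<int (Suc n)} = insert (int n) {0..<int n}" by auto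
      moreover have "(\<Sum>h\<in>{0..<int n}. 2 * (int (Suc n) - h)) = (\<Sum>h\<in>{0..<int n}. 2 * (int n - h)) + 2 * int n"
        by (simp add: algebra_simps sum.distrib sum_subtractf)
      ultimately show ?case using Suc by (simp add: algebra_simps)
    qed simp
    from this[of "nat J"] show ?thesis using L by (simp add: J_def)
  qed
  finally have "(\<Sum>v\<in>V. J - (L - g v)) \<le> J * (J + 1)" .
  moreover have "(\<Sum>v\<in>V. J - (L - g v)) = (J - L) * int (card V) + (\<Sum>v\<in>V. g v)"
    by (simp add: sum.distrib sum_subtractf algebra_simps)
  ultimately have "(L + 1) * int (card V) \<le> (L + 1) * (4 * L + 2)"
    using sum by (simp add: J_def algebra_simps)
  then show ?thesis using L by (simp add: mult_le_cancel_left_pos)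
qed

text \<open>For \<open>l = 1\<close> the factor \<open>2 * l - 3\<close> is negative and the lower
  bound on \<open>k\<close> decides: \<open>12 - 3 - 2 = 7\<close>. For \<open>l \<ge> 2\<close> the
  upper bound on \<open>k\<close> gives \<open>8 l^2 - 8 l + 4\<close>, which is below the claim by
  \<open>2 l - 1\<close>.\<close>

lemma card_bound_arith:
  fixes l n k :: int
  assumes "1 \<le> l" "n \<le> 12 + (2 * l - 3) * k" "3 \<le> k" "k \<le> 4 * l + 2"
  shows "n - 2 \<le> (if l = 1 then 7 else 8 * l\<^sup>2 - 6 * l + 3)"
proof (cases "l = 1")
  case False
  then have "(2 * l - 3) * k \<le> (2 * l - 3) * (4 * l + 2)" using assms by (intro mult_left_mono) auto
  then show ?thesis using assms False by (simp add: algebra_simps power2_eq_square)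
qed (use assms in simp)

section \<open>Lattice polygons\<close>

definition dot :: "int \<times> int \<Rightarrow> int \<times> int \<Rightarrow> int" where
  "dot m v = fst m * fst v + snd m * snd v"

lemma dot_add [simp]: "dot m (u + v) = dot m u + dot m v" "dot (m + k) v = dot m v + dot k v"
  by (simp_all add: dot_def algebra_simps)

lemma dot_zero [simp]: "dot 0 u = 0" "dot m 0 = 0"
  by (simp_all add: dot_def)

lemma dot_uminus [simp]: "dot (- m) u = - dot m u"
  by (simp add: dot_def)

lemma dot_sum: "dot (\<Sum>i\<in>I. f i) u = (\<Sum>i\<in>I. dot (f i) u)" "dot u (\<Sum>i\<in>I. f i) = (\<Sum>i\<in>I. dot u (f i))"
  by (induction I rule: infinite_finite_induct) simp_all

lemma lvec_inner_lvec [simp]: "lvec m \<bullet> lvec v = of_int (dot m v)"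
  by (simp add: lvec_def dot_def)

lemma lvec_eq_iff [simp]: "lvec u = lvec v \<longleftrightarrow> u = v"
  by (auto simp: lvec_def prod_eq_iff)

lemma lvec_zero [simp]: "lvec 0 = 0" "lvec u = 0 \<longleftrightarrow> u = 0"
  by (auto simp: lvec_def prod_eq_iff zero_prod_def)

lemma lvec_uminus: "lvec (- u) = - lvec u"
  by (simp add: lvec_def)

lemma cross_scaleR [simp]: "cross (c *\<^sub>R x) y = c * cross x y" "cross y (c *\<^sub>R x) = c * cross y x"
  for x y :: "real \<times> real"
  by (simp_all add: cross_def algebra_simps)

lemma cross_eq_inner: "cross y x = (snd x, - fst x) \<bullet> y" for x y :: "real \<times> real"
  by (cases x; cases y) (simp add: cross_def algebra_simps)

lemma cross_combination:
  fixes x :: "real \<times> real"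
  assumes "cross a b \<noteq> 0"
  shows "x = (cross x b / cross a b) *\<^sub>R a + (cross a x / cross a b) *\<^sub>R b"
proof -
  have "cross x b * fst a + cross a x * fst b = cross a b * fst x"
    "cross x b * snd a + cross a x * snd b = cross a b * snd x"
    by (simp_all add: cross_def algebra_simps)
  then show ?thesis using assms by (simp add: prod_eq_iff field_simps)
qed

text \<open>For \<open>0 < cross a b\<close> this is the cone spanned by \<open>a\<close> and
  \<open>b\<close>; the two inequalities let membership be decided by signs of determinants.\<close>

definition cone2 :: "int \<times> int \<Rightarrow> int \<times> int \<Rightarrow> (real \<times> real) set" where
  "cone2 a b = {x. 0 \<le> cross (lvec a) x \<and> 0 \<le> cross x (lvec b)}"

lemma cone2_explicit:
  assumes "0 < cross a b"
  shows "cone2 a b = {\<alpha> *\<^sub>R lvec a + \<beta> *\<^sub>R lvec b |\<alpha> \<beta>. 0 \<le> \<alpha> \<and> 0 \<le> \<beta>}"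
proof (intro equalityI subsetI)
  fix x assume "x \<in> cone2 a b"
  moreover have "cross (lvec a) (lvec b) \<noteq> 0" using assms by simp
  ultimately have "x = (cross x (lvec b) / cross (lvec a) (lvec b)) *\<^sub>R lvec a + (cross (lvec a) x / cross (lvec a) (lvec b)) *\<^sub>R lvec b
      \<and> 0 \<le> cross x (lvec b) / cross (lvec a) (lvec b) \<and> 0 \<le> cross (lvec a) x / cross (lvec a) (lvec b)"
    using cross_combination[of "lvec a" "lvec b" x] assms by (simp add: cone2_def)
  then show "x \<in> {\<alpha> *\<^sub>R lvec a + \<beta> *\<^sub>R lvec b |\<alpha> \<beta>. 0 \<le> \<alpha> \<and> 0 \<le> \<beta>}" by blast
next
  fix x assume "x \<in> {\<alpha> *\<^sub>R lvec a + \<beta> *\<^sub>R lvec b |\<alpha> \<beta>. 0 \<le> \<alpha> \<and> 0 \<le> \<beta>}"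
  then obtain \<alpha> \<beta> where "0 \<le> \<alpha>" "0 \<le> \<beta>" "x = \<alpha> *\<^sub>R lvec a + \<beta> *\<^sub>R lvec b" by blast
  then show "x \<in> cone2 a b" using assms by (simp add: cone2_def cross_add)
qed

lemma convex_cone_hull_pair:
  "convex_cone hull {x, y} = {\<alpha> *\<^sub>R x + \<beta> *\<^sub>R y |\<alpha> \<beta>. 0 \<le> \<alpha> \<and> 0 \<le> \<beta>}" for x y :: "real \<times> real"
proof (intro equalityI)
  have cc: "convex_cone {\<alpha> *\<^sub>R x + \<beta> *\<^sub>R y |\<alpha> \<beta>. 0 \<le> \<alpha> \<and> 0 \<le> \<beta>}" (is "convex_cone ?C")
    unfolding convex_cone_iff
  proof (intro conjI ballI allI impI)
    have I: "\<alpha> *\<^sub>R x + \<beta> *\<^sub>R y \<in> ?C" if "0 \<le> \<alpha>" "0 \<le> \<beta>" for \<alpha> \<beta> using that by blast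
    show "0 \<in> ?C" using I[of 0 0] by simp
    show "p + q \<in> ?C" if pq: "p \<in> ?C" "q \<in> ?C" for p q
    proof -
      obtain \<alpha> \<beta> where p: "p = \<alpha> *\<^sub>R x + \<beta> *\<^sub>R y" "0 \<le> \<alpha>" "0 \<le> \<beta>" using pq(1) by blast
      obtain \<alpha>' \<beta>' where q: "q = \<alpha>' *\<^sub>R x + \<beta>' *\<^sub>R y" "0 \<le> \<alpha>'" "0 \<le> \<beta>'" using pq(2) by blast
      have "p + q = (\<alpha> + \<alpha>') *\<^sub>R x + (\<beta> + \<beta>') *\<^sub>R y" by (simp add: p(1) q(1) algebra_simps)
      then show ?thesis using I[of "\<alpha> + \<alpha>'" "\<beta> + \<beta>'"] p q by simp
    qed
    show "c *\<^sub>R p \<in> ?C" if pc: "p \<in> ?C" "0 \<le> c" for p and c :: real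
    proof -
      obtain \<alpha> \<beta> where p: "p = \<alpha> *\<^sub>R x + \<beta> *\<^sub>R y" "0 \<le> \<alpha>" "0 \<le> \<beta>" using pc(1) by blast
      have "c *\<^sub>R p = (c * \<alpha>) *\<^sub>R x + (c * \<beta>) *\<^sub>R y" by (simp add: p(1) algebra_simps)
      then show ?thesis using I[of "c * \<alpha>" "c * \<beta>"] p pc(2) by simp
    qed
  qed
  moreover have "x \<in> {\<alpha> *\<^sub>R x + \<beta> *\<^sub>R y |\<alpha> \<beta>. 0 \<le> \<alpha> \<and> 0 \<le> \<beta>}"
    by (rule CollectI, rule exI[of _ 1], rule exI[of _ 0]) simp
  moreover have "y \<in> {\<alpha> *\<^sub>R x + \<beta> *\<^sub>R y |\<alpha> \<beta>. 0 \<le> \<alpha> \<and> 0 \<le> \<beta>}"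
    by (rule CollectI, rule exI[of _ 0], rule exI[of _ 1]) simp
  ultimately show "convex_cone hull {x, y} \<subseteq> {\<alpha> *\<^sub>R x + \<beta> *\<^sub>R y |\<alpha> \<beta>. 0 \<le> \<alpha> \<and> 0 \<le> \<beta>}"
    by (intro hull_minimal) (simp_all only: insert_subset empty_subsetI simp_thms)
next
  have "\<alpha> *\<^sub>R x + \<beta> *\<^sub>R y \<in> convex_cone hull {x, y}" if "0 \<le> \<alpha>" "0 \<le> \<beta>" for \<alpha> \<beta>
    by (intro convex_cone_hull_add convex_cone_hull_mul that hull_inc) auto
  then show "{\<alpha> *\<^sub>R x + \<beta> *\<^sub>R y |\<alpha> \<beta>. 0 \<le> \<alpha> \<and> 0 \<le> \<beta>} \<subseteq> convex_cone hull {x, y}" by blast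
qed

lemma cone2_eq_hull: "0 < cross a b \<Longrightarrow> cone2 a b = convex_cone hull (lvec ` {a, b})"
  by (simp only: cone2_explicit convex_cone_hull_pair image_insert image_empty)

lemma cone2_eq_conic_hull:
  "0 < cross a b \<Longrightarrow> conic hull (closed_segment (lvec a) (lvec b)) = cone2 a b"
  by (simp only: cone2_eq_hull convex_cone_hull_separate_nonempty segment_convex_hull image_insert image_empty insert_not_empty not_False_eq_True)

lemma primitive_iff: "primitive u \<longleftrightarrow> (\<exists>w. cross u w = 1)"
proof
  assume "primitive u"
  then obtain x y where "x * fst u + y * snd u = 1"
    unfolding primitive_def using bezout_int[of "fst u" "snd u"] by (metis coprime_iff_gcd_eq_1)
  then have "cross u (- y, x) = 1" by (simp add: cross_def algebra_simps)
  then show "\<exists>w. cross u w = 1" ..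
next
  assume "\<exists>w. cross u w = 1"
  then obtain w where "fst u * snd w - snd u * fst w = 1" by (auto simp: cross_def)
  then show "primitive u" unfolding primitive_def
    by (metis coprimeI dvd_diff dvd_mult2)
qed

lemma primitive_multiple:
  assumes "primitive v" "v = (D * fst w, D * snd w)" "0 \<le> D"
  shows "D = 1"
proof -
  obtain z where "cross v z = 1" using assms(1) primitive_iff by auto
  moreover have "cross v z = D * cross w z" using assms(2) by (simp add: cross_def algebra_simps)
  ultimately show ?thesis using assms(3) by (auto simp: zmult_eq_1_iff)
qed

section \<open>Vertices and edges of an LDP-polygon\<close>

definition vertices :: "(real \<times> real) set \<Rightarrow> (int \<times> int) set" where
  "vertices Q = {v. lvec v extreme_point_of Q}"

text \<open>The sign condition orders the endpoints counterclockwise as seen from the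
  origin.\<close>

definition edge :: "(real \<times> real) set \<Rightarrow> int \<times> int \<Rightarrow> int \<times> int \<Rightarrow> bool" where
  "edge Q a b \<longleftrightarrow> a \<in> vertices Q \<and> b \<in> vertices Q \<and> 0 < cross a b \<and>
     closed_segment (lvec a) (lvec b) facet_of Q"

context
  fixes Q assumes Q: "LDP_polygon Q"
begin

lemma polygon_basics: "polytope Q" "0 \<in> interior Q" "convex Q" "compact Q" "bounded Q" "polyhedron Q" "0 \<in> Q"
proof -
  show 1: "polytope Q" "0 \<in> interior Q" using Q by (simp_all add: LDP_polygon_def)
  show "convex Q" "compact Q" "bounded Q" "polyhedron Q" "0 \<in> Q"
    using polytope_imp_convex[OF 1(1)] polytope_imp_compact[OF 1(1)] polytope_imp_bounded[OF 1(1)]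
      polytope_imp_polyhedron[OF 1(1)] subsetD[OF interior_subset 1(2)] by simp_all
qed

lemma extreme_point_primitive: "x extreme_point_of Q \<Longrightarrow> \<exists>v. primitive v \<and> x = lvec v"
  using Q unfolding LDP_polygon_def by blast

lemma primitive_vertex:
  assumes "v \<in> vertices Q" shows "primitive v"
proof -
  have "lvec v extreme_point_of Q" using assms by (simp add: vertices_def)
  from extreme_point_primitive[OF this] show ?thesis by auto
qed

lemma extreme_point_vertex:
  assumes "x extreme_point_of Q" shows "\<exists>v\<in>vertices Q. x = lvec v"
proof -
  obtain v where "x = lvec v" using extreme_point_primitive[OF assms] by blast
  then show ?thesis using assms by (auto simp: vertices_def)
qed

lemma vertex_in: "v \<in> vertices Q \<Longrightarrow> lvec v \<in> Q"
  by (simp add: vertices_def extreme_point_of_def)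

lemma finite_vertices: "finite (vertices Q)"
proof -
  have "finite (lvec ` vertices Q)"
    by (rule finite_subset[OF _ finite_polyhedron_extreme_points[OF polygon_basics(6)]]) (simp add: vertices_def image_subset_iff)
  then show ?thesis by (rule finite_imageD) (simp add: inj_on_def)
qed

lemma polygon_hull: "Q = convex hull (lvec ` vertices Q)"
proof -
  have "{x. x extreme_point_of Q} = lvec ` vertices Q"
    using extreme_point_vertex unfolding vertices_def by blast
  then show ?thesis using Krein_Milman_Minkowski[OF polygon_basics(4,3)] by simp
qed

lemma polygon_direction:
  assumes "c \<noteq> 0" shows "\<exists>y\<in>Q. 0 < c \<bullet> y"
proof -
  obtain e where e: "0 < e" "cball 0 e \<subseteq> Q" using polygon_basics(2) mem_interior_cball by blast
  have "(e / norm c) *\<^sub>R c \<in> cball 0 e" using e assms by simp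
  moreover have "0 < c \<bullet> ((e / norm c) *\<^sub>R c)" using e assms by simp
  ultimately show ?thesis using e by blast
qed

text \<open>If all vertices were on the other closed side of the line through \<open>x\<close>, so
  would be their hull \<open>Q\<close>, although the origin is interior to it.\<close>

lemma vertex_direction:
  assumes "x \<noteq> 0" shows "\<exists>v\<in>vertices Q. 0 < cross (lvec v) x"
proof (rule ccontr)
  assume "\<not> ?thesis"
  then have "lvec ` vertices Q \<subseteq> {y. (snd x, - fst x) \<bullet> y \<le> 0}"
    unfolding cross_eq_inner image_subset_iff mem_Collect_eq by (meson not_less)
  then have "Q \<subseteq> {y. (snd x, - fst x) \<bullet> y \<le> 0}"
    by (subst polygon_hull) (intro hull_minimal convex_halfspace_le)
  moreover have "(snd x, - fst x) \<noteq> 0" using assms by (auto simp: prod_eq_iff)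
  ultimately show False using polygon_direction by force
qed

text \<open>Besides a first vertex \<open>v\<close> there is one on each open side of the line
  through \<open>v\<close> and the origin.\<close>

lemma card_vertices: "3 \<le> card (vertices Q)"
proof -
  obtain v where v: "v \<in> vertices Q" using vertex_direction[of "(1, 0)"] by (auto simp: prod_eq_iff)
  then have v0: "lvec v \<noteq> 0" using primitive_vertex[of v] by (auto simp: primitive_def)
  obtain w where w: "w \<in> vertices Q" "0 < cross (lvec w) (lvec v)" using vertex_direction[OF v0] by auto
  obtain w' where w': "w' \<in> vertices Q" "0 < cross (lvec w') (- lvec v)" using vertex_direction[of "- lvec v"] v0 by auto
  have "v \<noteq> w" "v \<noteq> w'" "w \<noteq> w'" using w w' by auto
  then have "card {v, w, w'} = 3" by simp
  moreover have "{v, w, w'} \<subseteq> vertices Q" using v w w' by auto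
  ultimately show ?thesis using finite_vertices by (metis card_mono)
qed

lemma facet_support:
  assumes F: "F facet_of Q"
  shows "\<exists>c d. 0 < d \<and> (\<forall>x\<in>Q. c \<bullet> x \<le> d) \<and> F = Q \<inter> {x. c \<bullet> x = d}"
proof -
  have "F exposed_face_of Q" using facet_of_imp_face_of[OF F] exposed_face_of_polyhedron[OF polygon_basics(6)] by blast
  moreover have "F \<noteq> {}" "F \<noteq> Q" using F by (auto simp: facet_of_def)
  ultimately obtain c d where c: "c \<noteq> 0" "Q \<subseteq> {x. c \<bullet> x \<le> d}" "F = Q \<inter> {x. c \<bullet> x = d}"
    unfolding exposed_face_of by blast
  obtain y where "y \<in> Q" "0 < c \<bullet> y" using polygon_direction[OF c(1)] by auto
  then have "0 < d" using c(2) by force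
  then show ?thesis using c by blast
qed

text \<open>A facet is compact of dimension 1, hence a segment whose ends are vertices of
  \<open>Q\<close>. Its line misses the origin, as the supporting value \<open>d\<close> is
  positive, so the ends are independent and can be put into counterclockwise order.\<close>

lemma facet_edge:
  assumes F: "F facet_of Q"
  shows "\<exists>a b. edge Q a b \<and> F = closed_segment (lvec a) (lvec b)"
proof -
  obtain c d where c: "0 < d" "F = Q \<inter> {x. c \<bullet> x = d}" using facet_support[OF F] by auto
  have face: "F face_of Q" using F by (rule facet_of_imp_face_of)
  have "aff_dim Q = 2" using aff_dim_nonempty_interior[of Q] polygon_basics(2) by auto
  then have dim: "aff_dim F = 1" using F by (simp add: facet_of_def)
  have "compact F" "convex F" "F \<noteq> {}" "collinear F"
    using face_of_imp_compact[OF polygon_basics(3,4) face] face_of_imp_convex[OF face] F dim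
    by (simp_all add: facet_of_def collinear_aff_dim)
  then obtain A B where AB: "F = closed_segment A B" using compact_convex_collinear_segment by metis
  have "A extreme_point_of F" "B extreme_point_of F" by (simp_all add: AB extreme_point_of_segment)
  then have "A extreme_point_of Q" "B extreme_point_of Q" using extreme_point_of_face[OF face] by auto
  then obtain a b where ab: "a \<in> vertices Q" "b \<in> vertices Q" "A = lvec a" "B = lvec b"
    using extreme_point_vertex by blast
  have "A \<in> F" "B \<in> F" using AB by auto
  then have d: "c \<bullet> A = d" "c \<bullet> B = d" using c by auto
  have "cross a b \<noteq> 0"
  proof
    assume "cross a b = 0"
    then have 0: "cross A B = 0" using ab by simp
    have e: "(c \<bullet> B) * fst A - (c \<bullet> A) * fst B = snd c * cross A B"
      "(c \<bullet> B) * snd A - (c \<bullet> A) * snd B = - fst c * cross A B"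
      by (simp_all add: cross_def inner_prod_def algebra_simps)
    have "d * fst A = d * fst B" "d * snd A = d * snd B" using e unfolding d 0 by simp_all
    then have "A = B" using c(1) by (simp add: prod_eq_iff)
    then have "F = {A}" using AB by simp
    then show False using dim by simp
  qed
  then consider "0 < cross a b" | "0 < cross b a" using cross_swap[of a b] by linarith
  then show ?thesis
  proof cases
    case 1
    then show ?thesis using ab AB F unfolding edge_def by blast
  next
    case 2
    have "F = closed_segment (lvec b) (lvec a)" using AB ab closed_segment_commute by metis
    then show ?thesis using 2 ab F unfolding edge_def by blast
  qed
qed

text \<open>The ray through \<open>x\<close> leaves \<open>Q\<close> in a point of the frontier, and
  the frontier is the union of the facets.\<close>

lemma cone2_cover:
  assumes "x \<noteq> 0" shows "\<exists>a b. edge Q a b \<and> x \<in> cone2 a b"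
proof -
  obtain d where d: "0 < d" "0 + d *\<^sub>R x \<in> frontier Q"
    using ray_to_frontier[OF polygon_basics(5,2) assms] by blast
  have "rel_frontier Q = frontier Q" using polygon_basics(2) by (intro rel_frontier_nonempty_interior) auto
  then obtain F where F: "F facet_of Q" "d *\<^sub>R x \<in> F"
    using d rel_frontier_of_polyhedron[OF polygon_basics(6)] by auto
  then obtain a b where e: "edge Q a b" "F = closed_segment (lvec a) (lvec b)" using facet_edge by blast
  have "d *\<^sub>R x \<in> conic hull F" using F by (simp add: hull_inc)
  then have "d *\<^sub>R x \<in> cone2 a b" using e cone2_eq_conic_hull by (simp add: edge_def)
  then have "x \<in> cone2 a b" using d by (simp add: cone2_def zero_le_mult_iff)
  then show ?thesis using e by blast
qed

text \<open>The ends of the edge span the plane, so a functional with value \<open>l\<close> at both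
  is \<open>l / d\<close> times the one that supports \<open>Q\<close> along the edge.\<close>

lemma edge_support:
  assumes e: "edge Q a b" and m: "dot m a = l" "dot m b = l" and l: "0 \<le> l"
  shows "x \<in> Q \<Longrightarrow> lvec m \<bullet> x \<le> of_int l"
    and "x \<in> cone2 a b \<Longrightarrow> \<exists>c y. 0 \<le> c \<and> y \<in> Q \<and> x = c *\<^sub>R y \<and> lvec m \<bullet> y = of_int l"
proof -
  let ?A = "lvec a" and ?B = "lvec b"
  obtain c d where c: "0 < d" "\<forall>x\<in>Q. c \<bullet> x \<le> d" "closed_segment ?A ?B = Q \<inter> {x. c \<bullet> x = d}"
    using facet_support[of "closed_segment ?A ?B"] e unfolding edge_def by blast
  have cab: "c \<bullet> ?A = d" "c \<bullet> ?B = d" using c(3) ends_in_segment by blast+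
  have ab: "cross ?A ?B \<noteq> 0" using e by (simp add: edge_def)
  have m': "lvec m \<bullet> ?A = of_int l" "lvec m \<bullet> ?B = of_int l" using m by auto
  have cm: "lvec m \<bullet> x = (of_int l / d) * (c \<bullet> x)" for x
    by (subst (1 2) cross_combination[OF ab, of x]) (use c(1) m' cab in \<open>simp add: inner_add_right field_simps\<close>)
  show "lvec m \<bullet> x \<le> of_int l" if "x \<in> Q"
  proof -
    have "(of_int l / d) * (c \<bullet> x) \<le> (of_int l / d) * d" using c that l by (intro mult_left_mono) auto
    then show ?thesis using cm[of x] c(1) by simp
  qed
  assume "x \<in> cone2 a b"
  then have "x \<in> conic hull (closed_segment ?A ?B)" using cone2_eq_conic_hull e by (simp add: edge_def)
  then obtain k y where y: "0 \<le> k" "y \<in> closed_segment ?A ?B" "x = k *\<^sub>R y"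
    unfolding conic_hull_explicit by blast
  then have "y \<in> Q" "lvec m \<bullet> y = of_int l" using c cm[of y] by auto
  then show "\<exists>c y. 0 \<le> c \<and> y \<in> Q \<and> x = c *\<^sub>R y \<and> lvec m \<bullet> y = of_int l" using y by blast
qed

end

text \<open>Exchanging the two coordinates reverses the orientation and reduces this to
  \<open>angularly_last\<close>.\<close>

lemma angularly_first:
  fixes x :: "real \<times> real"
  assumes "finite S" "S \<noteq> {}" "\<And>w. w \<in> S \<Longrightarrow> 0 < cross x (lvec w)"
  shows "\<exists>u\<in>S. \<forall>w\<in>S. 0 \<le> cross u w"
proof -
  have "\<exists>u\<in>prod.swap ` S. \<forall>w\<in>prod.swap ` S. cross u w \<le> 0"
    by (rule angularly_last[where x = "prod.swap x"]) (use assms in \<open>auto simp: cross_def lvec_def algebra_simps\<close>)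
  then show ?thesis by (auto simp: cross_def algebra_simps)
qed

lemma finite_lattice_points:
  assumes "bounded Q" shows "finite {u. lvec u \<in> Q}"
proof -
  obtain B where B: "\<And>x. x \<in> Q \<Longrightarrow> norm x \<le> B" using assms bounded_iff by metis
  define N where "N = \<lceil>B\<rceil>"
  have "u \<in> {-N..N} \<times> {-N..N}" if "lvec u \<in> Q" for u
  proof -
    have "\<bar>fst (lvec u)\<bar> \<le> norm (lvec u)" "\<bar>snd (lvec u)\<bar> \<le> norm (lvec u)"
      using norm_fst_le[of "real_of_int (fst u)" "real_of_int (snd u)"]
        norm_snd_le[of "real_of_int (snd u)" "real_of_int (fst u)"] by (simp_all add: lvec_def)
    then have "\<bar>fst (lvec u)\<bar> \<le> of_int N" "\<bar>snd (lvec u)\<bar> \<le> of_int N"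
      using B[OF that] unfolding N_def by linarith+
    then have "\<bar>fst u\<bar> \<le> N" "\<bar>snd u\<bar> \<le> N" by (simp_all add: lvec_def)
    then show ?thesis by (cases u) auto
  qed
  then have "{u. lvec u \<in> Q} \<subseteq> {-N..N} \<times> {-N..N}" by blast
  then show ?thesis by (rule finite_subset) simp
qed

context
  fixes Q assumes Q: "LDP_polygon Q"
begin

text \<open>Let \<open>v\<close> be the first point after \<open>u\<close> and \<open>D\<close>
  their determinant. Reduction modulo \<open>u\<close> yields \<open>w\<close> with
  \<open>cross u w = 1\<close> and \<open>D w = r u + v\<close>, \<open>0 \<le> r < D\<close>, so
  \<open>w\<close> is in the triangle with corners \<open>0\<close>, \<open>u\<close>,
  \<open>v\<close>. For \<open>r > 0\<close> it would be a primitive point of \<open>Q\<close> that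
  precedes \<open>v\<close>; for \<open>r = 0\<close> primitivity of \<open>v = D w\<close> gives
  \<open>D = 1\<close>.\<close>

lemma primitive_points_cycle: "smooth_cycle {u. primitive u \<and> lvec u \<in> Q}" (is "smooth_cycle ?U")
proof -
  have fin: "finite ?U"
    by (rule finite_subset[OF _ finite_lattice_points[OF polygon_basics(5)[OF Q]]]) auto
  have V: "vertices Q \<subseteq> ?U" using primitive_vertex[OF Q] vertex_in[OF Q] by auto
  have ne: "?U \<noteq> {}" using V card_vertices[OF Q] by fastforce
  have "\<exists>v. is_next ?U u v" if u: "u \<in> ?U" for u
  proof -
    obtain w0 where w0: "cross u w0 = 1" using u primitive_iff by auto
    define S where "S = {w\<in>?U. 0 < cross u w}"
    have "u \<noteq> 0" using w0 by auto
    then have "lvec (- u) \<noteq> 0" by simp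
    then obtain v0 where v0: "v0 \<in> vertices Q" "0 < cross (lvec v0) (lvec (- u))"
      using vertex_direction[OF Q] by blast
    then have "v0 \<in> S" using V cross_swap[of v0 u] by (auto simp: S_def)
    moreover have "finite S" using fin unfolding S_def by (rule rev_finite_subset) blast
    ultimately have "\<exists>v\<in>S. \<forall>w\<in>S. 0 \<le> cross v w"
      by (intro angularly_first[where x = "lvec u"]) (blast, blast, simp add: S_def)
    then obtain v where v: "v \<in> S" "\<And>w. w \<in> S \<Longrightarrow> 0 \<le> cross v w" by blast
    define D where "D = cross u v"
    have D: "0 < D" "v \<in> ?U" using v by (auto simp: S_def D_def)
    define k where "k = - (cross w0 v div D)"
    define w where "w = (fst w0 + k * fst u, snd w0 + k * snd u)"
    have w: "cross u w = 1" "cross w v = cross w0 v mod D"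
    proof -
      show "cross u w = 1" using w0 by (simp add: w_def cross_def algebra_simps)
      have "cross w v = cross w0 v + k * D" by (simp add: w_def D_def cross_def algebra_simps)
      then show "cross w v = cross w0 v mod D" by (simp add: k_def minus_div_mult_eq_mod)
    qed
    define r where "r = cross w v"
    have r: "0 \<le> r" "r < D" using w D by (auto simp: r_def)
    have Dw: "D * fst w = r * fst u + fst v" "D * snd w = r * snd u + snd v"
    proof -
      have "cross u w * fst v = D * fst w - r * fst u" "cross u w * snd v = D * snd w - r * snd u"
        by (simp_all add: D_def r_def cross_def algebra_simps)
      then show "D * fst w = r * fst u + fst v" "D * snd w = r * snd u + snd v" using w(1) by simp_all
    qed
    have D1: "D = 1"
    proof (cases "r = 0")
      case True
      then have "v = (D * fst w, D * snd w)" using Dw by (simp add: prod_eq_iff)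
      then show ?thesis using primitive_multiple[of v D w] D by auto
    next
      case False
      \<comment> \<open>A convex combination: the coefficient of the origin is nonnegative because
        \<open>r + 1 \<le> D\<close>.\<close>
      have "lvec w = (of_int r / of_int D) *\<^sub>R lvec u + (1 / of_int D) *\<^sub>R lvec v + (1 - of_int (r + 1) / of_int D) *\<^sub>R 0"
      proof -
        have "real_of_int D * of_int (fst w) = of_int r * of_int (fst u) + of_int (fst v)"
          "real_of_int D * of_int (snd w) = of_int r * of_int (snd u) + of_int (snd v)"
          using arg_cong[OF Dw(1), of real_of_int] arg_cong[OF Dw(2), of real_of_int] by simp_all
        then show ?thesis using D by (simp add: lvec_def field_simps)
      qed
      also have "\<dots> \<in> convex hull {lvec u, lvec v, 0}"
      proof -
        have "0 \<le> real_of_int r / of_int D" "0 \<le> 1 / real_of_int D"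
          "0 \<le> 1 - real_of_int (r + 1) / of_int D" using r D by (simp_all del: of_int_add)
        moreover have "real_of_int r / of_int D + 1 / of_int D + (1 - of_int (r + 1) / of_int D) = 1"
          by (simp add: add_divide_distrib)
        ultimately show ?thesis unfolding convex_hull_3 by blast
      qed
      also have "\<dots> \<subseteq> Q"
        using polygon_basics[OF Q] u D by (intro hull_minimal) auto
      finally have "lvec w \<in> Q" .
      moreover have "primitive w" unfolding primitive_iff
        by (rule exI[of _ "- u"]) (use w(1) cross_swap[of w u] in simp)
      ultimately have "w \<in> S" using w(1) by (simp add: S_def)
      then have "0 \<le> cross v w" using v by blast
      then show ?thesis using False r cross_swap[of v w] by (simp add: r_def)
    qed
    have "\<not> lies_between u w v" if "w \<in> ?U" for w
    proof
      assume b: "lies_between u w v"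
      then have "w \<in> S" using that by (simp add: S_def lies_between_def)
      then have "0 \<le> cross v w" using v by blast
      then show False using b cross_swap[of v w] by (simp add: lies_between_def)
    qed
    then have "is_next ?U u v" using D D1 by (simp add: is_next_def D_def)
    then show ?thesis by blast
  qed
  then show ?thesis using fin ne unfolding smooth_cycle_def by blast
qed

text \<open>The combinatorial data of the minimal resolution: a smooth cycle through the vertices of least
  cardinality. Away from the vertices it has no \<open>(-1)\<close>-curves.\<close>

lemma minimal_cycle:
  obtains U where "smooth_cycle U" "vertices Q \<subseteq> U" "lvec ` U \<subseteq> Q"
    "\<And>u. u \<in> U - vertices Q \<Longrightarrow> cross (prv U u) (nxt U u) \<noteq> 1"
proof -
  define P where "P U \<longleftrightarrow> smooth_cycle U \<and> vertices Q \<subseteq> U \<and> lvec ` U \<subseteq> Q" for U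
  have "P {u. primitive u \<and> lvec u \<in> Q}"
    unfolding P_def using primitive_points_cycle primitive_vertex[OF Q] vertex_in[OF Q] by auto
  then obtain U where U: "P U" "\<And>U'. P U' \<Longrightarrow> card U \<le> card U'"
    using ex_has_least_nat[of P _ card] by blast
  show ?thesis
  proof (rule that)
    show cyc: "smooth_cycle U" "vertices Q \<subseteq> U" "lvec ` U \<subseteq> Q" using U(1) by (simp_all add: P_def)
    fix u assume u: "u \<in> U - vertices Q"
    show "cross (prv U u) (nxt U u) \<noteq> 1"
    proof
      assume "cross (prv U u) (nxt U u) = 1"
      then have "smooth_cycle (U - {u})" using smooth_cycle_remove[OF cyc(1)] u by blast
      then have "P (U - {u})" using cyc u by (auto simp: P_def)
      then have "card U \<le> card (U - {u})" by (rule U(2))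
      moreover have "card (U - {u}) < card U"
        using u finite_cycle[OF cyc(1)] by (intro psubset_card_mono) auto
      ultimately show False by simp
    qed
  qed
qed

text \<open>A ray that is not a vertex lies strictly inside the cone, since the boundary half-lines
  carry no rays of the cycle other than the vertices \<open>a\<close> and \<open>b\<close>. Its
  neighbours cannot pass \<open>a\<close> or \<open>b\<close>, which are themselves in the
  cycle.\<close>

lemma cone2_neighbours:
  assumes U: "smooth_cycle U" "vertices Q \<subseteq> U" and u: "u \<in> U" "u \<notin> vertices Q"
    and e: "edge Q a b" "lvec u \<in> cone2 a b"
  shows "lvec (prv U u) \<in> cone2 a b" "lvec (nxt U u) \<in> cone2 a b"
proof -
  define p where "p = prv U u"
  define n where "n = nxt U u"
  have pn: "cross p u = 1" "cross u n = 1" using cross_prv[OF U(1) u(1)] cross_nxt[OF U(1) u(1)] by (simp_all add: p_def n_def)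
  have ab: "a \<in> vertices Q" "b \<in> vertices Q" "0 < cross a b" using e by (auto simp: edge_def)
  then have abU: "a \<in> U" "b \<in> U" using U by auto
  have ge: "0 \<le> cross a u" "0 \<le> cross u b" using e by (auto simp: cone2_def)
  have au: "0 < cross a u"
  proof (rule ccontr)
    assume "\<not> 0 < cross a u"
    then have "a = u \<or> a = - u" using ge cycle_parallel[OF U(1) u(1) abU(1)] by simp
    then show False using ab u ge by auto
  qed
  have ub: "0 < cross u b"
  proof (rule ccontr)
    assume "\<not> 0 < cross u b"
    then have "b = u \<or> b = - u" using ge cycle_parallel[OF U(1) u(1) abU(2)] cross_swap[of u b] by simp
    then show False using ab u ge by auto
  qed
  have ap: "0 \<le> cross a p"
    using not_between_prv[OF U(1) u(1) abU(1)] au cross_swap[of a p] by (auto simp: lies_between_def p_def)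
  have nb: "0 \<le> cross n b"
    using not_between_nxt[OF U(1) u(1) abU(2)] ub cross_swap[of n b] by (auto simp: lies_between_def n_def)
  have "0 < cross a b * cross p u" using ab pn by simp
  moreover have "0 \<le> cross a p * cross u b" using ap ub by simp
  ultimately have "0 < cross a u * cross p b" using cross_pluecker[of a b p u] by linarith
  then have pb: "0 < cross p b" using au by (simp add: zero_less_mult_iff)
  have "0 < cross a b * cross u n" using ab pn by simp
  moreover have "0 \<le> cross a u * cross n b" using au nb by simp
  ultimately have "0 < cross a n * cross u b" using cross_pluecker[of a b u n] by linarith
  then have an: "0 < cross a n" using ub by (simp add: zero_less_mult_iff)
  show "lvec (prv U u) \<in> cone2 a b" "lvec (nxt U u) \<in> cone2 a b"
    using ap pb an nb by (simp_all add: cone2_def flip: p_def n_def)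
qed

text \<open>Of three points on a line one lies between the other two, so it is not extreme.\<close>

lemma vertices_on_line:
  assumes "m \<noteq> 0" shows "card {v \<in> vertices Q. dot m v = h} \<le> 2"
proof (rule ccontr)
  assume "\<not> ?thesis"
  then have "3 \<le> card {v \<in> vertices Q. dot m v = h}" by simp
  then obtain T where T: "T \<subseteq> {v \<in> vertices Q. dot m v = h}" "card T = 3"
    by (meson obtain_subset_with_card_n)
  then obtain x y z where xyz: "T = {x, y, z}" "x \<noteq> y" "x \<noteq> z" "y \<noteq> z"
    by (auto simp: card_3_iff)
  have V: "x \<in> vertices Q" "y \<in> vertices Q" "z \<in> vertices Q" using T xyz by auto
  have d: "dot m x = h" "dot m y = h" "dot m z = h" using T xyz by auto
  have "collinear {lvec x, lvec y, lvec z}"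
  proof -
    define c where "c = lvec m"
    have c: "c \<noteq> 0" using assms by (simp add: c_def)
    have "\<exists>t. p - q = t *\<^sub>R (- snd c, fst c)" if "c \<bullet> p = c \<bullet> q" for p q
    proof -
      define w where "w = p - q"
      have "fst c * fst w + snd c * snd w = 0" using that by (simp add: w_def inner_prod_def algebra_simps)
      moreover define N where "N = (fst c)\<^sup>2 + (snd c)\<^sup>2"
      moreover define K where "K = fst c * snd w - snd c * fst w"
      moreover have "fst w * N = K * (- snd c) + fst c * (fst c * fst w + snd c * snd w)"
         "snd w * N = K * fst c + snd c * (fst c * fst w + snd c * snd w)"
        by (simp_all add: N_def K_def algebra_simps power2_eq_square)
      moreover have "N \<noteq> 0" using c by (simp add: N_def prod_eq_iff sum_power2_eq_zero_iff)
      ultimately have "w = (K / N) *\<^sub>R (- snd c, fst c)"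
        by (simp add: prod_eq_iff field_simps del: mult_eq_0_iff)
      then show ?thesis unfolding w_def by blast
    qed
    moreover have "c \<bullet> p = of_int h" if "p \<in> {lvec x, lvec y, lvec z}" for p
      using that d by (auto simp: c_def)
    ultimately show ?thesis unfolding collinear_def by metis
  qed
  then consider "lvec x \<in> open_segment (lvec y) (lvec z)" | "lvec y \<in> open_segment (lvec z) (lvec x)"
    | "lvec z \<in> open_segment (lvec x) (lvec y)"
    using xyz unfolding collinear_between_cases between_mem_segment open_segment_def by auto
  then show False
    using V vertex_in[OF Q] unfolding vertices_def mem_Collect_eq extreme_point_of_def by cases blast+
qed

text \<open>A vertex in the cone is \<open>c y\<close> with \<open>y\<close> in \<open>Q\<close> on
  the line of the edge. The supporting inequality gives \<open>c \<le> 1\<close>, and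
  \<open>c < 1\<close> would put the vertex inside the segment from the origin to
  \<open>y\<close>.\<close>

lemma vertex_in_cone2:
  assumes e: "edge Q a b" and m: "dot m a = l" "dot m b = l" and l: "0 < l"
    and v: "v \<in> vertices Q" "lvec v \<in> cone2 a b"
  shows "dot m v = l"
proof -
  have v0: "lvec v \<noteq> 0" using primitive_vertex[OF Q v(1)] by (auto simp: primitive_def)
  obtain c y where y: "0 \<le> c" "y \<in> Q" "lvec v = c *\<^sub>R y" "lvec m \<bullet> y = of_int l"
    using edge_support(2)[OF Q e m _ v(2)] l by auto
  have y0: "c \<noteq> 0" "y \<noteq> 0" using y v0 by auto
  have "c = 1"
  proof (rule ccontr)
    assume c1: "c \<noteq> 1"
    have "real_of_int (dot m v) = c * of_int l"
      by (subst lvec_inner_lvec[symmetric]) (simp add: y(3,4))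
    moreover have "lvec m \<bullet> lvec v \<le> of_int l" using edge_support(1)[OF Q e m _ vertex_in[OF Q v(1)]] l by simp
    ultimately have "c * of_int l \<le> 1 * of_int l" by simp
    then have "c < 1" using c1 l by (simp add: mult_le_cancel_right)
    then have "lvec v \<in> open_segment 0 y" using y y0 by (auto simp: in_segment intro!: exI[of _ c])
    then show False
      using v(1) y(2) polygon_basics(7)[OF Q] unfolding vertices_def mem_Collect_eq extreme_point_of_def by blast
  qed
  then have "real_of_int (dot m v) = of_int l"
    by (subst lvec_inner_lvec[symmetric]) (simp add: y(3,4))
  then show ?thesis by simp
qed

lemma polygon_cycle_bound:
  assumes l: "1 \<le> l" and edges: "\<And>a b. edge Q a b \<Longrightarrow> \<exists>m. dot m a = l \<and> dot m b = l"
  obtains U where "smooth_cycle U" "vertices Q \<subseteq> U"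
    "int (card U) - 2 \<le> (if l = 1 then 7 else 8 * l\<^sup>2 - 6 * l + 3)"
proof -
  let ?V = "vertices Q"
  obtain U where U: "smooth_cycle U" "?V \<subseteq> U" "lvec ` U \<subseteq> Q"
    and min: "\<And>u. u \<in> U - ?V \<Longrightarrow> cross (prv U u) (nxt U u) \<noteq> 1"
    using minimal_cycle by blast
  obtain m where m: "\<And>a b. edge Q a b \<Longrightarrow> dot (m a b) a = l \<and> dot (m a b) b = l"
    using edges by metis
  have le: "dot (m a b) u \<le> l" if "edge Q a b" "lvec u \<in> Q" for a b u
    using edge_support(1)[OF Q that(1), of "m a b" l "lvec u"] m[OF that(1)] l that(2) by simp
  have in_cone: "\<exists>c y. 0 \<le> c \<and> y \<in> Q \<and> x = c *\<^sub>R y \<and> lvec (m a b) \<bullet> y = of_int l"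
    if "edge Q a b" "x \<in> cone2 a b" for a b x
    using edge_support(2)[OF Q that(1), of "m a b" l x] m[OF that(1)] l that(2) by simp
  \<comment> \<open>On its own cone an edge functional is the largest of all. Hence two functionals
    agree where their cones overlap, and the function \<open>h\<close> defined next does not depend
    on the edge.\<close>
  have max: "dot (m a' b') u \<le> dot (m a b) u" if e: "edge Q a b" "lvec u \<in> cone2 a b" "edge Q a' b'" for a b a' b' u
  proof -
    obtain c y where y: "0 \<le> c" "y \<in> Q" "lvec u = c *\<^sub>R y" "lvec (m a b) \<bullet> y = of_int l"
      using in_cone[OF e(1,2)] by blast
    have "lvec (m a' b') \<bullet> y \<le> of_int l"
      using edge_support(1)[OF Q e(3), of "m a' b'" l y] m[OF e(3)] l y by simp
    then have "lvec (m a' b') \<bullet> lvec u \<le> lvec (m a b) \<bullet> lvec u"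
      using y by (simp add: mult_left_mono)
    then show ?thesis by simp
  qed
  define h where "h u = (THE k. \<exists>a b. edge Q a b \<and> lvec u \<in> cone2 a b \<and> k = dot (m a b) u)" for u
  have h: "h u = dot (m a b) u" if e: "edge Q a b" "lvec u \<in> cone2 a b" for a b u
    unfolding h_def
  proof (rule the_equality)
    show "\<exists>a' b'. edge Q a' b' \<and> lvec u \<in> cone2 a' b' \<and> dot (m a b) u = dot (m a' b') u" using e by blast
    show "k = dot (m a b) u" if "\<exists>a b. edge Q a b \<and> lvec u \<in> cone2 a b \<and> k = dot (m a b) u" for k
      using that max e by (meson order_antisym)
  qed
  have U0: "lvec u \<noteq> 0" if "u \<in> U" for u using cross_nxt[OF U(1) that] by auto
  have hpos: "1 \<le> h u" if u: "u \<in> U" for u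
  proof -
    obtain a b where e: "edge Q a b" "lvec u \<in> cone2 a b" using cone2_cover[OF Q U0[OF u]] by blast
    obtain c y where y: "0 \<le> c" "lvec u = c *\<^sub>R y" "lvec (m a b) \<bullet> y = of_int l" using in_cone[OF e] by blast
    have "c \<noteq> 0" using y U0[OF u] by auto
    then have "0 < lvec (m a b) \<bullet> lvec u" using y l by simp
    then show ?thesis using h[OF e] by simp
  qed
  have dot_three: "dot k (prv U u) + dot k (nxt U u) = cross (prv U u) (nxt U u) * dot k u" if "u \<in> U" for u k
    using three_term[OF cross_prv[OF U(1) that] cross_nxt[OF U(1) that], of "(snd k, - fst k)"]
    by (simp add: dot_def cross_def algebra_simps)
  have lin: "h (prv U u) + h (nxt U u) = cross (prv U u) (nxt U u) * h u" if u: "u \<in> U - ?V" for u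
  proof -
    obtain a b where e: "edge Q a b" "lvec u \<in> cone2 a b" using cone2_cover[OF Q U0] u by blast
    show ?thesis
      using dot_three[of u "m a b"] h[OF e] u h[OF e(1)] cone2_neighbours[OF U(1,2) _ _ e] by auto
  qed
  \<comment> \<open>Positivity of \<open>h\<close> in the linear relation gives
    \<open>b > 0\<close>, and minimality excludes \<open>b = 1\<close>.\<close>
  have b2: "2 \<le> cross (prv U u) (nxt U u)" if u: "u \<in> U - ?V" for u
  proof -
    have "0 < h (prv U u) + h (nxt U u)" "0 < h u"
      using hpos[of u] hpos[OF prv_in[OF U(1), of u]] hpos[OF nxt_in[OF U(1), of u]] u by auto
    then have "0 < cross (prv U u) (nxt U u)" using lin[OF u] by (simp add: zero_less_mult_iff)
    then show ?thesis using min[OF u] by linarith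
  qed
  have vertex_edge: "\<exists>a b. edge Q a b \<and> lvec v \<in> cone2 a b \<and> dot (m a b) v = l" if v: "v \<in> ?V" for v
  proof -
    have "lvec v \<noteq> 0" using U0 U(2) v by blast
    then obtain a b where e: "edge Q a b" "lvec v \<in> cone2 a b" using cone2_cover[OF Q] by blast
    have "dot (m a b) v = l" using vertex_in_cone2[OF e(1) _ _ _ v e(2)] m[OF e(1)] l by simp
    then show ?thesis using e by blast
  qed
  have hV: "h v = l" if "v \<in> ?V" for v using vertex_edge[OF that] h by metis
  \<comment> \<open>Some edge functional takes its maximum over \<open>Q\<close> at
    \<open>v\<close>, so \<open>b l \<le> 2 l\<close>. The remaining value \<open>b = 2\<close>
    would make \<open>v\<close> the midpoint of its neighbours, which are points of
    \<open>Q\<close>.\<close>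
  have conv: "cross (prv U v) (nxt U v) \<le> 1" if v: "v \<in> ?V" for v
  proof (rule ccontr)
    assume b: "\<not> ?thesis"
    define p where "p = prv U v"
    define n where "n = nxt U v"
    have vU: "v \<in> U" using v U by auto
    have pn: "lvec p \<in> Q" "lvec n \<in> Q" using prv_in[OF U(1) vU] nxt_in[OF U(1) vU] U(3) by (auto simp: p_def n_def)
    obtain a b where e: "edge Q a b" "dot (m a b) v = l" using vertex_edge[OF v] by blast
    have "cross p n * l \<le> 2 * l"
      using dot_three[OF vU, of "m a b"] e le[OF e(1) pn(1)] le[OF e(1) pn(2)] by (simp flip: p_def n_def)
    then have b2: "cross p n = 2" using b l by (simp add: mult_le_cancel_right flip: p_def n_def)
    have "cross (lvec p) (lvec v) = 1" "cross (lvec v) (lvec n) = 1"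
      using cross_prv[OF U(1) vU] cross_nxt[OF U(1) vU] by (simp_all add: p_def n_def)
    then have t: "cross q (lvec p) + cross q (lvec n) = 2 * cross q (lvec v)" for q
      using three_term[of "lvec p" "lvec v" "lvec n" q] b2 by simp
    have "lvec p + lvec n = 2 *\<^sub>R lvec v"
      using t[of "(1, 0)"] t[of "(0, 1)"] by (simp add: cross_def prod_eq_iff)
    then have "lvec v = midpoint (lvec p) (lvec n)" by (simp add: midpoint_def)
    moreover have "p \<noteq> n" using b2 by auto
    ultimately have "lvec v \<in> open_segment (lvec p) (lvec n)" by simp
    then show False using v pn unfolding vertices_def mem_Collect_eq extreme_point_of_def by blast
  qed
  have card: "int (card U) \<le> 12 + (2 * l - 3) * int (card ?V)"
    by (rule cycle_card_bound[OF U(1,2) hV hpos lin b2 conv])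
  have "int (card ?V) \<le> 4 * l + 2"
  proof -
    define s where "s = (\<Sum>v\<in>?V. v)"
    \<comment> \<open>If the vertices add up to zero, the functional of any edge will do, and
      \<open>(1, 0)\<close> is an arbitrary direction that selects one.\<close>
    define x :: "real \<times> real" where "x = (if s = 0 then (1, 0) else lvec s)"
    have "(1, 0) \<noteq> (0 :: real \<times> real)" by (simp add: prod_eq_iff)
    then have x: "x \<noteq> 0" "s \<noteq> 0 \<longrightarrow> x = lvec s" by (simp_all add: x_def)
    obtain a b where e: "edge Q a b" "x \<in> cone2 a b" using cone2_cover[OF Q x(1)] by blast
    have "0 \<le> dot (m a b) s"
    proof (cases "s = 0")
      case False
      then have s: "x = lvec s" using x by simp
      obtain c y where "0 \<le> c" "x = c *\<^sub>R y" "lvec (m a b) \<bullet> y = of_int l"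
        using in_cone[OF e] by blast
      then have "0 \<le> lvec (m a b) \<bullet> x" using l by simp
      then show ?thesis unfolding s by simp
    qed (simp add: dot_def)
    then have sum: "0 \<le> (\<Sum>v\<in>?V. dot (m a b) v)" by (simp add: s_def dot_sum)
    have m0: "m a b \<noteq> 0" using m[OF e(1)] l by (auto simp: dot_def)
    show ?thesis
      by (rule card_bound_of_heights[OF finite_vertices[OF Q] _ _ vertices_on_line[OF m0] sum])
        (use le[OF e(1) vertex_in[OF Q]] l in auto)
  qed
  then have "int (card U) - 2 \<le> (if l = 1 then 7 else 8 * l\<^sup>2 - 6 * l + 3)"
    using card_bound_arith[OF l card] card_vertices[OF Q] by simp
  then show ?thesis using that U by blast
qed

end

section \<open>Plane fans\<close>

definition cone_of :: "(int \<times> int) set \<Rightarrow> (real \<times> real) set" where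
  "cone_of B = convex_cone hull (lvec ` B)"

lemma convex_cone_cone_of: "convex_cone (cone_of B)"
  by (simp add: cone_of_def convex_cone_convex_cone_hull)

lemma convex_cone_of: "convex (cone_of B)"
  by (simp add: cone_of_def convex_convex_cone_hull)

lemma cone_of_mono: "B \<subseteq> C \<Longrightarrow> cone_of B \<subseteq> cone_of C"
  by (simp add: cone_of_def hull_mono image_mono)

lemma cone_of_inc: "b \<in> B \<Longrightarrow> lvec b \<in> cone_of B"
  by (simp add: cone_of_def hull_inc)

lemma cone_of_empty [simp]: "cone_of {} = {0}"
  by (simp add: cone_of_def convex_cone_hull_empty)

lemma cone_of_singleton: "x \<in> cone_of {u} \<longleftrightarrow> (\<exists>c\<ge>0. x = c *\<^sub>R lvec u)"
proof
  assume "x \<in> cone_of {u}"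
  then have "x \<in> convex_cone hull {lvec u, lvec u}" by (simp add: cone_of_def)
  then obtain \<alpha> \<beta> where "0 \<le> \<alpha>" "0 \<le> \<beta>" "x = \<alpha> *\<^sub>R lvec u + \<beta> *\<^sub>R lvec u"
    unfolding convex_cone_hull_pair by blast
  then have "0 \<le> \<alpha> + \<beta> \<and> x = (\<alpha> + \<beta>) *\<^sub>R lvec u" by (simp add: scaleR_left_distrib)
  then show "\<exists>c\<ge>0. x = c *\<^sub>R lvec u" by blast
next
  assume "\<exists>c\<ge>0. x = c *\<^sub>R lvec u"
  then show "x \<in> cone_of {u}"
    using convex_cone_scaleR[OF convex_cone_cone_of] cone_of_inc[of u "{u}"] by blast
qed

lemma cone_of_pair: "0 < cross a b \<Longrightarrow> cone_of {a, b} = cone2 a b"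
  by (simp only: cone_of_def cone2_eq_hull)

text \<open>Handles a two-dimensional cone and all its faces at once: a missing generator becomes a
  vanishing coordinate.\<close>

lemma cone_of_subset_pair:
  assumes ab: "0 < cross a b" and B: "B \<subseteq> {a, b}"
  shows "cone_of B = {x \<in> cone2 a b. (a \<notin> B \<longrightarrow> cross x (lvec b) = 0) \<and> (b \<notin> B \<longrightarrow> cross (lvec a) x = 0)}"
proof -
  have ab': "a \<noteq> b" "cross (lvec a) (lvec b) \<noteq> 0" "0 < cross (lvec a) (lvec b)" using ab by auto
  note x_eq = cross_combination[OF ab'(2)]
  consider "B = {a, b}" | "B = {a}" | "B = {b}" | "B = {}" using B by blast
  then show ?thesis
  proof cases
    case 1
    then show ?thesis using cone_of_pair[OF ab] by auto
  next
    case 2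
    have "x \<in> cone_of {a} \<longleftrightarrow> x \<in> cone2 a b \<and> cross (lvec a) x = 0" for x
    proof
      assume "x \<in> cone_of {a}"
      then obtain c where "0 \<le> c" "x = c *\<^sub>R lvec a" unfolding cone_of_singleton by blast
      then show "x \<in> cone2 a b \<and> cross (lvec a) x = 0" using ab by (simp add: cone2_def)
    next
      assume x: "x \<in> cone2 a b \<and> cross (lvec a) x = 0"
      then have "x = (cross x (lvec b) / cross (lvec a) (lvec b)) *\<^sub>R lvec a" using x_eq[of x] by simp
      moreover have "0 \<le> cross x (lvec b) / cross (lvec a) (lvec b)" using x ab' by (simp add: cone2_def)
      ultimately show "x \<in> cone_of {a}" unfolding cone_of_singleton by blast
    qed
    then show ?thesis using 2 ab' by auto
  next
    case 3
    have "x \<in> cone_of {b} \<longleftrightarrow> x \<in> cone2 a b \<and> cross x (lvec b) = 0" for x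
    proof
      assume "x \<in> cone_of {b}"
      then obtain c where "0 \<le> c" "x = c *\<^sub>R lvec b" unfolding cone_of_singleton by blast
      then show "x \<in> cone2 a b \<and> cross x (lvec b) = 0" using ab by (simp add: cone2_def)
    next
      assume x: "x \<in> cone2 a b \<and> cross x (lvec b) = 0"
      then have "x = (cross (lvec a) x / cross (lvec a) (lvec b)) *\<^sub>R lvec b" using x_eq[of x] by simp
      moreover have "0 \<le> cross (lvec a) x / cross (lvec a) (lvec b)" using x ab' by (simp add: cone2_def)
      ultimately show "x \<in> cone_of {b}" unfolding cone_of_singleton by blast
    qed
    then show ?thesis using 3 ab' by auto
  next
    case 4
    have "x = 0" if "cross x (lvec b) = 0" "cross (lvec a) x = 0" for x
      using x_eq[of x] that by simp
    then show ?thesis using 4 by (auto simp: cone2_def)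
  qed
qed

text \<open>A nonzero \<open>x\<close> of the face is strictly between \<open>0\<close> and
  \<open>c x\<close> when \<open>c > 1\<close>, so both are in the face; the smaller multiples
  follow by convexity.\<close>

lemma convex_cone_face:
  fixes S :: "'a::real_vector set"
  assumes S: "convex_cone S" and T: "T face_of S" "T \<noteq> {}"
  shows "convex_cone T"
proof -
  have cv: "convex T" and sub: "T \<subseteq> S" using face_of_imp_convex[OF T(1)] face_of_imp_subset[OF T(1)] by simp_all
  have seg: "p \<in> T" "q \<in> T" if "p \<in> S" "q \<in> S" "x \<in> T" "x \<in> open_segment p q" for p q x
    using that T(1) unfolding face_of_def by blast+
  have Sc: "c *\<^sub>R x \<in> S" if "x \<in> T" "0 \<le> c" for c x using that sub S convex_cone_scaleR by blast
  have big: "c *\<^sub>R x \<in> T" "0 \<in> T" if x: "x \<in> T" "x \<noteq> 0" "1 < c" for c :: real and x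
  proof -
    have "x \<in> open_segment 0 (c *\<^sub>R x)"
      using x by (auto simp: in_segment intro!: exI[of _ "1 / c"])
    then show "c *\<^sub>R x \<in> T" "0 \<in> T"
      using seg[of 0 "c *\<^sub>R x" x] Sc[of x c] x S convex_cone_contains_0 by auto
  qed
  have "c *\<^sub>R x \<in> T" if x: "x \<in> T" "0 \<le> c" for c :: real and x
  proof (cases "x = 0 \<or> c = 1")
    case False
    then have 0: "0 \<in> T" using big[of x 2] x by simp
    show ?thesis
    proof (cases "1 < c")
      case True
      then show ?thesis using big[of x c] x False by blast
    next
      case c: False
      have "(1 - c) *\<^sub>R 0 + c *\<^sub>R x \<in> T"
        using c x by (intro convexD_alt[OF cv 0]) auto
      then show ?thesis by simp
    qed
  qed (use x in auto)
  then show ?thesis using cv T(2) by (simp add: convex_cone_def conic_def)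
qed

text \<open>Dropping a generator amounts to intersecting with a supporting line, and intersections
  of faces are faces.\<close>

lemma face_of_cone_of:
  assumes ab: "0 < cross a b" and B: "B \<subseteq> C" "C \<subseteq> {a, b}"
  shows "cone_of B face_of cone_of C"
proof -
  have "cone_of B face_of cone2 a b"
  proof -
    have cv: "convex (cone2 a b)" using convex_cone_of[of "{a, b}"] by (simp add: cone_of_pair[OF ab])
    have 1: "cone2 a b \<inter> {x. (snd (lvec b), - fst (lvec b)) \<bullet> x = 0} face_of cone2 a b"
      by (rule face_of_Int_supporting_hyperplane_ge[OF cv])
        (unfold cross_eq_inner[symmetric], simp add: cone2_def)
    have neg: "cross (lvec a) x = (- snd (lvec a), fst (lvec a)) \<bullet> x" for x
      using cross_eq_inner[of x "lvec a"] cross_swap[of "lvec a" x] by (simp add: inner_prod_def)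
    have 2: "cone2 a b \<inter> {x. (- snd (lvec a), fst (lvec a)) \<bullet> x = 0} face_of cone2 a b"
      by (rule face_of_Int_supporting_hyperplane_ge[OF cv])
        (unfold neg[symmetric], simp add: cone2_def)
    let ?P = "if a \<in> B then cone2 a b else cone2 a b \<inter> {x. cross x (lvec b) = 0}"
    let ?R = "if b \<in> B then cone2 a b else cone2 a b \<inter> {x. cross (lvec a) x = 0}"
    have "?P face_of cone2 a b" "?R face_of cone2 a b"
      using 1 2 face_of_refl[OF cv] by (simp_all flip: cross_eq_inner neg)
    then have "?P \<inter> ?R face_of cone2 a b" by (rule face_of_Int)
    moreover have "?P \<inter> ?R = cone_of B" using cone_of_subset_pair[OF ab, of B] B by auto
    ultimately show ?thesis by simp
  qed
  moreover have "cone_of C \<subseteq> cone2 a b" using cone_of_mono[OF B(2)] by (simp add: cone_of_pair[OF ab])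
  ultimately show ?thesis using face_of_subset cone_of_mono[OF B(1)] by blast
qed

text \<open>If \<open>\<alpha> a + \<beta> b\<close> is in the face, so are
  \<open>2 \<alpha> a\<close> and \<open>2 \<beta> b\<close>, of which it is the midpoint. Hence the
  face is spanned by the generators that it contains.\<close>

lemma faces_of_cone_of:
  assumes ab: "0 < cross a b" and C: "C \<subseteq> {a, b}" and T: "T face_of cone_of C" "T \<noteq> {}"
  shows "\<exists>B\<subseteq>C. T = cone_of B"
proof -
  define B where "B = {w \<in> {a, b}. lvec w \<in> T}"
  have cT: "convex_cone T" by (rule convex_cone_face[OF convex_cone_cone_of T])
  have "cone_of B \<subseteq> T" unfolding cone_of_def by (rule hull_minimal) (auto simp: B_def cT)
  have TC: "T \<subseteq> cone_of C" using T face_of_imp_subset by blast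
  have Tface: "T face_of cone2 a b"
    using face_of_trans[OF T(1)] face_of_cone_of[OF ab C order_refl] cone_of_pair[OF ab] by metis
  have ab': "cross (lvec a) (lvec b) \<noteq> 0" "0 < cross (lvec a) (lvec b)" using ab by auto
  have "x \<in> cone_of B" if x: "x \<in> T" for x
  proof -
    have xc: "x \<in> cone2 a b" using x Tface face_of_imp_subset by blast
    define \<alpha> where "\<alpha> = cross x (lvec b) / cross (lvec a) (lvec b)"
    define \<beta> where "\<beta> = cross (lvec a) x / cross (lvec a) (lvec b)"
    have xe: "x = \<alpha> *\<^sub>R lvec a + \<beta> *\<^sub>R lvec b" using cross_combination[OF ab'(1), of x] by (simp add: \<alpha>_def \<beta>_def)
    have ge: "0 \<le> \<alpha>" "0 \<le> \<beta>" using xc ab' by (simp_all add: \<alpha>_def \<beta>_def cone2_def)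
    have both: "(2 * \<alpha>) *\<^sub>R lvec a \<in> T \<and> (2 * \<beta>) *\<^sub>R lvec b \<in> T" if "\<alpha> \<noteq> 0 \<or> \<beta> \<noteq> 0"
    proof -
      let ?p = "(2 * \<alpha>) *\<^sub>R lvec a" and ?q = "(2 * \<beta>) *\<^sub>R lvec b"
      have "cross ?p (lvec b) \<noteq> cross ?q (lvec b) \<or> cross (lvec a) ?p \<noteq> cross (lvec a) ?q"
        using that ab' by simp
      then have "?p \<noteq> ?q" by metis
      moreover have "x = midpoint ?p ?q" by (simp add: xe midpoint_def algebra_simps)
      ultimately have "x \<in> open_segment ?p ?q" by simp
      moreover have "?p \<in> cone2 a b" "?q \<in> cone2 a b" using ge ab' by (simp_all add: cone2_def)
      ultimately show ?thesis using Tface x unfolding face_of_def by blast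
    qed
    have "a \<in> B" if "\<alpha> \<noteq> 0"
      using convex_cone_scaleR[OF cT, of "1 / (2 * \<alpha>)" "(2 * \<alpha>) *\<^sub>R lvec a"] both that ge by (simp add: B_def)
    moreover have "b \<in> B" if "\<beta> \<noteq> 0"
      using convex_cone_scaleR[OF cT, of "1 / (2 * \<beta>)" "(2 * \<beta>) *\<^sub>R lvec b"] both that ge by (simp add: B_def)
    moreover have "B \<subseteq> {a, b}" by (auto simp: B_def)
    ultimately show ?thesis
      using xc ab' by (auto simp: cone_of_subset_pair[OF ab] \<alpha>_def \<beta>_def)
  qed
  then have "T = cone_of B" using \<open>cone_of B \<subseteq> T\<close> by blast
  moreover have "B \<subseteq> C"
  proof
    fix w assume w: "w \<in> B"
    then have "lvec w \<in> cone_of C" "w \<in> {a, b}" using TC by (auto simp: B_def)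
    then show "w \<in> C" using ab by (auto simp: cone_of_subset_pair[OF ab C])
  qed
  ultimately show ?thesis by blast
qed

lemma cone_of_pointed:
  assumes ab: "0 < cross a b" and B: "B \<subseteq> {a, b}"
  shows "cone_of B \<inter> uminus ` cone_of B = {0}"
proof -
  have "x = 0" if "x \<in> cone2 a b" "- x \<in> cone2 a b" for x
  proof -
    have "cross (lvec a) x = 0" "cross x (lvec b) = 0" using that by (auto simp: cone2_def)
    then show ?thesis using cross_combination[of "lvec a" "lvec b" x] ab by simp
  qed
  moreover have "cone_of B \<subseteq> cone2 a b" using cone_of_mono[OF B] by (simp add: cone_of_pair[OF ab])
  moreover have "0 \<in> cone_of B" using convex_cone_contains_0[OF convex_cone_cone_of] .
  moreover have neg: "- x \<in> cone_of B" if "x \<in> uminus ` cone_of B" for x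
    using that by (metis imageE minus_minus)
  ultimately have "x \<in> {0}" if "x \<in> cone_of B \<inter> uminus ` cone_of B" for x using that by blast
  moreover have "0 \<in> uminus ` cone_of B" using \<open>0 \<in> cone_of B\<close> by (metis imageI minus_zero)
  ultimately show ?thesis using \<open>0 \<in> cone_of B\<close> by blast
qed

lemma lattice_basis_cross:
  assumes "cross u v = 1" shows "lattice_basis u v"
  unfolding lattice_basis_def
proof (intro allI ex1I)
  fix w
  have e: "cross w v * fst u + cross u w * fst v = fst w * cross u v"
    "cross w v * snd u + cross u w * snd v = snd w * cross u v"
    by (simp_all add: cross_def algebra_simps)
  show "w = (fst (cross w v, cross u w) * fst u + snd (cross w v, cross u w) * fst v,
    fst (cross w v, cross u w) * snd u + snd (cross w v, cross u w) * snd v)"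
    using e assms by (simp add: prod_eq_iff)
  fix c assume w: "w = (fst c * fst u + snd c * fst v, fst c * snd u + snd c * snd v)"
  have "cross w v = fst c * cross u v" "cross u w = snd c * cross u v"
    by (simp_all add: w cross_def algebra_simps)
  then show "c = (cross w v, cross u w)" using assms by (simp add: prod_eq_iff)
qed

text \<open>Expressing the two unit vectors in the basis shows that the determinant is invertible
  among the integers.\<close>

lemma cross_lattice_basis:
  assumes "lattice_basis u v" shows "cross u v = 1 \<or> cross v u = 1"
proof -
  obtain c where c: "(1, 0) = (fst c * fst u + snd c * fst v, fst c * snd u + snd c * snd v)"
    using assms unfolding lattice_basis_def by blast
  obtain d where d: "(0, 1) = (fst d * fst u + snd d * fst v, fst d * snd u + snd d * snd v)"
    using assms unfolding lattice_basis_def by blast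
  have c': "fst c * fst u + snd c * fst v = 1" "fst c * snd u + snd c * snd v = 0" using c by simp_all
  have d': "fst d * fst u + snd d * fst v = 0" "fst d * snd u + snd d * snd v = 1" using d by simp_all
  have "cross c d * cross u v = (fst c * fst u + snd c * fst v) * (fst d * snd u + snd d * snd v) -
      (fst c * snd u + snd c * snd v) * (fst d * fst u + snd d * fst v)"
    by (simp add: cross_def algebra_simps)
  then have "cross c d * cross u v = 1" unfolding c' d' by simp
  then have "cross u v = 1 \<or> cross u v = - 1" by (auto simp: zmult_eq_1_iff)
  then show ?thesis using cross_swap[of v u] by auto
qed

text \<open>Taking all subsets \<open>B\<close> closes the set of cones under faces:
  \<open>B = {}\<close> gives the origin, singletons give the rays.\<close>

definition cycle_fan :: "(int \<times> int) set \<Rightarrow> (real \<times> real) set set" where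
  "cycle_fan U = cone_of ` {B. \<exists>u\<in>U. B \<subseteq> {u, nxt U u}}"

text \<open>The point to prove is that cones of different cells meet in a common face. By
  \<open>cell_unique\<close> a common nonzero point lies on a boundary ray of either cell, and a
  point determines its ray.\<close>

lemma fan_cycle_fan:
  assumes U: "smooth_cycle U" shows "fan (cycle_fan U)"
proof -
  let ?G = "{B. \<exists>u\<in>U. B \<subseteq> {u, nxt U u}}"
  have c: "0 < cross u (nxt U u)" if "u \<in> U" for u using cross_nxt[OF U that] by simp
  have "?G \<subseteq> Pow U" using nxt_in[OF U] by auto
  then have fin: "finite ?G" using finite_cycle[OF U] finite_subset by blast
  have ray: "\<exists>z\<in>B. x \<in> cone_of {z} \<and> x \<noteq> 0"
    if u: "u \<in> U" "B \<subseteq> {u, nxt U u}" and x: "x \<in> cone_of B" "x \<noteq> 0"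
      "\<not> (0 < cross (lvec u) x \<and> 0 < cross x (lvec (nxt U u)))" for u B x
  proof -
    note ch = cone_of_subset_pair[OF c[OF u(1)]]
    have ge: "x \<in> cone2 u (nxt U u)" "0 \<le> cross (lvec u) x" "0 \<le> cross x (lvec (nxt U u))"
      using x(1) unfolding ch[OF u(2)] by (auto simp: cone2_def)
    then consider "cross (lvec u) x = 0" "cross x (lvec (nxt U u)) \<noteq> 0"
      | "cross (lvec u) x \<noteq> 0" "cross x (lvec (nxt U u)) = 0"
      using x(2,3) cross_combination[of "lvec u" "lvec (nxt U u)" x] c[OF u(1)] by fastforce
    then show ?thesis
    proof cases
      case 1
      then have "u \<in> B" using x(1) unfolding ch[OF u(2)] by auto
      moreover have "x \<in> cone_of {u}" using ge 1 by (subst ch) auto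
      ultimately show ?thesis using x(2) by blast
    next
      case 2
      then have "nxt U u \<in> B" using x(1) unfolding ch[OF u(2)] by auto
      moreover have "x \<in> cone_of {nxt U u}" using ge 2 by (subst ch) auto
      ultimately show ?thesis using x(2) by blast
    qed
  qed
  have same: "z = z'" if z: "z \<in> U" "z' \<in> U" "x \<in> cone_of {z}" "x \<in> cone_of {z'}" "x \<noteq> 0" for z z' x
  proof -
    obtain k where k: "0 \<le> k" "x = k *\<^sub>R lvec z" using z(3) cone_of_singleton by blast
    obtain k' where k': "0 \<le> k'" "x = k' *\<^sub>R lvec z'" using z(4) cone_of_singleton by blast
    have pos: "0 < k" "0 < k'" using k k' z(5) by (auto simp: order.strict_iff_order)
    have "k * real_of_int (cross z z') = cross x (lvec z')" using k by simp
    also have "\<dots> = 0" using k' by simp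
    finally have "cross z z' = 0" using pos by simp
    then have "z = z' \<or> z = - z'" using cycle_parallel[OF U z(2,1)] by simp
    moreover have "z \<noteq> - z'"
    proof
      assume "z = - z'"
      then have "(k + k') *\<^sub>R lvec z' = 0" using k(2) k'(2) by (simp add: lvec_uminus scaleR_left_distrib)
      then have "lvec z' = 0" using pos by simp
      then show False using k' z(5) by simp
    qed
    ultimately show ?thesis by blast
  qed
  have inter: "cone_of B \<inter> cone_of B' = cone_of (B \<inter> B')" if B: "B \<in> ?G" "B' \<in> ?G" for B B'
  proof
    show "cone_of (B \<inter> B') \<subseteq> cone_of B \<inter> cone_of B'" using cone_of_mono by (simp add: cone_of_mono)
    obtain u where u: "u \<in> U" "B \<subseteq> {u, nxt U u}" using B by blast
    obtain w where w: "w \<in> U" "B' \<subseteq> {w, nxt U w}" using B by blast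
    show "cone_of B \<inter> cone_of B' \<subseteq> cone_of (B \<inter> B')"
    proof
      fix x assume x: "x \<in> cone_of B \<inter> cone_of B'"
      have xu: "0 \<le> cross (lvec u) x" "0 \<le> cross x (lvec (nxt U u))"
        using x unfolding cone_of_subset_pair[OF c[OF u(1)] u(2)] by (auto simp: cone2_def)
      have xw: "0 \<le> cross (lvec w) x" "0 \<le> cross x (lvec (nxt U w))"
        using x unfolding cone_of_subset_pair[OF c[OF w(1)] w(2)] by (auto simp: cone2_def)
      show "x \<in> cone_of (B \<inter> B')"
      proof (cases "u = w")
        case True
        have "B \<inter> B' \<subseteq> {u, nxt U u}" using u by auto
        then show ?thesis
          using x u w unfolding True by (auto simp: cone_of_subset_pair[OF c[OF w(1)]])
      next
        case False
        show ?thesis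
        proof (cases "x = 0")
          case True
          then show ?thesis using convex_cone_contains_0[OF convex_cone_cone_of] by simp
        next
          case x0: False
          obtain z where z: "z \<in> B" "x \<in> cone_of {z}"
            using ray[OF u _ x0] x cell_unique[OF U u(1) w(1) _ _ xw] False by blast
          obtain z' where z': "z' \<in> B'" "x \<in> cone_of {z'}"
            using ray[OF w _ x0] x cell_unique[OF U w(1) u(1) _ _ xu] False by blast
          have "z \<in> U" "z' \<in> U" using z z' u w nxt_in[OF U u(1)] nxt_in[OF U w(1)] by auto
          then have "z = z'" using same z z' x0 by blast
          then show ?thesis using z z' cone_of_mono[of "{z}" "B \<inter> B'"] by auto
        qed
      qed
    qed
  qed
  show ?thesis unfolding fan_def
  proof (intro conjI ballI allI impI)
    show "finite (cycle_fan U)" using fin by (simp add: cycle_fan_def)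
    show "cycle_fan U \<noteq> {}" using cycle_nonempty[OF U] by (auto simp: cycle_fan_def)
  next
    fix \<sigma> assume "\<sigma> \<in> cycle_fan U"
    then obtain B u where B: "\<sigma> = cone_of B" "u \<in> U" "B \<subseteq> {u, nxt U u}" by (auto simp: cycle_fan_def)
    then show "strongly_convex_rational_cone \<sigma>"
      unfolding strongly_convex_rational_cone_def
      using cone_of_pointed[OF c] finite_subset[OF B(3)] by (metis cone_of_def finite.emptyI finite.insertI)
    fix \<tau> assume "\<tau> face_of \<sigma> \<and> \<tau> \<noteq> {}"
    then obtain C where "C \<subseteq> B" "\<tau> = cone_of C" using faces_of_cone_of[OF c[OF B(2)] B(3)] B(1) by blast
    then show "\<tau> \<in> cycle_fan U" using B by (auto simp: cycle_fan_def)
  next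
    fix \<sigma> \<tau> assume "\<sigma> \<in> cycle_fan U" "\<tau> \<in> cycle_fan U"
    then obtain B C where BC: "\<sigma> = cone_of B" "\<tau> = cone_of C" "B \<in> ?G" "C \<in> ?G" unfolding cycle_fan_def by blast
    obtain u where u: "u \<in> U" "B \<subseteq> {u, nxt U u}" using BC(3) by blast
    obtain w where w: "w \<in> U" "C \<subseteq> {w, nxt U w}" using BC(4) by blast
    have "cone_of (B \<inter> C) face_of cone_of B" "cone_of (B \<inter> C) face_of cone_of C"
      using face_of_cone_of[OF c[OF u(1)] Int_lower1 u(2)] face_of_cone_of[OF c[OF w(1)] Int_lower2 w(2)] .
    then show "\<sigma> \<inter> \<tau> face_of \<sigma>" "\<sigma> \<inter> \<tau> face_of \<tau>" using inter[OF BC(3,4)] BC(1,2) by simp_all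
  qed
qed

lemma polygon_fan_eq:
  assumes Q: "LDP_polygon Q"
  shows "polygon_fan Q = {cone_of B |a b B. edge Q a b \<and> B \<subseteq> {a, b}}"
proof (intro equalityI subsetI)
  fix \<tau> assume "\<tau> \<in> polygon_fan Q"
  then obtain F where F: "\<tau> \<noteq> {}" "F facet_of Q" "\<tau> face_of conic hull F" by (auto simp: polygon_fan_def)
  then obtain a b where e: "edge Q a b" "F = closed_segment (lvec a) (lvec b)" using facet_edge[OF Q] by blast
  then have ab: "0 < cross a b" by (simp add: edge_def)
  have "\<tau> face_of cone_of {a, b}" using F e ab by (simp add: cone_of_pair cone2_eq_conic_hull)
  then show "\<tau> \<in> {cone_of B |a b B. edge Q a b \<and> B \<subseteq> {a, b}}"
    using faces_of_cone_of[OF ab order_refl] F(1) e(1) by blast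
next
  fix \<tau> assume "\<tau> \<in> {cone_of B |a b B. edge Q a b \<and> B \<subseteq> {a, b}}"
  then obtain a b B where e: "\<tau> = cone_of B" "edge Q a b" "B \<subseteq> {a, b}" by blast
  then have ab: "0 < cross a b" "closed_segment (lvec a) (lvec b) facet_of Q" by (simp_all add: edge_def)
  have "\<tau> face_of conic hull (closed_segment (lvec a) (lvec b))"
    using face_of_cone_of[OF ab(1) e(3) order_refl] e(1) ab by (simp add: cone_of_pair cone2_eq_conic_hull)
  moreover have "\<tau> \<noteq> {}" using convex_cone_contains_0[OF convex_cone_cone_of] e(1) by blast
  ultimately show "\<tau> \<in> polygon_fan Q" using ab(2) by (auto simp: polygon_fan_def)
qed

lemma Union_polygon_fan:
  assumes Q: "LDP_polygon Q" shows "\<Union> (polygon_fan Q) = UNIV"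
proof -
  have "x \<in> \<Union> (polygon_fan Q)" for x
  proof -
    define y :: "real \<times> real" where "y = (if x = 0 then (1, 0) else x)"
    have y: "y \<noteq> 0" "x \<noteq> 0 \<longrightarrow> y = x" by (auto simp: y_def prod_eq_iff)
    obtain a b where e: "edge Q a b" "y \<in> cone2 a b" using cone2_cover[OF Q y(1)] by blast
    then have "x \<in> cone2 a b" using y by (cases "x = 0") (auto simp: cone2_def)
    then have "x \<in> cone_of {a, b}" using e by (simp add: cone_of_pair edge_def)
    then show ?thesis using e unfolding polygon_fan_eq[OF Q] by blast
  qed
  then show ?thesis by blast
qed

text \<open>An interior point \<open>u + n\<close> of a cell lies in the cone of some edge. The ends
  of that edge are rays of the cycle and so not inside the cell; \<open>cell_in_cone\<close> then
  places the entire cell in the cone.\<close>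

lemma smooth_refinement_cycle_fan:
  assumes Q: "LDP_polygon Q" and U: "smooth_cycle U" and V: "vertices Q \<subseteq> U"
  shows "smooth_refinement (cycle_fan U) (polygon_fan Q)"
  unfolding smooth_refinement_def refines_def
proof (intro conjI ballI)
  have c: "0 < cross u (nxt U u)" if "u \<in> U" for u using cross_nxt[OF U that] by simp
  show "fan (cycle_fan U)" by (rule fan_cycle_fan[OF U])
  fix \<sigma> assume "\<sigma> \<in> cycle_fan U"
  then obtain B u where B: "\<sigma> = cone_of B" "u \<in> U" "B \<subseteq> {u, nxt U u}" by (auto simp: cycle_fan_def)
  then show "smooth_cone \<sigma>"
    unfolding smooth_cone_def using lattice_basis_cross[OF cross_nxt[OF U B(2)]] by (metis cone_of_def)
  let ?n = "nxt U u"
  let ?x = "lvec u + lvec ?n"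
  have x: "cross (lvec u) ?x = 1" "cross ?x (lvec ?n) = 1" using cross_nxt[OF U B(2)] by (simp_all add: cross_add)
  then have "?x \<noteq> 0" by (metis cross_zero(2) zero_neq_one)
  then obtain a b where e: "edge Q a b" "?x \<in> cone2 a b" using cone2_cover[OF Q] by blast
  have ab: "a \<in> U" "b \<in> U" "0 < cross a b" using e V by (auto simp: edge_def)
  have "0 \<le> cross a u" "0 < cross u b" "0 < cross a ?n" "0 \<le> cross ?n b"
    using cell_in_cone[OF ab(3) cross_nxt[OF U B(2)] not_between_nxt[OF U B(2) ab(1)] not_between_nxt[OF U B(2) ab(2)], of ?x]
      x e by (auto simp: cone2_def)
  then have "lvec ` {u, ?n} \<subseteq> cone_of {a, b}" using ab by (simp add: cone_of_pair cone2_def)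
  then have "cone_of {u, ?n} \<subseteq> cone_of {a, b}"
    by (subst (1) cone_of_def) (rule hull_minimal, auto simp: convex_cone_cone_of)
  then have "\<sigma> \<subseteq> cone_of {a, b}" using B cone_of_mono by blast
  moreover have "cone_of {a, b} \<in> polygon_fan Q" unfolding polygon_fan_eq[OF Q] using e by blast
  ultimately show "\<exists>\<tau>\<in>polygon_fan Q. \<sigma> \<subseteq> \<tau>" by blast
next
  have c: "0 < cross u (nxt U u)" if "u \<in> U" for u using cross_nxt[OF U that] by simp
  have "x \<in> \<Union> (cycle_fan U)" for x
  proof -
    define y :: "real \<times> real" where "y = (if x = 0 then (1, 0) else x)"
    have y: "y \<noteq> 0" "x \<noteq> 0 \<longrightarrow> y = x" by (auto simp: y_def prod_eq_iff)
    obtain v where "v \<in> U" "0 < cross (lvec v) y" using vertex_direction[OF Q y(1)] V by blast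
    then obtain u where u: "u \<in> U" "0 < cross (lvec u) y" "0 \<le> cross y (lvec (nxt U u))"
      using cell_exists[OF U] by blast
    then have "x \<in> cone2 u (nxt U u)" using y by (cases "x = 0") (auto simp: cone2_def)
    then have "x \<in> cone_of {u, nxt U u}" using c[OF u(1)] by (simp add: cone_of_pair)
    then show ?thesis using u(1) unfolding cycle_fan_def by blast
  qed
  then show "\<Union> (cycle_fan U) = \<Union> (polygon_fan Q)" using Union_polygon_fan[OF Q] by blast
qed

section \<open>Rays of a fan and of its refinements\<close>

definition rays :: "(real \<times> real) set set \<Rightarrow> (int \<times> int) set" where
  "rays \<Sigma> = {u. primitive u \<and> cone_of {u} \<in> \<Sigma>}"

lemma primitive_positive_multiple:
  assumes "primitive u" "primitive w" "lvec u = c *\<^sub>R lvec w" "0 \<le> c"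
  shows "u = w"
proof -
  obtain u' w' where u': "cross u u' = 1" and w': "cross w w' = 1" using assms primitive_iff by auto
  have "real_of_int (cross u w) = c * cross (lvec w) (lvec w)" using assms(3) by (metis cross_lvec cross_scaleR(1))
  then have "cross u w = 0" by simp
  then have "u = w \<or> u = - w" using parallel_unimodular[OF w' u'] by simp
  moreover have "u \<noteq> - w"
  proof
    assume "u = - w"
    then have "c *\<^sub>R lvec w = - lvec w" using assms(3) by (simp add: lvec_uminus)
    then have "(c + 1) *\<^sub>R lvec w = 0" by (simp add: scaleR_left_distrib)
    then have "w = 0" using assms(4) by simp
    then show False using w' by simp
  qed
  ultimately show ?thesis by blast
qed

lemma finite_rays: "finite \<Sigma> \<Longrightarrow> finite (rays \<Sigma>)"
proof (rule inj_on_finite[of "\<lambda>u. cone_of {u}"])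
  show "inj_on (\<lambda>u. cone_of {u}) (rays \<Sigma>)"
  proof (rule inj_onI)
    fix u w assume a: "u \<in> rays \<Sigma>" "w \<in> rays \<Sigma>" "cone_of {u} = cone_of {w}"
    then have "lvec u \<in> cone_of {w}" using cone_of_inc by blast
    then show "u = w" using a primitive_positive_multiple unfolding cone_of_singleton rays_def by blast
  qed
qed (auto simp: rays_def)

text \<open>A ray of the coarser fan meets every cone \<open>\<delta>\<close> of it in a face. If
  the ray ran through the inside of a cell contained in \<open>\<delta>\<close>, its generator would
  be the midpoint of two points of \<open>\<delta>\<close> with different directions, and the face
  property would put both onto the ray.\<close>

lemma rays_subset_cycle:
  assumes \<Delta>: "fan \<Delta>" "refines (cycle_fan U) \<Delta>" and U: "smooth_cycle U"
  shows "rays \<Delta> \<subseteq> U"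
proof
  fix r assume r: "r \<in> rays \<Delta>"
  then have rp: "primitive r" "cone_of {r} \<in> \<Delta>" by (auto simp: rays_def)
  have r0: "lvec r \<noteq> 0" using rp(1) by (auto simp: primitive_def)
  have "lvec r \<in> \<Union> (cycle_fan U)" using \<Delta>(2) rp(2) cone_of_inc[of r "{r}"] by (auto simp: refines_def)
  then obtain B u where B: "u \<in> U" "B \<subseteq> {u, nxt U u}" "lvec r \<in> cone_of B" by (auto simp: cycle_fan_def)
  let ?n = "nxt U u"
  have un: "cross u ?n = 1" "?n \<in> U" using cross_nxt[OF U B(1)] nxt_in[OF U B(1)] by auto
  have "cone_of {u, ?n} \<in> cycle_fan U" using B(1) by (auto simp: cycle_fan_def)
  then obtain \<delta> where \<delta>: "\<delta> \<in> \<Delta>" "cone_of {u, ?n} \<subseteq> \<delta>" using \<Delta>(2) by (auto simp: refines_def)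
  have face: "cone_of {r} \<inter> \<delta> face_of \<delta>" using \<Delta>(1) rp(2) \<delta>(1) by (auto simp: fan_def)
  have rc: "lvec r \<in> cone_of {u, ?n}" using B cone_of_mono by blast
  then obtain \<alpha> \<beta> where ab: "lvec r = \<alpha> *\<^sub>R lvec u + \<beta> *\<^sub>R lvec ?n" "0 \<le> \<alpha>" "0 \<le> \<beta>"
    using un by (simp add: cone_of_pair cone2_explicit) blast
  have prim: "primitive u" "primitive ?n"
    using un(1) cross_nxt[OF U un(2)] primitive_iff by blast+
  have "\<alpha> = 0 \<or> \<beta> = 0"
  proof (rule ccontr)
    assume "\<not> ?thesis"
    then have pos: "0 < \<alpha>" "0 < \<beta>" using ab by auto
    let ?p = "(2 * \<alpha>) *\<^sub>R lvec u" and ?q = "(2 * \<beta>) *\<^sub>R lvec ?n"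
    have pq: "cross ?p ?q = 4 * \<alpha> * \<beta>" using un by simp
    then have "?p \<noteq> ?q" using pos by (metis cross_self mult_eq_0_iff less_irrefl zero_neq_numeral)
    moreover have "lvec r = midpoint ?p ?q" by (simp add: ab(1) midpoint_def algebra_simps)
    ultimately have "lvec r \<in> open_segment ?p ?q" by simp
    moreover have "?p \<in> cone_of {u, ?n}" "?q \<in> cone_of {u, ?n}"
      using pos by (auto intro!: convex_cone_scaleR[OF convex_cone_cone_of] cone_of_inc)
    moreover have "lvec r \<in> cone_of {r} \<inter> \<delta>" using rc \<delta>(2) cone_of_inc[of r "{r}"] by auto
    ultimately have "?p \<in> cone_of {r}" "?q \<in> cone_of {r}" using face \<delta>(2) unfolding face_of_def by blast+
    then obtain k k' where "?p = k *\<^sub>R lvec r" "?q = k' *\<^sub>R lvec r" unfolding cone_of_singleton by blast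
    then have "cross ?p ?q = 0" by simp
    then show False using pq pos by simp
  qed
  then have "r = u \<or> r = ?n"
    using primitive_positive_multiple[OF rp(1) prim(1), of \<alpha>] primitive_positive_multiple[OF rp(1) prim(2), of \<beta>] ab by fastforce
  then show "r \<in> U" using B(1) un(2) by blast
qed

section \<open>Discrete valuation rings and localizations\<close>

definition is_subring :: "ratfun set \<Rightarrow> bool" where
  "is_subring R \<longleftrightarrow> 1 \<in> R \<and> (\<forall>a\<in>R. - a \<in> R \<and> (\<forall>b\<in>R. a + b \<in> R \<and> a * b \<in> R))"

lemma is_subringD:
  assumes "is_subring R"
  shows "1 \<in> R" "0 \<in> R" "a \<in> R \<Longrightarrow> - a \<in> R" "a \<in> R \<Longrightarrow> b \<in> R \<Longrightarrow> a + b \<in> R"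
    "a \<in> R \<Longrightarrow> b \<in> R \<Longrightarrow> a * b \<in> R" "a \<in> R \<Longrightarrow> b \<in> R \<Longrightarrow> a - b \<in> R" "a \<in> R \<Longrightarrow> a ^ k \<in> R"
proof -
  show *: "1 \<in> R" "\<And>a. a \<in> R \<Longrightarrow> - a \<in> R" "\<And>a b. a \<in> R \<Longrightarrow> b \<in> R \<Longrightarrow> a + b \<in> R"
    "\<And>a b. a \<in> R \<Longrightarrow> b \<in> R \<Longrightarrow> a * b \<in> R" using assms by (auto simp: is_subring_def)
  have "1 + - 1 \<in> R" using *(1,2,3) by blast
  then show "0 \<in> R" by simp
  show "a \<in> R \<Longrightarrow> b \<in> R \<Longrightarrow> a - b \<in> R" using *(3)[of a "- b"] *(2) by simp
  show "a \<in> R \<Longrightarrow> a ^ k \<in> R" by (induction k) (use * in auto)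
qed

text \<open>The last clause gives every nonzero element of the field a finite order; it is the form
  in which discreteness is verified for the two kinds of divisors.\<close>

definition is_dvr :: "ratfun set \<Rightarrow> ratfun \<Rightarrow> bool" where
  "is_dvr R t \<longleftrightarrow> is_subring R \<and> uniformizer R t \<and> (\<forall>f. f \<noteq> 0 \<longrightarrow> (\<exists>n. \<exists>w\<in>unit_set R. f = w * t powi n))"

lemma unit_setD: "u \<in> unit_set R \<Longrightarrow> u \<in> R \<and> u \<noteq> 0 \<and> inverse u \<in> R"
  by (simp add: unit_set_def)

context
  fixes R assumes R: "is_subring R"
begin

lemma unit_set_one: "1 \<in> unit_set R"
  using is_subringD(1)[OF R] by (simp add: unit_set_def)

lemma unit_set_mult: "u \<in> unit_set R \<Longrightarrow> v \<in> unit_set R \<Longrightarrow> u * v \<in> unit_set R"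
  using is_subringD(5)[OF R] by (simp add: unit_set_def)

lemma unit_set_inverse: "u \<in> unit_set R \<Longrightarrow> inverse u \<in> unit_set R"
  by (simp add: unit_set_def)

lemma unit_set_powi: "u \<in> unit_set R \<Longrightarrow> u powi n \<in> unit_set R"
proof -
  assume u: "u \<in> unit_set R"
  have "u ^ k \<in> unit_set R" for k by (induction k) (use u unit_set_one unit_set_mult in auto)
  then have "u ^ k \<in> unit_set R" "inverse (u ^ k) \<in> unit_set R" for k using unit_set_inverse by blast+
  then show ?thesis by (simp add: power_int_def power_inverse)
qed

lemma unit_set_factor: "a \<in> R \<Longrightarrow> b \<in> R \<Longrightarrow> a * b \<in> unit_set R \<Longrightarrow> a \<in> unit_set R"
proof -
  assume ab: "a \<in> R" "b \<in> R" "a * b \<in> unit_set R"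
  then have nz: "a * b \<noteq> 0" "inverse (a * b) \<in> R" unfolding unit_set_def by blast+
  then have "b * inverse (a * b) \<in> R" using is_subringD(5)[OF R] ab by blast
  moreover have "b * inverse (a * b) = inverse a" using nz by (simp add: field_simps)
  ultimately have "inverse a \<in> R" by (simp only:)
  then show ?thesis using ab nz unfolding unit_set_def by simp
qed

end

lemma uniformizer_in:
  assumes "is_subring R" "uniformizer R t"
  shows "t \<in> R" "t \<notin> unit_set R" "t \<noteq> 0"
proof -
  have "t * 1 \<in> {t * a |a. a \<in> R}" using is_subringD(1)[OF assms(1)] by blast
  then have "t \<in> R - unit_set R" using assms(2) by (simp add: uniformizer_def)
  then show "t \<in> R" "t \<notin> unit_set R" by auto
  show "t \<noteq> 0" using assms(2) by (simp add: uniformizer_def)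
qed

text \<open>If a nontrivial power of \<open>t\<close> were a unit, its factor \<open>t\<close> would
  be one as well.\<close>

lemma uniformizer_powi_unit:
  assumes R: "is_subring R" and t: "uniformizer R t" and u: "t powi n \<in> unit_set R"
  shows "n = 0"
proof (rule ccontr)
  assume n: "n \<noteq> 0"
  note tR = uniformizer_in[OF R t]
  have "t powi \<bar>n\<bar> \<in> unit_set R"
    using u unit_set_inverse[OF R u] by (cases "0 \<le> n") (auto simp: power_int_minus)
  moreover have "t powi \<bar>n\<bar> = t * t ^ (nat \<bar>n\<bar> - 1)"
  proof -
    obtain k where "nat \<bar>n\<bar> = Suc k" using n by (cases "nat \<bar>n\<bar>") auto
    then show ?thesis by (simp add: power_int_def)
  qed
  ultimately have "t * t ^ (nat \<bar>n\<bar> - 1) \<in> unit_set R" by simp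
  then have "t \<in> unit_set R" using unit_set_factor[OF R tR(1) is_subringD(7)[OF R tR(1)]] by blast
  then show False using tR by simp
qed

lemma uniformizer_associated:
  assumes R: "is_subring R" and t: "uniformizer R t" and s: "uniformizer R s"
  shows "\<exists>a\<in>unit_set R. s = t * a"
proof -
  have "s \<in> R - unit_set R" "t \<in> R - unit_set R" using uniformizer_in R t s by auto
  then obtain a b where ab: "s = t * a" "a \<in> R" "t = s * b" "b \<in> R"
    using t s unfolding uniformizer_def by blast
  have "s * 1 = s * (b * a)" using ab by (simp add: algebra_simps)
  then have "b * a = 1" using uniformizer_in(3)[OF R s] by (metis mult_cancel_left)
  then have "a * b \<in> unit_set R" using unit_set_one[OF R] by (simp add: mult.commute)
  then show ?thesis using ab unit_set_factor[OF R ab(2,4)] by blast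
qed

context
  fixes R t assumes dvr: "is_dvr R t"
begin

lemma dvr_basics: "is_subring R" "uniformizer R t" "t \<noteq> 0"
  using dvr by (auto simp: is_dvr_def uniformizer_def)

text \<open>Two uniformizers differ by a unit, so a second decomposition of the same element would
  produce a power of \<open>t\<close> that is a unit.\<close>

lemma ord_at_eqI:
  assumes w: "w \<in> unit_set R"
  shows "ord_at R (w * t powi n) = n"
  unfolding ord_at_def
proof (rule the_equality)
  show "\<exists>s u. uniformizer R s \<and> u \<in> unit_set R \<and> w * t powi n = u * s powi n"
    using dvr_basics w by blast
  fix k assume "\<exists>s u. uniformizer R s \<and> u \<in> unit_set R \<and> w * t powi n = u * s powi k"
  then obtain s u where s: "uniformizer R s" "u \<in> unit_set R" "w * t powi n = u * s powi k" by blast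
  obtain a where a: "a \<in> unit_set R" "s = t * a"
    using uniformizer_associated[OF dvr_basics(1,2) s(1)] by blast
  have nz: "w \<noteq> 0" "t \<noteq> 0" using w dvr_basics by (auto simp: unit_set_def)
  have "w * t powi n = u * a powi k * t powi k" using s(3) a(2) by (simp add: power_int_mult_distrib)
  then have "t powi (n - k) = u * a powi k * inverse w" using nz by (simp add: power_int_diff field_simps)
  also have "\<dots> \<in> unit_set R"
    by (intro unit_set_mult[OF dvr_basics(1)] unit_set_powi[OF dvr_basics(1)] unit_set_inverse[OF dvr_basics(1)] s a w)
  finally have "n - k = 0" by (rule uniformizer_powi_unit[OF dvr_basics(1,2)])
  then show "k = n" by simp
qed

lemma ord_at_decompose:
  assumes "f \<noteq> 0" obtains w n where "w \<in> unit_set R" "f = w * t powi n" "ord_at R f = n"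
proof -
  obtain n w where w: "w \<in> unit_set R" "f = w * t powi n" using dvr assms unfolding is_dvr_def by blast
  then show ?thesis using that[OF w] ord_at_eqI[OF w(1), of n] by simp
qed

lemma ord_at_mult:
  assumes "f \<noteq> 0" "g \<noteq> 0" shows "ord_at R (f * g) = ord_at R f + ord_at R g"
proof -
  obtain w n where w: "w \<in> unit_set R" "f = w * t powi n" "ord_at R f = n"
    using ord_at_decompose[OF assms(1)] by blast
  obtain v k where v: "v \<in> unit_set R" "g = v * t powi k" "ord_at R g = k"
    using ord_at_decompose[OF assms(2)] by blast
  have "f * g = (w * v) * t powi (n + k)"
    unfolding w(2) v(2) using dvr_basics(3) by (simp add: power_int_add algebra_simps)
  then show ?thesis using ord_at_eqI[OF unit_set_mult[OF dvr_basics(1) w(1) v(1)], of "n + k"] w(3) v(3) by simp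
qed

lemma ord_at_unit: "w \<in> unit_set R \<Longrightarrow> ord_at R w = 0"
  using ord_at_eqI[of w 0] by simp

lemma ord_at_one: "ord_at R 1 = 0"
  using ord_at_unit[OF unit_set_one[OF dvr_basics(1)]] .

lemma ord_at_inverse: "f \<noteq> 0 \<Longrightarrow> ord_at R (inverse f) = - ord_at R f"
  using ord_at_mult[of f "inverse f"] ord_at_one by simp

lemma ord_at_divide: "f \<noteq> 0 \<Longrightarrow> g \<noteq> 0 \<Longrightarrow> ord_at R (f / g) = ord_at R f - ord_at R g"
  using ord_at_mult[of f "inverse g"] ord_at_inverse[of g] by (simp add: divide_inverse)

lemma ord_at_powi: "f \<noteq> 0 \<Longrightarrow> ord_at R (f powi k) = k * ord_at R f"
proof -
  assume f: "f \<noteq> 0"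
  have "ord_at R (f ^ n) = int n * ord_at R f" for n
    by (induction n) (use f ord_at_mult ord_at_one in \<open>simp_all add: algebra_simps\<close>)
  then show ?thesis using f ord_at_inverse[of f] ord_at_inverse[of "f ^ nat (- k)"]
    by (cases "0 \<le> k") (simp_all add: power_int_def power_inverse)
qed

lemma ord_at_prod:
  "finite I \<Longrightarrow> (\<And>i. i \<in> I \<Longrightarrow> f i \<noteq> 0) \<Longrightarrow> ord_at R (\<Prod>i\<in>I. f i) = (\<Sum>i\<in>I. ord_at R (f i))"
  by (induction I rule: finite_induct) (simp_all add: ord_at_one ord_at_mult)

lemma ord_at_uniformizer: "ord_at R t = 1"
  using ord_at_eqI[OF unit_set_one[OF dvr_basics(1)], of 1] by simp

lemma powi_nonneg_in: "0 \<le> n \<Longrightarrow> t powi n \<in> R"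
  using uniformizer_in(1)[OF dvr_basics(1,2)] is_subringD(7)[OF dvr_basics(1)] by (simp add: power_int_def)

lemma in_dvr_iff:
  assumes f: "f \<noteq> 0" shows "f \<in> R \<longleftrightarrow> 0 \<le> ord_at R f"
proof -
  obtain w n where w: "w \<in> unit_set R" "f = w * t powi n" "ord_at R f = n"
    using ord_at_decompose[OF f] by blast
  note sub = is_subringD[OF dvr_basics(1)]
  have "f \<in> R \<longleftrightarrow> 0 \<le> n"
  proof
    assume "0 \<le> n"
    then show "f \<in> R" unfolding w(2) using powi_nonneg_in[of n] sub(5) unit_setD[OF w(1)] by blast
  next
    assume fR: "f \<in> R"
    show "0 \<le> n"
    proof (rule ccontr)
      assume n: "\<not> 0 \<le> n"
      have "inverse w * f = t powi n" unfolding w(2) using unit_setD[OF w(1)] by simp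
      moreover have "inverse w * f \<in> R" using sub(5) fR unit_setD[OF w(1)] by blast
      ultimately have "t powi n \<in> R" by simp
      moreover have "inverse (t powi n) \<in> R"
        using powi_nonneg_in[of "- n"] n by (simp add: power_int_minus)
      ultimately have "t powi n \<in> unit_set R" using dvr_basics(3) by (simp add: unit_set_def)
      then have "n = 0" by (rule uniformizer_powi_unit[OF dvr_basics(1,2)])
      then show False using n by simp
    qed
  qed
  then show ?thesis using w(3) by simp
qed

lemma in_unit_set_iff: "f \<in> unit_set R \<longleftrightarrow> f \<noteq> 0 \<and> ord_at R f = 0"
  using in_dvr_iff[of f] in_dvr_iff[of "inverse f"] ord_at_inverse[of f] by (auto simp: unit_set_def)

lemma dvr_proper: "R \<noteq> UNIV"
proof -
  have "ord_at R (inverse t) = - 1" using ord_at_inverse[of t] ord_at_uniformizer dvr_basics(3) by simp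
  then show ?thesis using in_dvr_iff[of "inverse t"] dvr_basics(3) by auto
qed

text \<open>Powers of an element \<open>f\<close> of negative order absorb any pole: each
  \<open>g\<close> is \<open>f ^ k\<close> times an element of \<open>R\<close>. It follows that
  such local rings are points of codimension one.\<close>

lemma dvr_maximal:
  assumes R': "is_subring R'" "R \<subseteq> R'" "R' \<noteq> R" shows "R' = UNIV"
proof -
  note sub = is_subringD[OF R'(1)]
  obtain f where f: "f \<in> R'" "f \<notin> R" using R' by blast
  then have f0: "f \<noteq> 0" using is_subringD(2)[OF dvr_basics(1)] by auto
  have n: "ord_at R f < 0" using in_dvr_iff[OF f0] f by simp
  have "g \<in> R'" for g
  proof (cases "g \<in> R")
    case False
    then have g0: "g \<noteq> 0" using is_subringD(2)[OF dvr_basics(1)] by auto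
    define k where "k = nat \<bar>ord_at R g\<bar>"
    have "int k * 1 \<le> int k * (- ord_at R f)" using n by (intro mult_left_mono) auto
    then have "0 \<le> ord_at R g - int k * ord_at R f" by (simp add: k_def)
    then have "0 \<le> ord_at R (g / f ^ k)"
      using ord_at_divide[OF g0, of "f ^ k"] ord_at_powi[OF f0, of "int k"] f0 by (simp add: power_int_def)
    then have "g / f ^ k \<in> R'" using in_dvr_iff[of "g / f ^ k"] g0 f0 R' by auto
    then have "g / f ^ k * f ^ k \<in> R'" using sub(5) sub(7)[OF f(1)] by blast
    then show ?thesis using f0 by simp
  qed (use R' in auto)
  then show ?thesis by blast
qed

end

lemma is_dvr_uniformizer: "is_dvr R t \<Longrightarrow> R - unit_set R = {t * a |a. a \<in> R}"
  by (simp add: is_dvr_def uniformizer_def)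

section \<open>Prime ideals and localization inside the function field\<close>

lemma cring_ring_of:
  assumes A: "is_subring A" shows "cring (ring_of A)"
proof (rule cringI)
  note sub = is_subringD[OF A]
  show "abelian_group (ring_of A)"
  proof (rule abelian_groupI)
    show "\<exists>y\<in>carrier (ring_of A). y \<oplus>\<^bsub>ring_of A\<^esub> x = \<zero>\<^bsub>ring_of A\<^esub>" if "x \<in> carrier (ring_of A)" for x
      by (rule bexI[of _ "- x"]) (use that sub(3) in \<open>simp_all add: ring_of_def\<close>)
  qed (use sub(2,4) in \<open>simp_all add: ring_of_def algebra_simps\<close>)
  show "comm_monoid (ring_of A)"
    by (rule comm_monoidI) (use sub(1,5) in \<open>simp_all add: ring_of_def algebra_simps\<close>)
qed (auto simp: ring_of_def algebra_simps)

text \<open>The conditions of \<open>primeideal\<close> for \<open>ring_of A\<close>, unfolded so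
  that the arguments can stay inside the field.\<close>

definition prime_in :: "ratfun set \<Rightarrow> ratfun set \<Rightarrow> bool" where
  "prime_in P A \<longleftrightarrow> P \<subseteq> A \<and> 0 \<in> P \<and> 1 \<notin> P \<and> (\<forall>a\<in>P. \<forall>b\<in>P. a + b \<in> P) \<and> (\<forall>a\<in>A. \<forall>b\<in>P. a * b \<in> P) \<and>
     (\<forall>a\<in>A. \<forall>b\<in>A. a * b \<in> P \<longrightarrow> a \<in> P \<or> b \<in> P)"

lemma primeideal_ring_of:
  assumes A: "is_subring A" shows "primeideal P (ring_of A) \<longleftrightarrow> prime_in P A"
proof
  note sub = is_subringD[OF A]
  assume "primeideal P (ring_of A)"
  then interpret primeideal P "ring_of A" .
  have PA: "P \<subseteq> A" using a_subset by (simp add: ring_of_def)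
  have ab: "a * b \<in> P" if "a \<in> A" "b \<in> P" for a b
    using I_l_closed[of b a] that by (simp add: ring_of_def)
  show "prime_in P A" unfolding prime_in_def
  proof (intro conjI ballI impI PA ab)
    show "0 \<in> P" using additive_subgroup.zero_closed[OF is_additive_subgroup] by (simp add: ring_of_def)
    show "a + b \<in> P" if "a \<in> P" "b \<in> P" for a b
      using additive_subgroup.a_closed[OF is_additive_subgroup that] by (simp add: ring_of_def)
    show "1 \<notin> P"
    proof
      assume "1 \<in> P"
      then have "a \<in> P" if "a \<in> A" for a using ab[OF that, of 1] by simp
      then have "P = A" using PA by blast
      then show False using I_notcarr by (simp add: ring_of_def)
    qed
    show "a \<in> P \<or> b \<in> P" if "a \<in> A" "b \<in> A" "a * b \<in> P" for a b
      using I_prime[of a b] that by (simp add: ring_of_def)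
  qed
next
  note sub = is_subringD[OF A]
  assume P: "prime_in P A"
  then have P': "P \<subseteq> A" "0 \<in> P" "1 \<notin> P" "\<And>a b. a \<in> P \<Longrightarrow> b \<in> P \<Longrightarrow> a + b \<in> P"
    "\<And>a b. a \<in> A \<Longrightarrow> b \<in> P \<Longrightarrow> a * b \<in> P" "\<And>a b. a \<in> A \<Longrightarrow> b \<in> A \<Longrightarrow> a * b \<in> P \<Longrightarrow> a \<in> P \<or> b \<in> P"
    by (simp_all add: prime_in_def)
  interpret cring "ring_of A" by (rule cring_ring_of[OF A])
  have neg: "- a \<in> P" if "a \<in> P" for a
    using P'(5)[of "- 1" a] sub(3)[of 1] sub(1) that by simp
  have car: "carrier (add_monoid (ring_of A)) = A" by (simp add: ring_of_def)
  have inv: "inv\<^bsub>add_monoid (ring_of A)\<^esub> a = - a" if "a \<in> P" for a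
  proof (rule group.inv_equality)
    show "group (add_monoid (ring_of A))" using a_group by simp
    show "a \<in> carrier (add_monoid (ring_of A))" "- a \<in> carrier (add_monoid (ring_of A))"
      unfolding car using that neg P'(1) by blast+
  qed (simp add: ring_of_def)
  have sg: "subgroup P (add_monoid (ring_of A))"
  proof (rule group.subgroupI)
    show "group (add_monoid (ring_of A))" using a_group by simp
    show "P \<subseteq> carrier (add_monoid (ring_of A))" "P \<noteq> {}" unfolding car using P' by blast+
    show "inv\<^bsub>add_monoid (ring_of A)\<^esub> a \<in> P" if "a \<in> P" for a using inv[OF that] neg[OF that] by simp
    show "a \<otimes>\<^bsub>add_monoid (ring_of A)\<^esub> b \<in> P" if "a \<in> P" "b \<in> P" for a b
      using P'(4)[OF that] by (simp add: ring_of_def)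
  qed
  have "ideal P (ring_of A)"
  proof (rule idealI[OF ring_axioms sg])
    fix a x assume ax: "a \<in> P" "x \<in> carrier (ring_of A)"
    then have "x * a \<in> P" using P'(5) by (simp add: ring_of_def)
    then show "x \<otimes>\<^bsub>ring_of A\<^esub> a \<in> P" "a \<otimes>\<^bsub>ring_of A\<^esub> x \<in> P"
      by (simp_all add: ring_of_def mult.commute)
  qed
  then show "primeideal P (ring_of A)"
  proof (rule primeidealI[OF _ is_cring])
    have "P \<noteq> A" using P'(3) sub(1) by blast
    then show "carrier (ring_of A) \<noteq> P" by (simp add: ring_of_def)
    show "a \<in> P \<or> b \<in> P" if "a \<in> carrier (ring_of A)" "b \<in> carrier (ring_of A)" "a \<otimes>\<^bsub>ring_of A\<^esub> b \<in> P" for a b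
      using P'(6)[of a b] that by (simp add: ring_of_def)
  qed
qed

context
  fixes A P assumes A: "is_subring A" and P: "prime_in P A"
begin

lemma prime_in_complement: "1 \<in> A - P" "s \<in> A - P \<Longrightarrow> s' \<in> A - P \<Longrightarrow> s * s' \<in> A - P" "s \<in> A - P \<Longrightarrow> s \<noteq> 0"
  using P is_subringD[OF A] by (auto simp: prime_in_def)

lemma subset_localization: "A \<subseteq> localization_at A P"
  using prime_in_complement(1) by (force simp: localization_at_def)

lemma inverse_in_localization: "s \<in> A - P \<Longrightarrow> s \<in> unit_set (localization_at A P)"
proof -
  assume s: "s \<in> A - P"
  have "inverse s = 1 / s" by (simp add: divide_inverse)
  then have "inverse s \<in> localization_at A P" unfolding localization_at_def using s is_subringD(1)[OF A] by blast
  then show ?thesis using subset_localization s prime_in_complement(3)[OF s] by (auto simp: unit_set_def)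
qed

lemma is_subring_localization: "is_subring (localization_at A P)"
  unfolding is_subring_def
proof (intro conjI ballI)
  note sub = is_subringD[OF A]
  show "1 \<in> localization_at A P" using subset_localization sub(1) by blast
  fix f assume "f \<in> localization_at A P"
  then obtain a s where f: "f = a / s" "a \<in> A" "s \<in> A - P" by (auto simp: localization_at_def)
  have "- f = (- a) / s" using f by simp
  then show "- f \<in> localization_at A P" using f sub(3) unfolding localization_at_def by blast
  fix g assume "g \<in> localization_at A P"
  then obtain b r where g: "g = b / r" "b \<in> A" "r \<in> A - P" by (auto simp: localization_at_def)
  have sr: "s * r \<in> A - P" "s \<noteq> 0" "r \<noteq> 0" using f g prime_in_complement by auto
  have "f + g = (a * r + b * s) / (s * r)" "f * g = (a * b) / (s * r)"
    unfolding f(1) g(1) using sr by (simp_all add: field_simps)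
  moreover have "a * r + b * s \<in> A" "a * b \<in> A" using f g sub(4,5) by auto
  ultimately show "f + g \<in> localization_at A P" "f * g \<in> localization_at A P"
    using sr unfolding localization_at_def by blast+
qed

lemma prime_not_unit: "a \<in> P \<Longrightarrow> a \<notin> unit_set (localization_at A P)"
proof
  assume a: "a \<in> P" "a \<in> unit_set (localization_at A P)"
  then obtain b s where "inverse a = b / s" "b \<in> A" "s \<in> A - P" "a \<noteq> 0"
    by (auto simp: unit_set_def localization_at_def)
  then have "s = b * a" using prime_in_complement(3) by (simp add: field_simps)
  then show False using a(1) \<open>b \<in> A\<close> \<open>s \<in> A - P\<close> P by (auto simp: prime_in_def)
qed

end

lemma localization_subset:
  assumes R: "is_subring R" and "A \<subseteq> R" "\<And>s. s \<in> A - P \<Longrightarrow> s \<in> unit_set R"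
  shows "localization_at A P \<subseteq> R"
  using assms is_subringD(5)[OF R] by (fastforce simp: localization_at_def divide_inverse unit_set_def)

text \<open>The nonunits of \<open>R\<close> are the multiples of \<open>t\<close> and form its
  maximal ideal. Its trace on \<open>A\<close> is the centre of the valuation.\<close>

lemma prime_in_contraction:
  assumes A: "is_subring A" and dvr: "is_dvr R t" and AR: "A \<subseteq> R"
  shows "prime_in (A - unit_set R) A"
proof -
  note R = dvr_basics(1)[OF dvr]
  note sub = is_subringD[OF A]
  note subR = is_subringD[OF R]
  have nu: "a \<in> R - unit_set R \<longleftrightarrow> (\<exists>b\<in>R. a = t * b)" for a using is_dvr_uniformizer[OF dvr] by auto
  have add: "a + b \<notin> unit_set R" if "a \<in> A - unit_set R" "b \<in> A - unit_set R" for a b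
  proof -
    have "a \<in> R - unit_set R" "b \<in> R - unit_set R" using that AR by blast+
    then obtain a' b' where ab: "a' \<in> R" "a = t * a'" "b' \<in> R" "b = t * b'" unfolding nu by blast
    have "a + b = t * (a' + b')" unfolding ab by (simp add: algebra_simps)
    then have "a + b \<in> R - unit_set R" unfolding nu using subR(4)[OF ab(1,3)] by blast
    then show ?thesis by simp
  qed
  have mult: "a * b \<notin> unit_set R" if "a \<in> A" "b \<in> A - unit_set R" for a b
    using unit_set_factor[OF R, of b a] that AR by (auto simp: mult.commute)
  show ?thesis
    unfolding prime_in_def
  proof (intro conjI ballI impI)
    have "0 \<notin> unit_set R" by (simp add: unit_set_def)
    then show "0 \<in> A - unit_set R" using sub(2) by blast
    show "1 \<notin> A - unit_set R" using unit_set_one[OF R] by blast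
    show "a + b \<in> A - unit_set R" if "a \<in> A - unit_set R" "b \<in> A - unit_set R" for a b
      using add[OF that] sub(4) that by blast
    show "a * b \<in> A - unit_set R" if "a \<in> A" "b \<in> A - unit_set R" for a b
      using mult[OF that] sub(5) that by blast
    show "a \<in> A - unit_set R \<or> b \<in> A - unit_set R" if "a \<in> A" "b \<in> A" "a * b \<in> A - unit_set R" for a b
      using unit_set_mult[OF R, of a b] that by blast
  qed blast
qed

section \<open>Semigroup algebras\<close>

lemma const_fn_simps: "const_fn 0 = 0" "const_fn 1 = 1" "const_fn (a + b) = const_fn a + const_fn b"
  "const_fn (a * b) = const_fn a * const_fn b" "const_fn (- a) = - const_fn a"
proof -
  have "[:[:1:]:] = (1 :: complex poly poly)" by (simp add: one_pCons)
  then show "const_fn 1 = 1" unfolding const_fn_def by (simp only: to_fract_1)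
qed (simp_all add: const_fn_def flip: to_fract_add to_fract_mult to_fract_uminus)

lemma fn_nonzero: "fn_x \<noteq> 0" "fn_y \<noteq> 0"
  by (simp_all add: fn_x_def fn_y_def)

lemma const_fn_eq_0_iff [simp]: "const_fn c = 0 \<longleftrightarrow> c = 0"
  by (simp add: const_fn_def)

lemma character_nonzero [simp]: "character m \<noteq> 0"
  using fn_nonzero by (simp add: character_def)

lemma character_add: "character (m + k) = character m * character k"
  using fn_nonzero by (simp add: character_def power_int_add algebra_simps)

lemma character_zero [simp]: "character 0 = 1"
  by (simp add: character_def)

lemma character_uminus: "character (- m) = inverse (character m)"
  by (simp add: character_def power_int_minus)

lemma semigroup_algebraI:
  "finite I \<Longrightarrow> I \<subseteq> S \<Longrightarrow> (\<Sum>m\<in>I. const_fn (c m) * character m) \<in> semigroup_algebra S"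
  unfolding semigroup_algebra_def by blast

lemma semigroup_algebraE:
  assumes "f \<in> semigroup_algebra S"
  obtains I c where "finite I" "I \<subseteq> S" "f = (\<Sum>m\<in>I. const_fn (c m) * character m)"
  using assms unfolding semigroup_algebra_def by blast

lemma semigroup_algebra_mono: "S \<subseteq> T \<Longrightarrow> semigroup_algebra S \<subseteq> semigroup_algebra T"
  unfolding semigroup_algebra_def by blast

lemma sum_character_extend:
  assumes "finite J" "I \<subseteq> J"
  shows "(\<Sum>m\<in>I. const_fn (c m) * character m) = (\<Sum>m\<in>J. const_fn (if m \<in> I then c m else 0) * character m)"
proof -
  have "(\<Sum>m\<in>J. const_fn (if m \<in> I then c m else 0) * character m) = (\<Sum>m\<in>I. const_fn (if m \<in> I then c m else 0) * character m)"
    using assms by (intro sum.mono_neutral_right) (simp_all add: const_fn_simps)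
  also have "\<dots> = (\<Sum>m\<in>I. const_fn (c m) * character m)" by (intro sum.cong) simp_all
  finally show ?thesis by simp
qed

lemma semigroup_algebra_term: "m \<in> S \<Longrightarrow> const_fn c * character m \<in> semigroup_algebra S"
  using semigroup_algebraI[of "{m}" S "\<lambda>_. c"] by simp

lemma semigroup_algebra_character: "m \<in> S \<Longrightarrow> character m \<in> semigroup_algebra S"
  using semigroup_algebra_term[of m S 1] by (simp add: const_fn_simps)

lemma semigroup_algebra_zero: "0 \<in> semigroup_algebra S"
  using semigroup_algebraI[of "{}" S] by simp

lemma semigroup_algebra_add:
  assumes "f \<in> semigroup_algebra S" "g \<in> semigroup_algebra S"
  shows "f + g \<in> semigroup_algebra S"
proof -
  obtain I c where f: "finite I" "I \<subseteq> S" "f = (\<Sum>m\<in>I. const_fn (c m) * character m)"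
    using assms(1) by (rule semigroup_algebraE)
  obtain J d where g: "finite J" "J \<subseteq> S" "g = (\<Sum>m\<in>J. const_fn (d m) * character m)"
    using assms(2) by (rule semigroup_algebraE)
  have K: "finite (I \<union> J)" "I \<subseteq> I \<union> J" "J \<subseteq> I \<union> J" "I \<union> J \<subseteq> S" using f g by auto
  have "f + g = (\<Sum>m\<in>I \<union> J. const_fn ((if m \<in> I then c m else 0) + (if m \<in> J then d m else 0)) * character m)"
    unfolding f(3) g(3) sum_character_extend[OF K(1,2)] sum_character_extend[OF K(1,3)] const_fn_simps(3)
    by (simp only: sum.distrib distrib_right)
  then show ?thesis using semigroup_algebraI[OF K(1,4)] by (simp only:)
qed

lemma semigroup_algebra_sum:
  "(\<And>i. i \<in> I \<Longrightarrow> f i \<in> semigroup_algebra S) \<Longrightarrow> (\<Sum>i\<in>I. f i) \<in> semigroup_algebra S"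
  by (induction I rule: infinite_finite_induct) (simp_all add: semigroup_algebra_zero semigroup_algebra_add)

lemma semigroup_algebra_mult:
  assumes "f \<in> semigroup_algebra S" "g \<in> semigroup_algebra T" "\<And>s t. s \<in> S \<Longrightarrow> t \<in> T \<Longrightarrow> s + t \<in> W"
  shows "f * g \<in> semigroup_algebra W"
proof -
  obtain I c where f: "finite I" "I \<subseteq> S" "f = (\<Sum>m\<in>I. const_fn (c m) * character m)"
    using assms(1) by (rule semigroup_algebraE)
  obtain J d where g: "finite J" "J \<subseteq> T" "g = (\<Sum>m\<in>J. const_fn (d m) * character m)"
    using assms(2) by (rule semigroup_algebraE)
  have "f * g = (\<Sum>m\<in>I. \<Sum>k\<in>J. const_fn (c m * d k) * character (m + k))"
    unfolding f(3) g(3) sum_product by (simp add: const_fn_simps character_add algebra_simps)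
  also have "\<dots> \<in> semigroup_algebra W"
    by (intro semigroup_algebra_sum semigroup_algebra_term assms(3)) (use f g in blast)+
  finally show ?thesis .
qed

lemma semigroup_algebra_uminus:
  assumes "f \<in> semigroup_algebra S" shows "- f \<in> semigroup_algebra S"
proof -
  have "const_fn (- 1) * character 0 \<in> semigroup_algebra {0}" by (rule semigroup_algebra_term) simp
  then have "(const_fn (- 1) * character 0) * f \<in> semigroup_algebra S"
    by (rule semigroup_algebra_mult[OF _ assms]) simp
  then show ?thesis by (simp add: const_fn_simps)
qed

lemma is_subring_semigroup_algebra:
  assumes "0 \<in> S" "\<And>s t. s \<in> S \<Longrightarrow> t \<in> S \<Longrightarrow> s + t \<in> S"
  shows "is_subring (semigroup_algebra S)"
  unfolding is_subring_def
proof (intro conjI ballI)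
  show "1 \<in> semigroup_algebra S" using semigroup_algebra_character[OF assms(1)] by simp
qed (use semigroup_algebra_add semigroup_algebra_uminus semigroup_algebra_mult[OF _ _ assms(2)] in blast)+

lemma semigroup_algebra_split:
  assumes "f \<in> semigroup_algebra (S \<union> T)"
  obtains g h where "g \<in> semigroup_algebra S" "h \<in> semigroup_algebra T" "f = g + h"
proof -
  obtain I c where f: "finite I" "I \<subseteq> S \<union> T" "f = (\<Sum>m\<in>I. const_fn (c m) * character m)"
    using assms by (rule semigroup_algebraE)
  have "f = (\<Sum>m\<in>I \<inter> S. const_fn (c m) * character m) + (\<Sum>m\<in>I - S. const_fn (c m) * character m)"
    unfolding f(3) using f(1) by (rule sum.Int_Diff)
  moreover have "(\<Sum>m\<in>I \<inter> S. const_fn (c m) * character m) \<in> semigroup_algebra S"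
    "(\<Sum>m\<in>I - S. const_fn (c m) * character m) \<in> semigroup_algebra T"
    by (rule semigroup_algebraI; use f in auto)+
  ultimately show ?thesis using that by blast
qed

lemma to_fract_power: "to_fract (p ^ n) = to_fract p ^ n"
  by (induction n) (simp_all add: to_fract_mult)

lemma const_fn_character_nat:
  "const_fn c * character (int i, int j) = to_fract (monom (monom c i) j)"
proof -
  have "[:[:c:]:] * [:[:0, 1:]:] ^ i * [:0, 1:] ^ j = monom (monom c i) j"
    by (simp add: monom_altdef poly_const_pow)
  then have "to_fract (monom (monom c i) j) = to_fract [:[:c:]:] * to_fract [:[:0, 1:]:] ^ i * to_fract [:0, 1:] ^ j"
    by (simp only: to_fract_mult[symmetric] to_fract_power[symmetric])
  then show ?thesis
    by (simp add: const_fn_def character_def fn_x_def fn_y_def power_int_def mult.assoc)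
qed

text \<open>Multiplication by a large monomial moves the finite sum into the polynomial ring, where
  coefficients can be compared.\<close>

lemma characters_independent:
  assumes fin: "finite I" and zero: "(\<Sum>m\<in>I. const_fn (c m) * character m) = 0" and k: "k \<in> I"
  shows "c k = 0"
proof -
  define N where "N = Max ((\<lambda>m. nat (\<bar>fst m\<bar> + \<bar>snd m\<bar>)) ` I)"
  have N: "\<bar>fst m\<bar> + \<bar>snd m\<bar> \<le> int N" if "m \<in> I" for m
  proof -
    have "nat (\<bar>fst m\<bar> + \<bar>snd m\<bar>) \<le> N" unfolding N_def using fin that by (intro Max_ge) auto
    then show ?thesis by linarith
  qed
  define e1 where "e1 m = nat (fst m + int N)" for m :: "int \<times> int"
  define e2 where "e2 m = nat (snd m + int N)" for m :: "int \<times> int"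
  have e: "m + (int N, int N) = (int (e1 m), int (e2 m))" if "m \<in> I" for m
  proof -
    have "0 \<le> fst m + int N" "0 \<le> snd m + int N" using N[OF that] by linarith+
    then show ?thesis by (simp add: e1_def e2_def prod_eq_iff)
  qed
  define p where "p = (\<Sum>m\<in>I. monom (monom (c m) (e1 m)) (e2 m))"
  have "to_fract p = (\<Sum>m\<in>I. const_fn (c m) * character (m + (int N, int N)))"
    unfolding p_def to_fract_sum by (intro sum.cong) (simp_all add: e const_fn_character_nat)
  also have "\<dots> = (\<Sum>m\<in>I. const_fn (c m) * character m) * character (int N, int N)"
    unfolding sum_distrib_right by (simp add: character_add mult_ac)
  finally have "p = 0" using zero by simp
  then have "coeff (coeff p (e2 k)) (e1 k) = 0" by simp
  also have "coeff (coeff p (e2 k)) (e1 k) = (\<Sum>m\<in>I. if m = k then c m else 0)"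
    unfolding p_def coeff_sum
  proof (intro sum.cong refl)
    fix m assume m: "m \<in> I"
    have "e1 m = e1 k \<and> e2 m = e2 k \<longleftrightarrow> m = k"
    proof -
      have "0 \<le> fst m + int N" "0 \<le> snd m + int N" "0 \<le> fst k + int N" "0 \<le> snd k + int N"
        using N[OF m] N[OF k] by linarith+
      then show ?thesis by (auto simp: e1_def e2_def prod_eq_iff eq_nat_nat_iff)
    qed
    then show "coeff (coeff (monom (monom (c m) (e1 m)) (e2 m)) (e2 k)) (e1 k) = (if m = k then c m else 0)"
      by auto
  qed
  also have "\<dots> = c k" using fin k by simp
  finally show ?thesis .
qed

text \<open>The two expansions of \<open>f\<close> coincide by independence of characters.
  Statements about supports, weights and constant terms are all derived through this lemma rather
  than through coefficient functions.\<close>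

lemma semigroup_algebra_Int:
  assumes "f \<in> semigroup_algebra S" "f \<in> semigroup_algebra T"
  shows "f \<in> semigroup_algebra (S \<inter> T)"
proof -
  obtain I c where f: "finite I" "I \<subseteq> S" "f = (\<Sum>m\<in>I. const_fn (c m) * character m)"
    using assms(1) by (rule semigroup_algebraE)
  obtain J d where g: "finite J" "J \<subseteq> T" "f = (\<Sum>m\<in>J. const_fn (d m) * character m)"
    using assms(2) by (rule semigroup_algebraE)
  have K: "finite (I \<union> J)" "I \<subseteq> I \<union> J" "J \<subseteq> I \<union> J" using f g by auto
  define e where "e m = (if m \<in> I then c m else 0) + - (if m \<in> J then d m else 0)" for m
  have "(\<Sum>m\<in>I \<union> J. const_fn (e m) * character m) = (\<Sum>m\<in>I. const_fn (c m) * character m) + - (\<Sum>m\<in>J. const_fn (d m) * character m)"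
    unfolding e_def sum_character_extend[OF K(1,2)] sum_character_extend[OF K(1,3)] const_fn_simps(3,5) sum_negf[symmetric] sum.distrib[symmetric]
    by (simp only: distrib_right mult_minus_left)
  also have "\<dots> = 0" using f(3) g(3) by (metis add.right_inverse)
  finally have e0: "e m = 0" if "m \<in> I \<union> J" for m using characters_independent[OF K(1)] that by blast
  have "c m = 0" if "m \<in> I - J" for m using e0[of m] that by (simp add: e_def)
  then have "(\<Sum>m\<in>I. const_fn (c m) * character m) = (\<Sum>m\<in>I \<inter> J. const_fn (c m) * character m)"
    using f(1) by (intro sum.mono_neutral_right) (auto simp: const_fn_simps)
  then show ?thesis
    unfolding f(3) using semigroup_algebraI[of "I \<inter> J" "S \<inter> T" c] f(1,2) g(2) by auto
qed

lemma semigroup_algebra_empty [simp]: "semigroup_algebra {} = {0}"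
  by (auto simp: semigroup_algebra_def)

lemma poly_in_semigroup_algebra: "to_fract p \<in> semigroup_algebra {m. 0 \<le> fst m \<and> 0 \<le> snd m}"
proof -
  have "p = (\<Sum>j\<le>degree p. monom (coeff p j) j)" by (simp add: poly_as_sum_of_monoms)
  also have "\<dots> = (\<Sum>j\<le>degree p. monom (\<Sum>i\<le>degree (coeff p j). monom (coeff (coeff p j) i) i) j)"
    by (simp add: poly_as_sum_of_monoms)
  also have "\<dots> = (\<Sum>j\<le>degree p. \<Sum>i\<le>degree (coeff p j). monom (monom (coeff (coeff p j) i) i) j)"
    by (simp add: monom_sum)
  finally have "to_fract p = (\<Sum>j\<le>degree p. \<Sum>i\<le>degree (coeff p j). const_fn (coeff (coeff p j) i) * character (int i, int j))"
    unfolding const_fn_character_nat to_fract_sum[symmetric] by (rule arg_cong)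
  also have "\<dots> \<in> semigroup_algebra {m. 0 \<le> fst m \<and> 0 \<le> snd m}"
    by (intro semigroup_algebra_sum semigroup_algebra_term) simp
  finally show ?thesis .
qed

abbreviation laurent :: "ratfun set" where "laurent \<equiv> semigroup_algebra UNIV"

lemma poly_in_laurent: "to_fract p \<in> laurent"
  using poly_in_semigroup_algebra semigroup_algebra_mono by blast

lemma is_subring_laurent: "is_subring laurent"
  by (rule is_subring_semigroup_algebra) auto

lemma laurent_clear_denominators:
  assumes "f \<in> laurent" obtains k p where "f = character k * to_fract p"
proof -
  obtain I c where f: "finite I" "f = (\<Sum>m\<in>I. const_fn (c m) * character m)"
    using assms by (rule semigroup_algebraE)
  define N where "N = Max (insert 0 ((\<lambda>m. nat (\<bar>fst m\<bar> + \<bar>snd m\<bar>)) ` I))"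
  have N: "\<bar>fst m\<bar> + \<bar>snd m\<bar> \<le> int N" if "m \<in> I" for m
  proof -
    have "nat (\<bar>fst m\<bar> + \<bar>snd m\<bar>) \<le> N" unfolding N_def using f(1) that by (intro Max_ge) auto
    then show ?thesis by linarith
  qed
  define e1 where "e1 m = nat (fst m + int N)" for m :: "int \<times> int"
  define e2 where "e2 m = nat (snd m + int N)" for m :: "int \<times> int"
  have e: "m = (- int N, - int N) + (int (e1 m), int (e2 m))" if "m \<in> I" for m
  proof -
    have "0 \<le> fst m + int N" "0 \<le> snd m + int N" using N[OF that] by linarith+
    then show ?thesis by (simp add: e1_def e2_def prod_eq_iff)
  qed
  have "f = (\<Sum>m\<in>I. character (- int N, - int N) * (const_fn (c m) * character (int (e1 m), int (e2 m))))"
    unfolding f(2)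
  proof (intro sum.cong refl)
    fix m assume "m \<in> I"
    then have "character m = character (- int N, - int N) * character (int (e1 m), int (e2 m))"
      unfolding character_add[symmetric] by (rule arg_cong[OF e])
    then show "const_fn (c m) * character m = character (- int N, - int N) * (const_fn (c m) * character (int (e1 m), int (e2 m)))"
      by (simp add: algebra_simps)
  qed
  also have "\<dots> = character (- int N, - int N) * to_fract (\<Sum>m\<in>I. monom (monom (c m) (e1 m)) (e2 m))"
    by (simp add: const_fn_character_nat to_fract_sum sum_distrib_left)
  finally show ?thesis by (rule that)
qed

lemma dot_scale: "dot (k * fst m, k * snd m) u = k * dot m u"
  by (simp add: dot_def algebra_simps)

lemma primitive_dot:
  assumes "primitive u" shows "\<exists>m. dot m u = 1"
proof -
  obtain w where "cross u w = 1" using assms primitive_iff by blast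
  then have "dot (snd w, - fst w) u = 1" by (simp add: dot_def cross_def algebra_simps)
  then show ?thesis by blast
qed

lemma character_powi: "character (k * fst m, k * snd m) = character m powi k"
  by (simp add: character_def power_int_mult_distrib mult.commute[of k] power_int_mult)

lemma ratfun_cases:
  fixes f :: ratfun
  obtains a b where "f = to_fract a / to_fract b" "b \<noteq> 0"
  by (cases f) (auto simp: Fract_conv_to_fract)

lemma ratfun_cases_nonzero:
  fixes f :: ratfun assumes "f \<noteq> 0"
  obtains a b where "f = to_fract a / to_fract b" "a \<noteq> 0" "b \<noteq> 0"
  by (rule ratfun_cases[of f]) (use assms in auto)

text \<open>\<open>S0\<close> is a face of the semigroup and \<open>S1\<close> its complement. If
  \<open>f * g\<close> is in the ideal, the parts \<open>f0\<close>, \<open>g0\<close> supported on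
  the face have a product supported on both \<open>S0\<close> and \<open>S1\<close>, hence zero, and
  a field has no zero divisors.\<close>

lemma prime_in_face:
  assumes S0: "0 \<in> S0" "\<And>s t. s \<in> S0 \<Longrightarrow> t \<in> S0 \<Longrightarrow> s + t \<in> S0"
    and S1: "\<And>s t. s \<in> S0 \<union> S1 \<Longrightarrow> t \<in> S1 \<Longrightarrow> s + t \<in> S1" and disj: "S0 \<inter> S1 = {}"
  shows "prime_in (semigroup_algebra S1) (semigroup_algebra (S0 \<union> S1))"
proof -
  have add: "f + g \<in> semigroup_algebra S1" if "f \<in> semigroup_algebra S1" "g \<in> semigroup_algebra S1" for f g
    using that by (rule semigroup_algebra_add)
  have mult: "f * g \<in> semigroup_algebra S1" if "f \<in> semigroup_algebra (S0 \<union> S1)" "g \<in> semigroup_algebra S1" for f g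
    using that by (rule semigroup_algebra_mult) (rule S1)
  have zero: "f = 0" if "f \<in> semigroup_algebra S0" "f \<in> semigroup_algebra S1" for f
    using semigroup_algebra_Int[OF that] by (simp add: disj)
  show ?thesis unfolding prime_in_def
  proof (intro conjI ballI impI add mult)
    show "semigroup_algebra S1 \<subseteq> semigroup_algebra (S0 \<union> S1)" by (rule semigroup_algebra_mono) blast
    show "0 \<in> semigroup_algebra S1" by (rule semigroup_algebra_zero)
    show "1 \<notin> semigroup_algebra S1" using zero[of 1] semigroup_algebra_character[OF S0(1)] by auto
    show "f \<in> semigroup_algebra S1 \<or> g \<in> semigroup_algebra S1"
      if fg: "f \<in> semigroup_algebra (S0 \<union> S1)" "g \<in> semigroup_algebra (S0 \<union> S1)" "f * g \<in> semigroup_algebra S1" for f g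
    proof -
      obtain f0 f1 where f: "f0 \<in> semigroup_algebra S0" "f1 \<in> semigroup_algebra S1" "f = f0 + f1"
        using semigroup_algebra_split[OF fg(1)] by blast
      obtain g0 g1 where g: "g0 \<in> semigroup_algebra S0" "g1 \<in> semigroup_algebra S1" "g = g0 + g1"
        using semigroup_algebra_split[OF fg(2)] by blast
      have f0: "f0 \<in> semigroup_algebra (S0 \<union> S1)" by (rule subsetD[OF semigroup_algebra_mono f(1)]) blast
      have "f * g + - (f0 * g1 + g * f1) \<in> semigroup_algebra S1"
        by (intro add semigroup_algebra_uminus mult fg f0 f(2) g(2))
      moreover have "f * g + - (f0 * g1 + g * f1) = f0 * g0" unfolding f(3) g(3) by (simp add: algebra_simps)
      ultimately have "f0 * g0 \<in> semigroup_algebra S1" by simp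
      moreover have "f0 * g0 \<in> semigroup_algebra S0" by (rule semigroup_algebra_mult[OF f(1) g(1) S0(2)])
      ultimately have "f0 * g0 = 0" using zero by blast
      then show ?thesis using f g by auto
    qed
  qed
qed

section \<open>Prime divisors of toric surfaces\<close>

text \<open>The local ring of the generic point of the divisor of a ray: the valuation ring of the
  monomial valuation.\<close>

definition ray_alg :: "int \<times> int \<Rightarrow> ratfun set" where
  "ray_alg u = semigroup_algebra {m. 0 \<le> dot m u}"

definition ray_ideal :: "int \<times> int \<Rightarrow> ratfun set" where
  "ray_ideal u = semigroup_algebra {m. 0 < dot m u}"

definition ray_ring :: "int \<times> int \<Rightarrow> ratfun set" where
  "ray_ring u = localization_at (ray_alg u) (ray_ideal u)"

lemma is_subring_ray_alg: "is_subring (ray_alg u)"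
  unfolding ray_alg_def by (rule is_subring_semigroup_algebra) auto

lemma ray_alg_mult_ideal: "f \<in> ray_alg u \<Longrightarrow> g \<in> ray_ideal u \<Longrightarrow> f * g \<in> ray_ideal u"
  unfolding ray_alg_def ray_ideal_def by (rule semigroup_algebra_mult) auto

lemma ray_ideal_subset: "ray_ideal u \<subseteq> ray_alg u"
  unfolding ray_alg_def ray_ideal_def by (rule semigroup_algebra_mono) auto

lemma weight_zero_ideal: "f \<in> semigroup_algebra {m. dot m u = 0} \<Longrightarrow> f \<in> ray_ideal u \<Longrightarrow> f = 0"
proof -
  assume "f \<in> semigroup_algebra {m. dot m u = 0}" "f \<in> ray_ideal u"
  then have "f \<in> semigroup_algebra ({m. dot m u = 0} \<inter> {m. 0 < dot m u})"
    unfolding ray_ideal_def by (rule semigroup_algebra_Int)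
  also have "{m. dot m u = 0} \<inter> {m. 0 < dot m u} = {}" by auto
  finally show ?thesis by simp
qed

lemma ray_ideal_add: "f \<in> ray_ideal u \<Longrightarrow> g \<in> ray_ideal u \<Longrightarrow> f + g \<in> ray_ideal u"
  unfolding ray_ideal_def by (rule semigroup_algebra_add)

lemma prime_ray_ideal: "prime_in (ray_ideal u) (ray_alg u)"
proof -
  have "ray_alg u = semigroup_algebra ({m. dot m u = 0} \<union> {m. 0 < dot m u})"
    unfolding ray_alg_def by (rule arg_cong[where f = semigroup_algebra]) auto
  then show ?thesis unfolding ray_ideal_def by (simp only:) (rule prime_in_face; auto)
qed

text \<open>\<open>k\<close> is the least weight in the support of \<open>f\<close>. It is obtained
  as the largest lower bound for the weights, a maximum over a finite range because the weights of
  \<open>f\<close> are bounded on both sides.\<close>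

lemma laurent_weight:
  assumes f: "f \<in> laurent" "f \<noteq> 0"
  obtains k where "f \<in> semigroup_algebra {m. k \<le> dot m u}" "f \<notin> semigroup_algebra {m. k < dot m u}"
proof -
  obtain I c where I: "finite I" "f = (\<Sum>m\<in>I. const_fn (c m) * character m)"
    using f(1) by (rule semigroup_algebraE)
  have fI: "f \<in> semigroup_algebra I" unfolding I(2) using I(1) by (rule semigroup_algebraI) simp
  have "I \<noteq> {}" using f(2) I(2) by auto
  define a where "a = Min ((\<lambda>m. dot m u) ` I)"
  define b where "b = Max ((\<lambda>m. dot m u) ` I)"
  have ab: "a \<le> dot m u" "dot m u \<le> b" if "m \<in> I" for m using I(1) that by (auto simp: a_def b_def)
  have fa: "f \<in> semigroup_algebra {m. a \<le> dot m u}" by (rule subsetD[OF semigroup_algebra_mono fI]) (use ab in auto)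
  have fb: "f \<notin> semigroup_algebra {m. b < dot m u}"
  proof
    assume "f \<in> semigroup_algebra {m. b < dot m u}"
    with fI have "f \<in> semigroup_algebra (I \<inter> {m. b < dot m u})" by (rule semigroup_algebra_Int)
    also have "I \<inter> {m. b < dot m u} = {}" using ab(2) by force
    finally show False using f(2) by simp
  qed
  define K where "K = {k \<in> {a..b}. f \<in> semigroup_algebra {m. k \<le> dot m u}}"
  obtain m where "m \<in> I" using \<open>I \<noteq> {}\<close> by blast
  then have "a \<le> b" using ab(1)[of m] ab(2)[of m] by linarith
  then have K: "a \<in> K" using fa by (simp add: K_def)
  have fK: "finite K" unfolding K_def by (rule finite_subset[of _ "{a..b}"]) auto
  define k where "k = Max K"
  have kK: "k \<in> K" unfolding k_def using K fK by (intro Max_in) auto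
  have "f \<notin> semigroup_algebra {m. k < dot m u}"
  proof
    assume n: "f \<in> semigroup_algebra {m. k < dot m u}"
    have "k \<noteq> b" using n fb by blast
    then have "k + 1 \<in> K" using kK n by (auto simp: K_def add1_zle_eq)
    then have "k + 1 \<le> k" using Max_ge[OF fK] unfolding k_def by blast
    then show False by simp
  qed
  then show ?thesis using that kK by (auto simp: K_def)
qed

context
  fixes u m0 assumes m0: "dot m0 u = 1"
begin

text \<open>The character of \<open>m0\<close> has weight 1, so its powers shift the weight
  filtration and reduce every step of it to the ring and its ideal.\<close>

lemma weight_shift:
  "f \<in> semigroup_algebra {m. k \<le> dot m u} \<longleftrightarrow> f * character m0 powi (- k) \<in> ray_alg u"
  "f \<in> semigroup_algebra {m. k < dot m u} \<longleftrightarrow> f * character m0 powi (- k) \<in> ray_ideal u"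
proof -
  have t: "character m0 powi j \<in> semigroup_algebra {m. dot m u = j}" for j
    using semigroup_algebra_character[of "(j * fst m0, j * snd m0)" "{m. dot m u = j}"] m0
    by (simp add: character_powi dot_scale)
  have inv: "f * character m0 powi (- k) * character m0 powi k = f"
    by (simp add: power_int_minus)
  have up: "f * character m0 powi j \<in> semigroup_algebra {m. k + j \<le> dot m u}"
    if "f \<in> semigroup_algebra {m. k \<le> dot m u}" for f k j
    by (rule semigroup_algebra_mult[OF that t]) auto
  have up': "f * character m0 powi j \<in> semigroup_algebra {m. k + j < dot m u}"
    if "f \<in> semigroup_algebra {m. k < dot m u}" for f k j
    by (rule semigroup_algebra_mult[OF that t]) auto
  show "f \<in> semigroup_algebra {m. k \<le> dot m u} \<longleftrightarrow> f * character m0 powi (- k) \<in> ray_alg u"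
    unfolding ray_alg_def using up[of f k "- k"] up[of "f * character m0 powi (- k)" 0 k] inv by auto
  show "f \<in> semigroup_algebra {m. k < dot m u} \<longleftrightarrow> f * character m0 powi (- k) \<in> ray_ideal u"
    unfolding ray_ideal_def using up'[of f k "- k"] up'[of "f * character m0 powi (- k)" 0 k] inv by auto
qed

lemma ray_unit: "s \<in> ray_alg u - ray_ideal u \<Longrightarrow> s \<in> unit_set (ray_ring u)"
  unfolding ray_ring_def by (rule inverse_in_localization[OF is_subring_ray_alg prime_ray_ideal])

lemma is_subring_ray_ring: "is_subring (ray_ring u)"
  unfolding ray_ring_def by (rule is_subring_localization[OF is_subring_ray_alg prime_ray_ideal])

lemma ray_alg_subset_ring: "ray_alg u \<subseteq> ray_ring u"
  unfolding ray_ring_def by (rule subset_localization[OF is_subring_ray_alg prime_ray_ideal])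

lemma laurent_decompose:
  assumes "f \<in> laurent" "f \<noteq> 0"
  obtains k s where "s \<in> ray_alg u - ray_ideal u" "f = s * character m0 powi k"
    "f \<in> semigroup_algebra {m. k \<le> dot m u}" "f \<notin> semigroup_algebra {m. k < dot m u}"
proof -
  obtain k where k: "f \<in> semigroup_algebra {m. k \<le> dot m u}" "f \<notin> semigroup_algebra {m. k < dot m u}"
    using laurent_weight[OF assms] by blast
  have "f * character m0 powi (- k) \<in> ray_alg u - ray_ideal u" using k weight_shift by blast
  moreover have "f = f * character m0 powi (- k) * character m0 powi k" by (simp add: power_int_minus)
  ultimately show ?thesis using k that by blast
qed

text \<open>A nonzero Laurent polynomial is a power of the character of \<open>m0\<close> times an
  element of lowest weight 0, and the latter is a unit of the local ring. Quotients of Laurent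
  polynomials exhaust the field.\<close>

lemma ray_dvr: "is_dvr (ray_ring u) (character m0)"
  unfolding is_dvr_def
proof (intro conjI allI impI)
  let ?t = "character m0"
  show R: "is_subring (ray_ring u)" by (rule is_subring_ray_ring)
  have tI: "?t \<in> ray_ideal u" unfolding ray_ideal_def by (rule semigroup_algebra_character) (simp add: m0)
  note sub = is_subringD[OF R]
  have tR: "?t \<in> ray_ring u" using tI ray_ideal_subset ray_alg_subset_ring by blast
  have tn: "?t \<notin> unit_set (ray_ring u)"
    unfolding ray_ring_def by (rule prime_not_unit[OF is_subring_ray_alg prime_ray_ideal tI])
  have "ray_ring u - unit_set (ray_ring u) = {?t * a |a. a \<in> ray_ring u}"
  proof (intro equalityI subsetI)
    fix f assume f: "f \<in> ray_ring u - unit_set (ray_ring u)"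
    then obtain a s where as: "f = a / s" "a \<in> ray_alg u" "s \<in> ray_alg u - ray_ideal u"
      unfolding ray_ring_def localization_at_def by blast
    have s: "s \<in> unit_set (ray_ring u)" by (rule ray_unit[OF as(3)])
    have "a \<in> ray_ideal u"
    proof (rule ccontr)
      assume "a \<notin> ray_ideal u"
      then have "a \<in> unit_set (ray_ring u)" using ray_unit as(2) by blast
      then have "a * inverse s \<in> unit_set (ray_ring u)" using unit_set_mult[OF R] unit_set_inverse[OF R s] by blast
      then show False using f as(1) by (simp add: divide_inverse)
    qed
    then have "a \<in> semigroup_algebra {m. 1 \<le> dot m u}"
      unfolding ray_ideal_def by (rule subsetD[OF semigroup_algebra_mono, rotated]) auto
    then have "a * ?t powi (- 1) \<in> ray_alg u" by (simp only: weight_shift(1))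
    then have "a * ?t powi (- 1) * inverse s \<in> ray_ring u"
      using ray_alg_subset_ring sub(5) unit_setD[OF s] by blast
    moreover have "f = ?t * (a * ?t powi (- 1) * inverse s)" unfolding as(1) by (simp add: power_int_minus divide_inverse)
    ultimately show "f \<in> {?t * a |a. a \<in> ray_ring u}" by blast
  next
    fix f assume "f \<in> {?t * a |a. a \<in> ray_ring u}"
    then obtain a where "f = ?t * a" "a \<in> ray_ring u" by blast
    then show "f \<in> ray_ring u - unit_set (ray_ring u)"
      using tn unit_set_factor[OF R tR, of a] sub(5)[OF tR, of a] by blast
  qed
  then show "uniformizer (ray_ring u) ?t" by (simp add: uniformizer_def)
  fix f :: ratfun assume "f \<noteq> 0"
  then obtain p q where pq: "f = to_fract p / to_fract q" "p \<noteq> 0" "q \<noteq> 0" by (rule ratfun_cases_nonzero)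
  have nz: "to_fract p \<noteq> 0" "to_fract q \<noteq> 0" using pq by simp_all
  obtain k s where s: "s \<in> ray_alg u - ray_ideal u" "to_fract p = s * ?t powi k"
    using laurent_decompose[OF poly_in_laurent nz(1)] by blast
  obtain j r where r: "r \<in> ray_alg u - ray_ideal u" "to_fract q = r * ?t powi j"
    using laurent_decompose[OF poly_in_laurent nz(2)] by blast
  have "f = (s * inverse r) * ?t powi (k - j)"
    unfolding pq(1) s(2) r(2) by (simp add: power_int_diff divide_inverse)
  moreover have "s * inverse r \<in> unit_set (ray_ring u)"
    using ray_unit s r unit_set_mult[OF R] unit_set_inverse[OF R] by blast
  ultimately show "\<exists>n. \<exists>w\<in>unit_set (ray_ring u). f = w * ?t powi n" by blast
qed

lemma ord_ray:
  assumes f: "f \<in> laurent" "f \<noteq> 0"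
  shows "f \<in> semigroup_algebra {m. ord_at (ray_ring u) f \<le> dot m u}"
    and "f \<in> semigroup_algebra {m. k \<le> dot m u} \<Longrightarrow> k \<le> ord_at (ray_ring u) f"
proof -
  obtain j s where s: "s \<in> ray_alg u - ray_ideal u" "f = s * character m0 powi j"
    and j: "f \<in> semigroup_algebra {m. j \<le> dot m u}" "f \<notin> semigroup_algebra {m. j < dot m u}"
    using laurent_decompose[OF f] by blast
  have o: "ord_at (ray_ring u) f = j" unfolding s(2) by (rule ord_at_eqI[OF ray_dvr ray_unit[OF s(1)]])
  show "f \<in> semigroup_algebra {m. ord_at (ray_ring u) f \<le> dot m u}" using o j by simp
  assume k: "f \<in> semigroup_algebra {m. k \<le> dot m u}"
  show "k \<le> ord_at (ray_ring u) f"
  proof (rule ccontr)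
    assume "\<not> k \<le> ord_at (ray_ring u) f"
    then have "{m. k \<le> dot m u} \<subseteq> {m. j < dot m u}" using o by auto
    then show False using k j(2) semigroup_algebra_mono by blast
  qed
qed

lemma ord_ray_character: "ord_at (ray_ring u) (character m) = dot m u"
proof -
  define k where "k = dot m u"
  define s where "s = character (m + (- k * fst m0, - k * snd m0))"
  have d: "dot (m + (- k * fst m0, - k * snd m0)) u = 0"
    unfolding dot_add dot_scale by (simp add: m0 k_def)
  have "s \<in> ray_alg u" unfolding s_def ray_alg_def by (rule semigroup_algebra_character) (simp only: mem_Collect_eq d order_refl)
  moreover have "s \<notin> ray_ideal u"
  proof
    have "s \<in> semigroup_algebra {m. dot m u = 0}" unfolding s_def by (rule semigroup_algebra_character) (simp only: mem_Collect_eq d order_refl)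
    moreover assume "s \<in> ray_ideal u"
    ultimately have "s = 0" by (rule weight_zero_ideal)
    then show False by (simp add: s_def)
  qed
  ultimately have "s \<in> unit_set (ray_ring u)" using ray_unit by blast
  then have "ord_at (ray_ring u) (s * character m0 powi k) = k" by (rule ord_at_eqI[OF ray_dvr])
  moreover have "s * character m0 powi k = character m"
    unfolding s_def character_add character_powi by (simp add: power_int_minus)
  ultimately show ?thesis by (simp add: k_def)
qed

end

text \<open>The local ring of the generic point of a curve that meets the torus.\<close>

definition poly_local :: "complex poly poly \<Rightarrow> ratfun set" where
  "poly_local p = {to_fract a / to_fract b |a b. \<not> p dvd b}"

context
  fixes p :: "complex poly poly" assumes p: "prime_elem p"
begin

lemma to_fract_in_poly_local: "to_fract a \<in> poly_local p"
proof -
  have "\<not> p dvd 1" using p by (simp add: prime_elem_def)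
  moreover have "to_fract a = to_fract a / to_fract 1" by simp
  ultimately show ?thesis unfolding poly_local_def by blast
qed

lemma poly_local_unit: "\<not> p dvd a \<Longrightarrow> to_fract a \<in> unit_set (poly_local p)"
proof -
  assume a: "\<not> p dvd a"
  then have "inverse (to_fract a) = to_fract 1 / to_fract a" by (simp add: divide_inverse)
  then have "inverse (to_fract a) \<in> poly_local p" unfolding poly_local_def using a by blast
  moreover have "a \<noteq> 0" using a by auto
  ultimately show ?thesis using to_fract_in_poly_local by (simp add: unit_set_def)
qed

lemma is_subring_poly_local: "is_subring (poly_local p)"
  unfolding is_subring_def
proof (intro conjI ballI)
  show "1 \<in> poly_local p" using to_fract_in_poly_local[of 1] by simp
  fix f assume "f \<in> poly_local p"
  then obtain a b where f: "f = to_fract a / to_fract b" "\<not> p dvd b" unfolding poly_local_def by blast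
  have "- f = to_fract (- a) / to_fract b" unfolding f(1) by (simp add: to_fract_uminus)
  then show "- f \<in> poly_local p" using f(2) unfolding poly_local_def by blast
  fix g assume "g \<in> poly_local p"
  then obtain c d where g: "g = to_fract c / to_fract d" "\<not> p dvd d" unfolding poly_local_def by blast
  have nz: "to_fract b \<noteq> 0" "to_fract d \<noteq> 0" using f g by auto
  have bd: "\<not> p dvd b * d" using f g p by (simp add: prime_elem_dvd_mult_iff)
  have "f + g = to_fract (a * d + c * b) / to_fract (b * d)" "f * g = to_fract (a * c) / to_fract (b * d)"
    unfolding f(1) g(1) using nz by (simp_all add: to_fract_mult to_fract_add field_simps)
  then show "f + g \<in> poly_local p" "f * g \<in> poly_local p" using bd unfolding poly_local_def by blast+
qed

lemma poly_local_not_unit: "to_fract p \<notin> unit_set (poly_local p)"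
proof
  assume "to_fract p \<in> unit_set (poly_local p)"
  then have "inverse (to_fract p) \<in> poly_local p" "to_fract p \<noteq> 0" by (auto simp: unit_set_def)
  then obtain a b where ab: "inverse (to_fract p) = to_fract a / to_fract b" "\<not> p dvd b" unfolding poly_local_def by blast
  have "to_fract b \<noteq> 0" using ab by auto
  then have "to_fract b = to_fract (p * a)"
    using ab(1) \<open>to_fract p \<noteq> 0\<close> unfolding to_fract_mult by (simp add: field_simps)
  then have "b = p * a" by (simp only: to_fract_eq_iff)
  then show False using ab(2) by simp
qed

text \<open>The order is the multiplicity of \<open>p\<close> in the numerator minus that in the
  denominator.\<close>

lemma poly_local_dvr: "is_dvr (poly_local p) (to_fract p)"
  unfolding is_dvr_def
proof (intro conjI allI impI)
  show R: "is_subring (poly_local p)" by (rule is_subring_poly_local)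
  note sub = is_subringD[OF R]
  have p0: "p \<noteq> 0" using p by (simp add: prime_elem_def)
  have "poly_local p - unit_set (poly_local p) = {to_fract p * a |a. a \<in> poly_local p}"
  proof (intro equalityI subsetI)
    fix f assume f: "f \<in> poly_local p - unit_set (poly_local p)"
    then obtain a b where ab: "f = to_fract a / to_fract b" "\<not> p dvd b" unfolding poly_local_def by blast
    have "p dvd a"
    proof (rule ccontr)
      assume "\<not> p dvd a"
      then have "to_fract a * inverse (to_fract b) \<in> unit_set (poly_local p)"
        using unit_set_mult[OF R] unit_set_inverse[OF R] poly_local_unit ab(2) by blast
      then show False using f ab(1) by (simp add: divide_inverse)
    qed
    then obtain c where "a = p * c" by blast
    then have "f = to_fract p * (to_fract c / to_fract b)" using ab(1) by (simp add: to_fract_mult)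
    then show "f \<in> {to_fract p * a |a. a \<in> poly_local p}" using ab(2) unfolding poly_local_def by blast
  next
    fix f assume "f \<in> {to_fract p * a |a. a \<in> poly_local p}"
    then obtain a where "f = to_fract p * a" "a \<in> poly_local p" by blast
    then show "f \<in> poly_local p - unit_set (poly_local p)"
      using poly_local_not_unit unit_set_factor[OF R to_fract_in_poly_local, of a p]
        sub(5)[OF to_fract_in_poly_local, of a p] by blast
  qed
  then show "uniformizer (poly_local p) (to_fract p)" using p0 by (simp add: uniformizer_def)
  fix f :: ratfun assume "f \<noteq> 0"
  then obtain a b where ab: "f = to_fract a / to_fract b" "a \<noteq> 0" "b \<noteq> 0" by (rule ratfun_cases_nonzero)
  have nu: "\<not> is_unit p" using p by (simp add: prime_elem_def)
  obtain a' k where a': "a = p ^ k * a'" "\<not> p dvd a'" using multiplicity_decompose'[OF ab(2) nu] by metis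
  obtain b' j where b': "b = p ^ j * b'" "\<not> p dvd b'" using multiplicity_decompose'[OF ab(3) nu] by metis
  have nz: "to_fract p \<noteq> 0" "to_fract b' \<noteq> 0" using p0 b' by auto
  have "f = (to_fract a' * inverse (to_fract b')) * to_fract p powi (int k - int j)"
    unfolding ab(1) a'(1) b'(1) to_fract_mult to_fract_power using nz by (simp add: power_int_diff divide_inverse)
  moreover have "to_fract a' * inverse (to_fract b') \<in> unit_set (poly_local p)"
    using poly_local_unit a' b' unit_set_mult[OF R] unit_set_inverse[OF R] by blast
  ultimately show "\<exists>n. \<exists>w\<in>unit_set (poly_local p). f = w * to_fract p powi n" by blast
qed

lemma to_fract_unit_iff: "to_fract a \<in> unit_set (poly_local p) \<longleftrightarrow> \<not> p dvd a"
proof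
  assume a: "to_fract a \<in> unit_set (poly_local p)"
  show "\<not> p dvd a"
  proof
    assume "p dvd a"
    then obtain c where "a = p * c" by blast
    then have "to_fract p * to_fract c \<in> unit_set (poly_local p)" using a by (simp add: to_fract_mult)
    then have "to_fract p \<in> unit_set (poly_local p)"
      by (rule unit_set_factor[OF is_subring_poly_local to_fract_in_poly_local to_fract_in_poly_local])
    then show False using poly_local_not_unit by simp
  qed
qed (rule poly_local_unit)

end

section \<open>Affine charts and the points of codimension one\<close>

lemma dual_semigroup_cone_of: "dual_semigroup (cone_of B) = {m. \<forall>b\<in>B. 0 \<le> dot m b}"
proof (intro equalityI subsetI CollectI ballI)
  fix m b assume m: "m \<in> dual_semigroup (cone_of B)" "b \<in> B"
  then have "0 \<le> lvec m \<bullet> lvec b" using cone_of_inc unfolding dual_semigroup_def by blast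
  then show "0 \<le> dot m b" by simp
next
  fix m assume m: "m \<in> {m. \<forall>b\<in>B. 0 \<le> dot m b}"
  have "lvec ` B \<subseteq> {x. 0 \<le> lvec m \<bullet> x}" using m by auto
  then have "cone_of B \<subseteq> {x. 0 \<le> lvec m \<bullet> x}"
    unfolding cone_of_def by (rule hull_minimal[where S = convex_cone]) (rule convex_cone_halfspace_ge)
  then show "m \<in> dual_semigroup (cone_of B)" unfolding dual_semigroup_def by blast
qed

definition cone_alg :: "(int \<times> int) set \<Rightarrow> ratfun set" where
  "cone_alg B = semigroup_algebra {m. \<forall>b\<in>B. 0 \<le> dot m b}"

lemma is_subring_cone_alg: "is_subring (cone_alg B)"
  unfolding cone_alg_def by (rule is_subring_semigroup_algebra) auto

lemma cone_alg_subset_laurent: "cone_alg B \<subseteq> laurent"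
  unfolding cone_alg_def by (rule semigroup_algebra_mono) simp

lemma cone_alg_character: "(\<And>b. b \<in> B \<Longrightarrow> 0 \<le> dot m b) \<Longrightarrow> character m \<in> cone_alg B"
  unfolding cone_alg_def by (rule semigroup_algebra_character) simp

lemma cone_alg_const: "const_fn c \<in> cone_alg B"
  using semigroup_algebra_term[of 0 "{m. \<forall>b\<in>B. 0 \<le> dot m b}" c] by (simp add: cone_alg_def)

text \<open>The structure on which the theory of divisors is built, in a form shared by the fan of
  \<open>Q\<close> and its smooth refinements: the torus is a chart, and every cone is spanned by
  generators of rays of the fan.\<close>

definition toric_fan :: "(real \<times> real) set set \<Rightarrow> bool" where
  "toric_fan \<Sigma> \<longleftrightarrow> finite \<Sigma> \<and> {0} \<in> \<Sigma> \<and> (\<forall>\<sigma>\<in>\<Sigma>. \<exists>B\<subseteq>rays \<Sigma>. finite B \<and> \<sigma> = cone_of B)"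

lemma toric_surface_point:
  assumes "toric_fan \<Sigma>" "R \<in> toric_surface \<Sigma>"
  obtains B P where "B \<subseteq> rays \<Sigma>" "finite B" "cone_of B \<in> \<Sigma>" "prime_in P (cone_alg B)" "R = localization_at (cone_alg B) P"
proof -
  obtain \<sigma> P where *: "\<sigma> \<in> \<Sigma>" "R = localization_at (semigroup_algebra (dual_semigroup \<sigma>)) P"
    "primeideal P (ring_of (semigroup_algebra (dual_semigroup \<sigma>)))"
    using assms(2) unfolding toric_surface_def by blast
  have "\<exists>B\<subseteq>rays \<Sigma>. finite B \<and> \<sigma> = cone_of B" using assms(1) *(1) by (simp add: toric_fan_def)
  then obtain B where B: "B \<subseteq> rays \<Sigma>" "finite B" "\<sigma> = cone_of B" by blast
  have A: "semigroup_algebra (dual_semigroup \<sigma>) = cone_alg B"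
    unfolding B(3) cone_alg_def dual_semigroup_cone_of ..
  have "prime_in P (cone_alg B)" using *(3) unfolding A primeideal_ring_of[OF is_subring_cone_alg] .
  moreover have "cone_of B \<in> \<Sigma>" "R = localization_at (cone_alg B) P" using *(1,2) B(3) A by (simp_all only:)
  ultimately show ?thesis using that[OF B(1,2)] by blast
qed

lemma toric_surface_pointI:
  assumes "cone_of B \<in> \<Sigma>" "prime_in P (cone_alg B)"
  shows "localization_at (cone_alg B) P \<in> toric_surface \<Sigma>"
proof -
  have A: "semigroup_algebra (dual_semigroup (cone_of B)) = cone_alg B"
    unfolding cone_alg_def dual_semigroup_cone_of ..
  have "primeideal P (ring_of (cone_alg B))" using assms(2) by (simp add: primeideal_ring_of[OF is_subring_cone_alg])
  then show ?thesis unfolding toric_surface_def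
    by (intro UN_I[OF assms(1)] CollectI exI[of _ P]) (simp add: A)
qed

text \<open>The prime polynomials that stay prime in the Laurent ring, that is, those not associated
  with a coordinate.\<close>

definition torus_prime :: "complex poly poly \<Rightarrow> bool" where
  "torus_prime p \<longleftrightarrow> prime_elem p \<and> \<not> p dvd [:[:0, 1:]:] \<and> \<not> p dvd [:0, 1:]"

lemma torus_primeD: "torus_prime p \<Longrightarrow> prime_elem p"
  by (simp add: torus_prime_def)

lemma character_unit_poly_local:
  assumes p: "torus_prime p" shows "character m \<in> unit_set (poly_local p)"
proof -
  note R = is_subring_poly_local[OF torus_primeD[OF p]]
  have "fn_x \<in> unit_set (poly_local p)" "fn_y \<in> unit_set (poly_local p)"
    unfolding fn_x_def fn_y_def using p poly_local_unit unfolding torus_prime_def by blast+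
  then show ?thesis unfolding character_def using unit_set_mult[OF R] unit_set_powi[OF R] by blast
qed

lemma laurent_subset_poly_local:
  assumes p: "torus_prime p" shows "laurent \<subseteq> poly_local p"
proof
  fix f assume "f \<in> laurent"
  then obtain k g where "f = character k * to_fract g" by (rule laurent_clear_denominators)
  then show "f \<in> poly_local p"
    using is_subringD(5)[OF is_subring_poly_local[OF torus_primeD[OF p]]] unit_setD[OF character_unit_poly_local[OF p]]
      to_fract_in_poly_local[OF torus_primeD[OF p]] by blast
qed

text \<open>In the chart of the zero cone, which is the torus, the point is the centre of the
  valuation.\<close>

lemma poly_local_point:
  assumes \<Sigma>: "toric_fan \<Sigma>" and p: "torus_prime p" shows "poly_local p \<in> toric_surface \<Sigma>"
proof -
  note dvr = poly_local_dvr[OF torus_primeD[OF p]]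
  note R = dvr_basics(1)[OF dvr]
  let ?P = "laurent - unit_set (poly_local p)"
  have L: "cone_alg {} = laurent" by (simp add: cone_alg_def)
  have P: "prime_in ?P laurent"
    by (rule prime_in_contraction[OF is_subring_laurent dvr laurent_subset_poly_local[OF p]])
  have "localization_at laurent ?P = poly_local p"
  proof
    show "localization_at laurent ?P \<subseteq> poly_local p"
      by (rule localization_subset[OF R laurent_subset_poly_local[OF p]]) blast
    show "poly_local p \<subseteq> localization_at laurent ?P"
    proof
      fix f assume "f \<in> poly_local p"
      then obtain a b where ab: "f = to_fract a / to_fract b" "\<not> p dvd b" unfolding poly_local_def by blast
      then have "to_fract b \<in> laurent - ?P" using poly_local_unit[OF torus_primeD[OF p]] poly_in_laurent by blast
      then show "f \<in> localization_at laurent ?P" unfolding localization_at_def using ab poly_in_laurent by blast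
    qed
  qed
  moreover have "cone_of {} \<in> \<Sigma>" using \<Sigma> by (simp add: toric_fan_def)
  ultimately show ?thesis using toric_surface_pointI[of "{}" \<Sigma> ?P] P L by simp
qed

lemma ray_ring_point:
  assumes "u \<in> rays \<Sigma>" shows "ray_ring u \<in> toric_surface \<Sigma>"
proof -
  have "cone_alg {u} = ray_alg u" by (simp add: cone_alg_def ray_alg_def)
  then show ?thesis
    using toric_surface_pointI[of "{u}" \<Sigma> "ray_ideal u"] assms prime_ray_ideal[of u]
    by (simp add: rays_def ray_ring_def)
qed

lemma ray_ring_dvr:
  assumes "u \<in> rays \<Sigma>"
  obtains m where "dot m u = 1" "is_dvr (ray_ring u) (character m)"
proof -
  have "primitive u" using assms by (simp add: rays_def)
  then obtain m where "dot m u = 1" using primitive_dot by blast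
  then show ?thesis using that ray_dvr by blast
qed

lemma toric_surface_subring:
  assumes "toric_fan \<Sigma>" "R \<in> toric_surface \<Sigma>" shows "is_subring R"
  by (rule toric_surface_point[OF assms]) (simp add: is_subring_localization[OF is_subring_cone_alg])

lemma characters_in_prime:
  assumes A: "is_subring A" and P: "prime_in P A" and T: "\<And>m. m \<in> T \<Longrightarrow> character m \<in> P" and c: "\<And>c. const_fn c \<in> A"
  shows "semigroup_algebra T \<subseteq> P"
proof
  fix f assume "f \<in> semigroup_algebra T"
  then obtain I c where I: "finite I" "I \<subseteq> T" "f = (\<Sum>m\<in>I. const_fn (c m) * character m)"
    by (rule semigroup_algebraE)
  have Padd: "a + b \<in> P" if "a \<in> P" "b \<in> P" for a b using P that unfolding prime_in_def by blast
  have P0: "0 \<in> P" using P unfolding prime_in_def by blast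
  have Pm: "const_fn a * character m \<in> P" if "m \<in> T" for a m
    using P T[OF that] c[of a] unfolding prime_in_def by blast
  have "(\<Sum>m\<in>J. const_fn (c m) * character m) \<in> P" if "finite J" "J \<subseteq> T" for J
    using that by (induction J rule: finite_induct) (simp_all add: P0 Padd Pm)
  then show "f \<in> P" unfolding I(3) using I(1,2) by blast
qed

text \<open>The hypothesis \<open>chars\<close> says that \<open>P\<close> contains the ideal of the
  divisor of \<open>u\<close> in the chart. The inclusion of local rings then expresses that the
  point lies on this divisor.\<close>

lemma point_below_ray:
  assumes P: "prime_in P (cone_alg B)" and u: "u \<in> B"
    and chars: "\<And>m. (\<And>b. b \<in> B \<Longrightarrow> 0 \<le> dot m b) \<Longrightarrow> 0 < dot m u \<Longrightarrow> character m \<in> P"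
    and m0: "dot m0 u = 1"
  shows "localization_at (cone_alg B) P \<subseteq> ray_ring u"
proof (rule localization_subset[OF is_subring_ray_ring[OF m0]])
  let ?S = "{m. \<forall>b\<in>B. 0 \<le> dot m b}"
  have A: "cone_alg B \<subseteq> ray_alg u"
    unfolding cone_alg_def ray_alg_def using u by (intro semigroup_algebra_mono) blast
  then show "cone_alg B \<subseteq> ray_ring u" using ray_alg_subset_ring[OF m0] by blast
  fix s assume s: "s \<in> cone_alg B - P"
  have "s \<notin> ray_ideal u"
  proof
    assume "s \<in> ray_ideal u"
    then have "s \<in> semigroup_algebra (?S \<inter> {m. 0 < dot m u})"
      using s semigroup_algebra_Int unfolding cone_alg_def ray_ideal_def by blast
    moreover have "semigroup_algebra (?S \<inter> {m. 0 < dot m u}) \<subseteq> P"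
      by (rule characters_in_prime[OF is_subring_cone_alg P]) (use chars cone_alg_const in auto)
    ultimately show False using s by blast
  qed
  then show "s \<in> unit_set (ray_ring u)" using ray_unit[OF m0] s A by blast
qed

text \<open>Off the boundary each generator has a regular character that is positive on it and does
  not vanish at the point. Their product is a unit with exponent \<open>M\<close> positive on all of
  \<open>B\<close>, and every character becomes regular after multiplication by a power of
  it.\<close>

lemma point_in_torus:
  assumes P: "prime_in P (cone_alg B)" and B: "finite B"
    and chars: "\<And>u. u \<in> B \<Longrightarrow> \<exists>m. (\<forall>b\<in>B. 0 \<le> dot m b) \<and> 0 < dot m u \<and> character m \<notin> P"
  shows "character m \<in> unit_set (localization_at (cone_alg B) P)"
proof -
  let ?A = "cone_alg B"
  let ?R = "localization_at ?A P"
  have R: "is_subring ?R" by (rule is_subring_localization[OF is_subring_cone_alg P])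
  obtain w where w: "\<And>u. u \<in> B \<Longrightarrow> (\<forall>b\<in>B. 0 \<le> dot (w u) b) \<and> 0 < dot (w u) u \<and> character (w u) \<notin> P"
    using chars by metis
  define M where "M = (\<Sum>u\<in>B. w u)"
  have "character (\<Sum>u\<in>C. w u) \<in> ?A - P" if "C \<subseteq> B" "finite C" for C
    using that(2,1)
  proof (induction C rule: finite_induct)
    case empty
    then show ?case using prime_in_complement(1)[OF is_subring_cone_alg P] by simp
  next
    case (insert u C)
    have "character (w u) \<in> ?A - P" using w[of u] insert.prems cone_alg_character by auto
    then have "character (w u) * character (\<Sum>u\<in>C. w u) \<in> ?A - P"
      using insert prime_in_complement(2)[OF is_subring_cone_alg P] by blast
    then show ?case using insert.hyps by (simp add: character_add)
  qed
  then have "character M \<in> ?A - P" using B by (simp add: M_def)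
  then have Mu: "character M \<in> unit_set ?R" by (rule inverse_in_localization[OF is_subring_cone_alg P])
  have M: "1 \<le> dot M b" if b: "b \<in> B" for b
  proof -
    have "0 \<le> (\<Sum>u\<in>B - {b}. dot (w u) b)" using w b by (intro sum_nonneg) auto
    moreover have "dot M b = dot (w b) b + (\<Sum>u\<in>B - {b}. dot (w u) b)"
      unfolding M_def dot_sum(1) using B b by (rule sum.remove)
    ultimately show ?thesis using w[OF b] by simp
  qed
  have in_R: "character k \<in> ?R" for k
  proof -
    \<comment> \<open>Large enough to outweigh every negative value of \<open>k\<close> on
      \<open>B\<close>, as \<open>M\<close> is at least 1 there.\<close>
    define N where "N = (\<Sum>b\<in>B. \<bar>dot k b\<bar>)"
    have N: "0 \<le> N" "\<bar>dot k b\<bar> \<le> N" if "b \<in> B" for b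
      unfolding N_def using B that by (auto intro!: sum_nonneg member_le_sum)
    have "character (k + (N * fst M, N * snd M)) \<in> ?A"
    proof (rule cone_alg_character)
      fix b assume b: "b \<in> B"
      have "N * 1 \<le> N * dot M b" using N(1)[OF b] M[OF b] by (intro mult_left_mono)
      then show "0 \<le> dot (k + (N * fst M, N * snd M)) b"
        unfolding dot_add dot_scale using N(2)[OF b] by linarith
    qed
    then have "character k * character M powi N \<in> ?R"
      using subset_localization[OF is_subring_cone_alg P] unfolding character_add character_powi by blast
    moreover have "inverse (character M powi N) \<in> ?R"
      using unit_set_powi[OF R Mu] unit_setD by blast
    ultimately have "character k * character M powi N * inverse (character M powi N) \<in> ?R"
      using is_subringD(5)[OF R] by blast
    moreover have "character k * character M powi N * inverse (character M powi N) = character k" by simp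
    ultimately show ?thesis by (simp only:)
  qed
  then show ?thesis using in_R[of "- m"] by (simp add: unit_set_def character_uminus)
qed

text \<open>If every prime polynomial were a unit at the point, unique factorization would make all
  nonzero polynomials units and \<open>R\<close> the whole field. A prime that is not a unit cannot
  divide a coordinate, because characters are units.\<close>

lemma torus_point_below_curve:
  assumes P: "prime_in P (cone_alg B)" and R: "R = localization_at (cone_alg B) P" "R \<noteq> UNIV"
    and chars: "\<And>m. character m \<in> unit_set R"
  shows "\<exists>p. torus_prime p \<and> R \<subseteq> poly_local p"
proof -
  have sR: "is_subring R" unfolding R by (rule is_subring_localization[OF is_subring_cone_alg P])
  note sub = is_subringD[OF sR]
  have cR: "const_fn c \<in> R" for c
    unfolding R(1) using subset_localization[OF is_subring_cone_alg P] cone_alg_const by blast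
  have LR: "laurent \<subseteq> R"
  proof
    fix f assume "f \<in> laurent"
    then obtain I c where I: "finite I" "f = (\<Sum>m\<in>I. const_fn (c m) * character m)" by (rule semigroup_algebraE)
    have "(\<Sum>m\<in>J. const_fn (c m) * character m) \<in> R" if "finite J" for J
      using that by (induction J rule: finite_induct) (simp_all add: sub cR unit_setD[OF chars])
    then show "f \<in> R" using I by blast
  qed
  have polyR: "to_fract g \<in> R" for g using LR poly_in_laurent by blast
  have "\<exists>p. prime p \<and> to_fract p \<notin> unit_set R"
  proof (rule ccontr)
    assume "\<not> ?thesis"
    then have pu: "to_fract p \<in> unit_set R" if "prime p" for p using that by blast
    have unit: "g = 0 \<or> to_fract g \<in> unit_set R" for g
    proof (induction g rule: prime_divisors_induct)
      case (unit g)
      then obtain h where "1 = g * h" by blast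
      then have "to_fract g * to_fract h \<in> unit_set R" using unit_set_one[OF sR] by (simp flip: to_fract_mult)
      then show ?case using unit_set_factor[OF sR polyR polyR] by blast
    next
      case (factor p g)
      then show ?case using unit_set_mult[OF sR pu] by (auto simp: to_fract_mult)
    qed simp
    have "f \<in> R" for f
    proof -
      obtain a b where ab: "f = to_fract a / to_fract b" "b \<noteq> 0" by (rule ratfun_cases)
      then have "inverse (to_fract b) \<in> R" using unit[of b] unit_setD by blast
      then show ?thesis unfolding ab(1) divide_inverse using sub(5) polyR by blast
    qed
    then show False using R(2) by blast
  qed
  then obtain p where p: "prime p" "to_fract p \<notin> unit_set R" by blast
  have ndvd: "\<not> p dvd g" if g: "to_fract g \<in> unit_set R" for g
  proof
    assume "p dvd g"
    then obtain h where "g = p * h" by blast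
    then have "to_fract p * to_fract h \<in> unit_set R" using g by (simp add: to_fract_mult)
    then have "to_fract p \<in> unit_set R" by (rule unit_set_factor[OF sR polyR polyR])
    then show False using p(2) by blast
  qed
  have "to_fract [:[:0, 1:]:] \<in> unit_set R" "to_fract [:0, 1:] \<in> unit_set R"
    using chars[of "(1, 0)"] chars[of "(0, 1)"] by (simp_all add: character_def fn_x_def fn_y_def)
  then have tp: "torus_prime p" using p(1) ndvd by (simp add: torus_prime_def)
  have "R \<subseteq> poly_local p" unfolding R(1)
  proof (rule localization_subset[OF is_subring_poly_local[OF torus_primeD[OF tp]]])
    show "cone_alg B \<subseteq> poly_local p" using cone_alg_subset_laurent laurent_subset_poly_local[OF tp] by blast
    fix s assume s: "s \<in> cone_alg B - P"
    then have sU: "s \<in> unit_set R" unfolding R(1) by (rule inverse_in_localization[OF is_subring_cone_alg P])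
    obtain k g where g: "s = character k * to_fract g"
      using s cone_alg_subset_laurent laurent_clear_denominators[of s] by blast
    have "to_fract g = character (- k) * s" unfolding g character_uminus by simp
    also have "\<dots> \<in> unit_set R" using unit_set_mult[OF sR chars sU] .
    finally have "\<not> p dvd g" by (rule ndvd)
    then show "s \<in> unit_set (poly_local p)"
      unfolding g using unit_set_mult[OF is_subring_poly_local[OF torus_primeD[OF tp]]]
        character_unit_poly_local[OF tp] poly_local_unit[OF torus_primeD[OF tp]] by blast
  qed
  then show ?thesis using tp by blast
qed

lemma toric_point_below_divisor:
  assumes \<Sigma>: "toric_fan \<Sigma>" and R: "R \<in> toric_surface \<Sigma>" "R \<noteq> UNIV"
  shows "(\<exists>u\<in>rays \<Sigma>. R \<subseteq> ray_ring u) \<or> (\<exists>p. torus_prime p \<and> R \<subseteq> poly_local p)"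
proof -
  obtain B P where B: "B \<subseteq> rays \<Sigma>" "finite B" "prime_in P (cone_alg B)" "R = localization_at (cone_alg B) P"
    using toric_surface_point[OF \<Sigma> R(1)] by blast
  show ?thesis
  proof (cases "\<exists>u\<in>B. \<forall>m. (\<forall>b\<in>B. 0 \<le> dot m b) \<and> 0 < dot m u \<longrightarrow> character m \<in> P")
    case True
    then obtain u where u: "u \<in> B" "\<forall>m. (\<forall>b\<in>B. 0 \<le> dot m b) \<and> 0 < dot m u \<longrightarrow> character m \<in> P" by blast
    obtain m0 where "dot m0 u = 1" using primitive_dot B(1) u(1) unfolding rays_def by blast
    then have "R \<subseteq> ray_ring u" unfolding B(4) by (intro point_below_ray[OF B(3) u(1)]) (use u(2) in blast)+
    then show ?thesis using u(1) B(1) by blast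
  next
    case False
    then have "character m \<in> unit_set R" for m unfolding B(4) by (intro point_in_torus[OF B(3,2)]) blast
    then show ?thesis using torus_point_below_curve[OF B(3,4) R(2)] by blast
  qed
qed

text \<open>Every point other than the generic one lies on a divisor of the list, and the local
  rings in the list are maximal proper subrings by \<open>dvr_maximal\<close>.\<close>

lemma prime_divisors_toric:
  assumes \<Sigma>: "toric_fan \<Sigma>"
  shows "prime_divisors (toric_surface \<Sigma>) = ray_ring ` rays \<Sigma> \<union> poly_local ` {p. torus_prime p}"
proof -
  let ?X = "toric_surface \<Sigma>"
  have dvr: "\<exists>t. is_dvr R t" if "R \<in> ray_ring ` rays \<Sigma> \<union> poly_local ` {p. torus_prime p}" for R
    using that
  proof
    assume "R \<in> ray_ring ` rays \<Sigma>"
    then obtain u where "R = ray_ring u" "u \<in> rays \<Sigma>" by blast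
    then show ?thesis using ray_ring_dvr[of u \<Sigma>] by blast
  next
    assume "R \<in> poly_local ` {p. torus_prime p}"
    then show ?thesis using poly_local_dvr torus_primeD by blast
  qed
  have pt: "R \<in> ?X" if "R \<in> ray_ring ` rays \<Sigma> \<union> poly_local ` {p. torus_prime p}" for R
    using that ray_ring_point poly_local_point[OF \<Sigma>] by blast
  show ?thesis
  proof (intro equalityI subsetI)
    fix R assume R: "R \<in> prime_divisors ?X"
    then have RX: "R \<in> ?X" "R \<noteq> UNIV" "\<not> (\<exists>R'\<in>?X. R \<subset> R' \<and> R' \<subset> UNIV)" by (auto simp: prime_divisors_def)
    obtain R' where R': "R' \<in> ray_ring ` rays \<Sigma> \<union> poly_local ` {p. torus_prime p}" "R \<subseteq> R'"
      using toric_point_below_divisor[OF \<Sigma> RX(1,2)] by blast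
    have "R' \<noteq> UNIV" using dvr[OF R'(1)] dvr_proper by blast
    then have "R = R'" using RX(3) R'(2) pt[OF R'(1)] by blast
    then show "R \<in> ray_ring ` rays \<Sigma> \<union> poly_local ` {p. torus_prime p}" using R'(1) by simp
  next
    fix R assume R: "R \<in> ray_ring ` rays \<Sigma> \<union> poly_local ` {p. torus_prime p}"
    obtain t where t: "is_dvr R t" using dvr[OF R] by blast
    have "\<not> (\<exists>R'\<in>?X. R \<subset> R' \<and> R' \<subset> UNIV)"
      using dvr_maximal[OF t] toric_surface_subring[OF \<Sigma>] by blast
    then show "R \<in> prime_divisors ?X" using pt[OF R] dvr_proper[OF t] by (simp add: prime_divisors_def)
  qed
qed

section \<open>The Picard number\<close>

text \<open>Fraction-free Gaussian elimination, one coordinate at a time. The coefficient of the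
  pivot \<open>j\<close> is chosen at the end so that the coordinate \<open>s\<close>
  vanishes.\<close>

lemma integer_relation:
  fixes v :: "'i \<Rightarrow> 's \<Rightarrow> int"
  assumes "finite S" "finite I" "card S < card I"
  shows "\<exists>c. (\<exists>i\<in>I. c i \<noteq> 0) \<and> (\<forall>s\<in>S. (\<Sum>i\<in>I. c i * v i s) = 0)"
  using assms
proof (induction S arbitrary: I v rule: finite_induct)
  case empty
  then have "I \<noteq> {}" by auto
  then show ?case by (intro exI[of _ "\<lambda>_. 1"]) auto
next
  case (insert s S)
  show ?case
  proof (cases "\<forall>i\<in>I. v i s = 0")
    case True
    have "card S < card I" using insert by simp
    then obtain c where "\<exists>i\<in>I. c i \<noteq> 0" "\<forall>t\<in>S. (\<Sum>i\<in>I. c i * v i t) = 0"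
      using insert.IH[OF insert.prems(1)] by blast
    moreover have "(\<Sum>i\<in>I. c i * v i s) = 0" using True by simp
    ultimately show ?thesis by blast
  next
    case False
    then obtain j where j: "j \<in> I" "v j s \<noteq> 0" by blast
    let ?I = "I - {j}"
    have "card ?I = card I - 1" using j(1) insert.prems(1) by simp
    then have "card S < card ?I" using insert by simp
    then have "\<exists>c. (\<exists>i\<in>?I. c i \<noteq> 0) \<and> (\<forall>t\<in>S. (\<Sum>i\<in>?I. c i * (v j s * v i t - v i s * v j t)) = 0)"
      using insert.prems(1) by (intro insert.IH) simp_all
    then obtain c where c: "\<exists>i\<in>?I. c i \<noteq> 0" "\<And>t. t \<in> S \<Longrightarrow> (\<Sum>i\<in>?I. c i * (v j s * v i t - v i s * v j t)) = 0"
      by blast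
    define d where "d i = (if i = j then - (\<Sum>i\<in>?I. c i * v i s) else v j s * c i)" for i
    have sum: "(\<Sum>i\<in>I. d i * v i t) = (\<Sum>i\<in>?I. c i * (v j s * v i t - v i s * v j t))" for t
    proof -
      have "(\<Sum>i\<in>I. d i * v i t) = d j * v j t + (\<Sum>i\<in>?I. d i * v i t)"
        using insert.prems(1) j(1) by (rule sum.remove)
      also have "(\<Sum>i\<in>?I. d i * v i t) = (\<Sum>i\<in>?I. v j s * c i * v i t)"
        by (intro sum.cong) (auto simp: d_def)
      also have "d j * v j t = (\<Sum>i\<in>?I. - (c i * v i s * v j t))"
        by (simp add: d_def sum_distrib_right sum_negf)
      finally have "(\<Sum>i\<in>I. d i * v i t) = (\<Sum>i\<in>?I. - (c i * v i s * v j t) + v j s * c i * v i t)"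
        by (simp only: sum.distrib)
      also have "\<dots> = (\<Sum>i\<in>?I. c i * (v j s * v i t - v i s * v j t))"
        by (intro sum.cong refl) (simp add: algebra_simps)
      finally show ?thesis .
    qed
    have "\<exists>i\<in>I. d i \<noteq> 0" using c(1) j(2) by (auto simp: d_def)
    moreover have "(\<Sum>i\<in>I. d i * v i t) = 0" if "t \<in> insert s S" for t
    proof (cases "t = s")
      case True
      then show ?thesis unfolding sum by (simp add: mult.commute)
    next
      case False
      then show ?thesis unfolding sum using that by (intro c(2)) simp
    qed
    ultimately show ?thesis by blast
  qed
qed

section \<open>Cartier divisors modulo principal divisors\<close>

context
  fixes \<Sigma> assumes \<Sigma>: "toric_fan \<Sigma>"
begin

lemma prime_divisor_dvr: "R \<in> prime_divisors (toric_surface \<Sigma>) \<Longrightarrow> \<exists>t. is_dvr R t"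
proof -
  assume "R \<in> prime_divisors (toric_surface \<Sigma>)"
  then consider u where "u \<in> rays \<Sigma>" "R = ray_ring u" | p where "torus_prime p" "R = poly_local p"
    unfolding prime_divisors_toric[OF \<Sigma>] by blast
  then show ?thesis
  proof cases
    case 1
    then show ?thesis using ray_ring_dvr[of u \<Sigma>] by blast
  next
    case 2
    then show ?thesis using poly_local_dvr torus_primeD by blast
  qed
qed

lemma finite_ray_set: "finite (rays \<Sigma>)"
  using finite_rays \<Sigma> by (simp add: toric_fan_def)

lemma principal_divisor_one: "principal_divisor (toric_surface \<Sigma>) 1 = (\<lambda>R. 0)"
proof
  fix R
  show "principal_divisor (toric_surface \<Sigma>) 1 R = 0"
    using prime_divisor_dvr[of R] ord_at_one by (auto simp: principal_divisor_def)
qed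

lemma principal_divisor_mult:
  assumes "f \<noteq> 0" "g \<noteq> 0"
  shows "principal_divisor (toric_surface \<Sigma>) (f * g) = (\<lambda>R. principal_divisor (toric_surface \<Sigma>) f R + principal_divisor (toric_surface \<Sigma>) g R)"
proof
  fix R
  show "principal_divisor (toric_surface \<Sigma>) (f * g) R = principal_divisor (toric_surface \<Sigma>) f R + principal_divisor (toric_surface \<Sigma>) g R"
    using prime_divisor_dvr[of R] ord_at_mult[OF _ assms] by (auto simp: principal_divisor_def)
qed

lemma principal_divisor_inverse:
  assumes "f \<noteq> 0"
  shows "principal_divisor (toric_surface \<Sigma>) (inverse f) = (\<lambda>R. - principal_divisor (toric_surface \<Sigma>) f R)"
proof
  fix R
  show "principal_divisor (toric_surface \<Sigma>) (inverse f) R = - principal_divisor (toric_surface \<Sigma>) f R"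
    using prime_divisor_dvr[of R] ord_at_inverse[OF _ assms] by (auto simp: principal_divisor_def)
qed

lemma poly_local_normalize: "poly_local (normalize p) = poly_local p"
  by (simp add: poly_local_def)

text \<open>Along a torus curve that is not a prime factor of numerator or denominator the function
  is a unit, and the rays are finite in number.\<close>

lemma principal_divisor_weil:
  assumes f: "f \<noteq> 0" shows "principal_divisor (toric_surface \<Sigma>) f \<in> weil_divisors (toric_surface \<Sigma>)"
proof -
  obtain a b where ab: "f = to_fract a / to_fract b" "a \<noteq> 0" "b \<noteq> 0" using ratfun_cases_nonzero[OF f] by blast
  let ?F = "ray_ring ` rays \<Sigma> \<union> poly_local ` prime_factors (a * b)"
  have "R \<in> ?F" if R: "principal_divisor (toric_surface \<Sigma>) f R \<noteq> 0" for R
  proof (rule ccontr)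
    assume n: "R \<notin> ?F"
    have "R \<in> prime_divisors (toric_surface \<Sigma>)" and o: "ord_at R f \<noteq> 0" using R by (auto simp: principal_divisor_def split: if_splits)
    then obtain p where p: "torus_prime p" "R = poly_local p"
      using n unfolding prime_divisors_toric[OF \<Sigma>] by blast
    note pe = torus_primeD[OF p(1)]
    have "normalize p \<notin> prime_factors (a * b)" using n p(2) poly_local_normalize[of p] by blast
    then have "\<not> p dvd a * b" using ab pe by (auto simp: in_prime_factors_iff)
    then have "\<not> p dvd a" "\<not> p dvd b" by auto
    then have "to_fract a \<in> unit_set R" "to_fract b \<in> unit_set R" unfolding p(2) using poly_local_unit[OF pe] by blast+
    then have "ord_at R f = 0"
      using ab ord_at_divide[OF poly_local_dvr[OF pe]] ord_at_unit[OF poly_local_dvr[OF pe]] unfolding p(2) by simp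
    then show False using o by simp
  qed
  then have "{R. principal_divisor (toric_surface \<Sigma>) f R \<noteq> 0} \<subseteq> ?F" by blast
  moreover have "finite ?F" using finite_ray_set by simp
  ultimately have "finite {R. principal_divisor (toric_surface \<Sigma>) f R \<noteq> 0}" by (rule finite_subset)
  then show ?thesis by (auto simp: weil_divisors_def principal_divisor_def)
qed

lemma openin_zariski_whole: "openin (zariski (toric_surface \<Sigma>)) (toric_surface \<Sigma>)"
proof -
  have "toric_surface \<Sigma> = {R \<in> toric_surface \<Sigma>. 1 \<in> R}"
    using toric_surface_subring[OF \<Sigma>] is_subringD(1) by blast
  then have "toric_surface \<Sigma> \<in> range (\<lambda>f. {R \<in> toric_surface \<Sigma>. f \<in> R})" by blast
  then show ?thesis unfolding zariski_def by (rule topology_generated_by_Basis)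
qed

lemma principal_divisor_cartier:
  assumes "f \<noteq> 0" shows "cartier (toric_surface \<Sigma>) (principal_divisor (toric_surface \<Sigma>) f)"
  unfolding cartier_def using principal_divisor_weil[OF assms] openin_zariski_whole assms by blast

lemma cartier_add:
  assumes D: "cartier (toric_surface \<Sigma>) D" and E: "cartier (toric_surface \<Sigma>) E"
  shows "cartier (toric_surface \<Sigma>) (\<lambda>R. D R + E R)"
  unfolding cartier_def
proof (intro conjI ballI)
  have fin: "finite {R. D R \<noteq> 0}" "finite {R. E R \<noteq> 0}" and sub: "{R. D R \<noteq> 0} \<subseteq> prime_divisors (toric_surface \<Sigma>)"
    "{R. E R \<noteq> 0} \<subseteq> prime_divisors (toric_surface \<Sigma>)"
    using D E by (auto simp: cartier_def weil_divisors_def)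
  have "{R. D R + E R \<noteq> 0} \<subseteq> {R. D R \<noteq> 0} \<union> {R. E R \<noteq> 0}" by auto
  then show "(\<lambda>R. D R + E R) \<in> weil_divisors (toric_surface \<Sigma>)"
    unfolding weil_divisors_def using fin sub finite_subset by blast
  fix P assume P: "P \<in> toric_surface \<Sigma>"
  obtain V f where V: "openin (zariski (toric_surface \<Sigma>)) V" "P \<in> V" "f \<noteq> 0"
    "\<forall>R\<in>prime_divisors (toric_surface \<Sigma>) \<inter> V. D R = principal_divisor (toric_surface \<Sigma>) f R"
    using D P unfolding cartier_def by blast
  obtain W g where W: "openin (zariski (toric_surface \<Sigma>)) W" "P \<in> W" "g \<noteq> 0"
    "\<forall>R\<in>prime_divisors (toric_surface \<Sigma>) \<inter> W. E R = principal_divisor (toric_surface \<Sigma>) g R"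
    using E P unfolding cartier_def by blast
  have "\<forall>R\<in>prime_divisors (toric_surface \<Sigma>) \<inter> (V \<inter> W). D R + E R = principal_divisor (toric_surface \<Sigma>) (f * g) R"
    unfolding principal_divisor_mult[OF V(3) W(3)] using V(4) W(4) by simp
  moreover have "f * g \<noteq> 0" using V(3) W(3) by simp
  moreover have "openin (zariski (toric_surface \<Sigma>)) (V \<inter> W)" using V(1) W(1) by (rule openin_Int)
  ultimately show "\<exists>V f. openin (zariski (toric_surface \<Sigma>)) V \<and> P \<in> V \<and> f \<noteq> 0 \<and>
      (\<forall>R\<in>prime_divisors (toric_surface \<Sigma>) \<inter> V. D R + E R = principal_divisor (toric_surface \<Sigma>) f R)"
    using V(2) W(2) by blast
qed

lemma cartier_uminus:
  assumes D: "cartier (toric_surface \<Sigma>) D" shows "cartier (toric_surface \<Sigma>) (\<lambda>R. - D R)"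
  unfolding cartier_def
proof (intro conjI ballI)
  show "(\<lambda>R. - D R) \<in> weil_divisors (toric_surface \<Sigma>)" using D by (simp add: cartier_def weil_divisors_def)
  fix P assume P: "P \<in> toric_surface \<Sigma>"
  obtain V f where V: "openin (zariski (toric_surface \<Sigma>)) V" "P \<in> V" "f \<noteq> 0"
    "\<forall>R\<in>prime_divisors (toric_surface \<Sigma>) \<inter> V. D R = principal_divisor (toric_surface \<Sigma>) f R"
    using D P unfolding cartier_def by blast
  have "\<forall>R\<in>prime_divisors (toric_surface \<Sigma>) \<inter> V. - D R = principal_divisor (toric_surface \<Sigma>) (inverse f) R"
    unfolding principal_divisor_inverse[OF V(3)] using V(4) by simp
  moreover have "inverse f \<noteq> 0" using V(3) by simp
  ultimately show "\<exists>V f. openin (zariski (toric_surface \<Sigma>)) V \<and> P \<in> V \<and> f \<noteq> 0 \<and>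
      (\<forall>R\<in>prime_divisors (toric_surface \<Sigma>) \<inter> V. - D R = principal_divisor (toric_surface \<Sigma>) f R)"
    using V(1,2) by blast
qed

lemma cartier_zero: "cartier (toric_surface \<Sigma>) (\<lambda>R. 0)"
  using principal_divisor_cartier[of 1] principal_divisor_one by simp

lemma comm_group_cartier: "comm_group (cartier_group (toric_surface \<Sigma>))"
proof (rule comm_groupI)
  fix D assume "D \<in> carrier (cartier_group (toric_surface \<Sigma>))"
  then have "(\<lambda>R. - D R) \<in> carrier (cartier_group (toric_surface \<Sigma>))"
    using cartier_uminus by (simp add: cartier_group_def)
  moreover have "(\<lambda>R. - D R) \<otimes>\<^bsub>cartier_group (toric_surface \<Sigma>)\<^esub> D = \<one>\<^bsub>cartier_group (toric_surface \<Sigma>)\<^esub>"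
    by (simp add: cartier_group_def)
  ultimately show "\<exists>E\<in>carrier (cartier_group (toric_surface \<Sigma>)). E \<otimes>\<^bsub>cartier_group (toric_surface \<Sigma>)\<^esub> D = \<one>\<^bsub>cartier_group (toric_surface \<Sigma>)\<^esub>"
    by blast
qed (simp_all add: cartier_group_def cartier_add cartier_zero algebra_simps)

abbreviation "principal_group \<equiv> principal_divisor (toric_surface \<Sigma>) ` {f. f \<noteq> 0}"

lemma subgroup_principal: "subgroup principal_group (cartier_group (toric_surface \<Sigma>))"
proof -
  let ?G = "cartier_group (toric_surface \<Sigma>)"
  interpret G: comm_group ?G by (rule comm_group_cartier)
  have inv: "inv\<^bsub>?G\<^esub> D = (\<lambda>R. - D R)" if "cartier (toric_surface \<Sigma>) D" for D
    by (rule G.inv_equality) (use that cartier_uminus in \<open>simp_all add: cartier_group_def\<close>)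
  show ?thesis
  proof (rule G.subgroupI)
    show "principal_group \<subseteq> carrier ?G" using principal_divisor_cartier by (auto simp: cartier_group_def)
    show "principal_group \<noteq> {}" by (auto intro: exI[of _ 1])
    show "inv\<^bsub>?G\<^esub> D \<in> principal_group" if D: "D \<in> principal_group" for D
    proof -
      obtain f where f: "D = principal_divisor (toric_surface \<Sigma>) f" "f \<noteq> 0" using D by blast
      have "inv\<^bsub>?G\<^esub> D = principal_divisor (toric_surface \<Sigma>) (inverse f)"
        unfolding principal_divisor_inverse[OF f(2)] using inv principal_divisor_cartier[OF f(2)] f(1) by simp
      then show ?thesis using f(2) by simp
    qed
    show "D \<otimes>\<^bsub>?G\<^esub> E \<in> principal_group" if DE: "D \<in> principal_group" "E \<in> principal_group" for D E
    proof -
      obtain f where f: "D = principal_divisor (toric_surface \<Sigma>) f" "f \<noteq> 0" using DE(1) by blast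
      obtain g where g: "E = principal_divisor (toric_surface \<Sigma>) g" "g \<noteq> 0" using DE(2) by blast
      have "D \<otimes>\<^bsub>?G\<^esub> E = principal_divisor (toric_surface \<Sigma>) (f * g)"
        unfolding principal_divisor_mult[OF f(2) g(2)] by (simp add: cartier_group_def f(1) g(1))
      then show ?thesis using f(2) g(2) by simp
    qed
  qed
qed

lemma torus_prime_ord:
  assumes p: "torus_prime p" and q: "torus_prime q"
  shows "ord_at (poly_local p) (to_fract q) = (if poly_local q = poly_local p then 1 else 0)"
proof (cases "p dvd q")
  case True
  note pe = torus_primeD[OF p] and qe = torus_primeD[OF q]
  have "normalize p = normalize q"
    using True pe qe by (intro primes_dvd_imp_eq) auto
  then have "poly_local q = poly_local p" using poly_local_normalize[of p] poly_local_normalize[of q] by simp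
  then show ?thesis using ord_at_uniformizer[OF poly_local_dvr[OF qe]] by simp
next
  case False
  have "to_fract q \<in> unit_set (poly_local p)" by (rule poly_local_unit[OF torus_primeD[OF p] False])
  moreover from this have "poly_local q \<noteq> poly_local p"
    using poly_local_not_unit[OF torus_primeD[OF q]] by auto
  ultimately show ?thesis using ord_at_unit[OF poly_local_dvr[OF torus_primeD[OF p]]] by simp
qed

text \<open>The torus has trivial class group, so every divisor is linearly equivalent to an invariant one.\<close>

lemma weil_divisor_torus:
  assumes D: "D \<in> weil_divisors (toric_surface \<Sigma>)"
  shows "\<exists>f. f \<noteq> 0 \<and> (\<forall>p. torus_prime p \<longrightarrow> ord_at (poly_local p) f = D (poly_local p))"
proof -
  define T where "T = {R. D R \<noteq> 0} \<inter> poly_local ` {p. torus_prime p}"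
  have fin: "finite T" using D by (simp add: weil_divisors_def T_def)
  have "\<forall>R\<in>T. \<exists>p. torus_prime p \<and> poly_local p = R" by (auto simp: T_def)
  then obtain q where q: "\<And>R. R \<in> T \<Longrightarrow> torus_prime (q R) \<and> poly_local (q R) = R" by metis
  define f where "f = (\<Prod>R\<in>T. to_fract (q R) powi D R)"
  have q0: "to_fract (q R) \<noteq> 0" if "R \<in> T" for R
    using torus_primeD q[OF that] by (auto simp: prime_elem_def)
  have qp: "to_fract (q R) powi D R \<noteq> 0" if "R \<in> T" for R
    by (rule power_int_not_zero) (rule disjI1[OF q0[OF that]])
  show ?thesis
  proof (intro exI[of _ f] conjI allI impI)
    show "f \<noteq> 0" unfolding f_def using fin qp by (simp only: prod_zero_iff) blast
    fix p assume p: "torus_prime p"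
    note dvr = poly_local_dvr[OF torus_primeD[OF p]]
    have "ord_at (poly_local p) f = (\<Sum>R\<in>T. ord_at (poly_local p) (to_fract (q R) powi D R))"
      unfolding f_def by (rule ord_at_prod[OF dvr fin qp])
    also have "\<dots> = (\<Sum>R\<in>T. if R = poly_local p then D R else 0)"
    proof (intro sum.cong refl)
      fix R assume R: "R \<in> T"
      have "ord_at (poly_local p) (to_fract (q R) powi D R) = D R * ord_at (poly_local p) (to_fract (q R))"
        by (rule ord_at_powi[OF dvr q0[OF R]])
      also have "\<dots> = (if R = poly_local p then D R else 0)"
        using torus_prime_ord[OF p, of "q R"] q[OF R] by simp
      finally show "ord_at (poly_local p) (to_fract (q R) powi D R) = (if R = poly_local p then D R else 0)" .
    qed
    also have "\<dots> = D (poly_local p)" using fin p by (auto simp: T_def)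
    finally show "ord_at (poly_local p) f = D (poly_local p)" .
  qed
qed

lemma cartier_group_int_pow:
  assumes "D \<in> carrier (cartier_group (toric_surface \<Sigma>))"
  shows "D [^]\<^bsub>cartier_group (toric_surface \<Sigma>)\<^esub> (k :: int) = (\<lambda>R. k * D R)"
proof -
  let ?G = "cartier_group (toric_surface \<Sigma>)"
  interpret G: comm_group ?G by (rule comm_group_cartier)
  have nat: "D [^]\<^bsub>?G\<^esub> n = (\<lambda>R. int n * D R)" for n :: nat
    by (induction n) (simp_all add: cartier_group_def algebra_simps)
  have inv: "inv\<^bsub>?G\<^esub> E = (\<lambda>R. - E R)" if "E \<in> carrier ?G" for E
    by (rule G.inv_equality) (use that cartier_uminus in \<open>simp_all add: cartier_group_def\<close>)
  have neg: "inv\<^bsub>?G\<^esub> (D [^]\<^bsub>?G\<^esub> n) = (\<lambda>R. - (int n * D R))" for n :: nat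
    using inv[OF G.nat_pow_closed[OF assms]] nat by simp
  show ?thesis
    unfolding int_pow_def2 neg by (cases "k < 0") (simp_all add: nat)
qed

text \<open>Subtracting the divisor of \<open>f b\<close> from \<open>D b\<close> leaves a divisor
  supported on the rays. These \<open>card B\<close> vectors together with the two coordinate
  characters outnumber the rays, so there is an integer relation; as the rays span the plane, it is
  not a relation of the characters alone.\<close>

lemma picard_relation:
  fixes B :: "'b set"
  assumes fin: "finite B" and D: "\<And>b. b \<in> B \<Longrightarrow> cartier (toric_surface \<Sigma>) (D b)"
    and span: "\<And>m. (\<And>u. u \<in> rays \<Sigma> \<Longrightarrow> dot m u = 0) \<Longrightarrow> m = 0"
    and card: "card (rays \<Sigma>) < card B + 2"
  obtains c g where "\<exists>b\<in>B. c b \<noteq> 0" "g \<noteq> 0" "(\<lambda>R. \<Sum>b\<in>B. c b * D b R) = principal_divisor (toric_surface \<Sigma>) g"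
proof -
  have "\<exists>f. f \<noteq> 0 \<and> (\<forall>p. torus_prime p \<longrightarrow> ord_at (poly_local p) f = D b (poly_local p))" if "b \<in> B" for b
    using weil_divisor_torus[of "D b"] D[OF that] by (simp add: cartier_def)
  then have "\<exists>f. \<forall>b\<in>B. f b \<noteq> 0 \<and> (\<forall>p. torus_prime p \<longrightarrow> ord_at (poly_local p) (f b) = D b (poly_local p))"
    by (intro bchoice) blast
  then obtain f where f: "\<And>b. b \<in> B \<Longrightarrow> f b \<noteq> 0"
    "\<And>b p. b \<in> B \<Longrightarrow> torus_prime p \<Longrightarrow> ord_at (poly_local p) (f b) = D b (poly_local p)" by blast
  \<comment> \<open>\<open>Inl\<close> carries the boundary part of a divisor, \<open>Inr\<close>
    the orders of the two coordinate functions along the ray.\<close>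
  define v where "v i u = (case i of Inl b \<Rightarrow> D b (ray_ring u) - ord_at (ray_ring u) (f b)
    | Inr t \<Rightarrow> (if t then fst u else snd u))" for i :: "'b + bool" and u :: "int \<times> int"
  let ?I = "B <+> (UNIV :: bool set)"
  have "card ?I = card B + 2" using fin by (simp add: card_Plus)
  then have "\<exists>c. (\<exists>i\<in>?I. c i \<noteq> 0) \<and> (\<forall>u\<in>rays \<Sigma>. (\<Sum>i\<in>?I. c i * v i u) = 0)"
    using fin finite_ray_set card by (intro integer_relation) simp_all
  then obtain c where c: "\<exists>i\<in>?I. c i \<noteq> 0" "\<And>u. u \<in> rays \<Sigma> \<Longrightarrow> (\<Sum>i\<in>?I. c i * v i u) = 0" by blast
  define m where "m = (c (Inr True), c (Inr False))"
  have rel: "(\<Sum>b\<in>B. c (Inl b) * (D b (ray_ring u) - ord_at (ray_ring u) (f b))) + dot m u = 0" if "u \<in> rays \<Sigma>" for u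
  proof -
    have "(\<Sum>i\<in>?I. c i * v i u) = (\<Sum>b\<in>B. c (Inl b) * v (Inl b) u) + (\<Sum>t\<in>UNIV. c (Inr t) * v (Inr t) u)"
      using fin by (subst sum.Plus) simp_all
    then show ?thesis using c(2)[OF that] by (simp add: v_def m_def dot_def UNIV_bool)
  qed
  \<comment> \<open>The sign of the exponent is reversed because the relation has the character on
    the same side as the divisors.\<close>
  define g where "g = (\<Prod>b\<in>B. f b powi c (Inl b)) * character (- m)"
  have fp: "f b powi c (Inl b) \<noteq> 0" if "b \<in> B" for b
    by (rule power_int_not_zero) (rule disjI1[OF f(1)[OF that]])
  have prod0: "(\<Prod>b\<in>B. f b powi c (Inl b)) \<noteq> 0"
    using fin fp by (simp only: prod_zero_iff) blast
  have ord_g: "ord_at R g = (\<Sum>b\<in>B. c (Inl b) * ord_at R (f b)) + ord_at R (character (- m))" if dvr: "is_dvr R t" for R t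
  proof -
    have "ord_at R (\<Prod>b\<in>B. f b powi c (Inl b)) = (\<Sum>b\<in>B. ord_at R (f b powi c (Inl b)))"
      by (rule ord_at_prod[OF dvr fin fp])
    also have "\<dots> = (\<Sum>b\<in>B. c (Inl b) * ord_at R (f b))"
      by (intro sum.cong refl ord_at_powi[OF dvr] f(1))
    finally show ?thesis unfolding g_def using ord_at_mult[OF dvr prod0, of "character (- m)"] by simp
  qed
  have eq: "(\<lambda>R. \<Sum>b\<in>B. c (Inl b) * D b R) = principal_divisor (toric_surface \<Sigma>) g"
  proof
    fix R
    consider u where "u \<in> rays \<Sigma>" "R = ray_ring u" | p where "torus_prime p" "R = poly_local p"
      | "R \<notin> prime_divisors (toric_surface \<Sigma>)"
      unfolding prime_divisors_toric[OF \<Sigma>] by blast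
    then show "(\<Sum>b\<in>B. c (Inl b) * D b R) = principal_divisor (toric_surface \<Sigma>) g R"
    proof cases
      case 1
      then obtain k where k: "dot k u = 1" "is_dvr (ray_ring u) (character k)" using ray_ring_dvr by blast
      have "ord_at R g = (\<Sum>b\<in>B. c (Inl b) * ord_at R (f b)) - dot m u"
        using ord_g[OF k(2)] ord_ray_character[OF k(1), of "- m"] 1 by simp
      moreover have "R \<in> prime_divisors (toric_surface \<Sigma>)" unfolding prime_divisors_toric[OF \<Sigma>] using 1 by blast
      ultimately show ?thesis
        using rel[OF 1(1)] 1(2) by (simp add: principal_divisor_def right_diff_distrib sum_subtractf)
    next
      case 2
      note dvr = poly_local_dvr[OF torus_primeD[OF 2(1)]]
      have "ord_at R (character (- m)) = 0"
        unfolding 2(2) by (rule ord_at_unit[OF dvr character_unit_poly_local[OF 2(1)]])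
      then have "ord_at R g = (\<Sum>b\<in>B. c (Inl b) * ord_at R (f b))" using ord_g[OF dvr] 2(2) by simp
      also have "\<dots> = (\<Sum>b\<in>B. c (Inl b) * D b R)" by (intro sum.cong refl) (simp add: 2 f(2))
      finally have "ord_at R g = (\<Sum>b\<in>B. c (Inl b) * D b R)" .
      moreover have "R \<in> prime_divisors (toric_surface \<Sigma>)" unfolding prime_divisors_toric[OF \<Sigma>] using 2 by blast
      ultimately show ?thesis by (simp add: principal_divisor_def)
    next
      case 3
      have "D b R = 0" if "b \<in> B" for b using D[OF that] 3 by (auto simp: cartier_def weil_divisors_def)
      then show ?thesis using 3 by (simp add: principal_divisor_def)
    qed
  qed
  have "\<exists>b\<in>B. c (Inl b) \<noteq> 0"
  proof (rule ccontr)
    assume n: "\<not> (\<exists>b\<in>B. c (Inl b) \<noteq> 0)"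
    then have "dot m u = 0" if "u \<in> rays \<Sigma>" for u using rel[OF that] by simp
    then have "m = 0" by (rule span)
    then have "c (Inr t) = 0" for t by (cases t) (simp_all add: m_def prod_eq_iff)
    then show False using c(1) n by (auto simp: Plus_def)
  qed
  then show ?thesis using that[of "\<lambda>b. c (Inl b)" g] eq prod0 by (simp add: g_def)
qed

text \<open>Too many classes would have representatives with a nontrivial combination equal to a
  principal divisor, by \<open>picard_relation\<close>. The remaining work carries this combination
  through the quotient map.\<close>

lemma independent_in_picard:
  assumes B: "independent_in (picard_group (toric_surface \<Sigma>)) B"
    and span: "\<And>m. (\<And>u. u \<in> rays \<Sigma> \<Longrightarrow> dot m u = 0) \<Longrightarrow> m = 0"
  shows "card B + 2 \<le> card (rays \<Sigma>)"
proof (rule ccontr)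
  assume n: "\<not> ?thesis"
  let ?G = "cartier_group (toric_surface \<Sigma>)"
  let ?N = "principal_group"
  let ?Q = "?G Mod ?N"
  let ?h = "\<lambda>D. ?N #>\<^bsub>?G\<^esub> D"
  interpret G: comm_group ?G by (rule comm_group_cartier)
  interpret N: normal ?N ?G by (rule G.subgroup_imp_normal[OF subgroup_principal])
  have hom: "?h \<in> hom ?G ?Q" by (rule N.r_coset_hom_Mod)
  have carQ: "carrier ?Q = ?h ` carrier ?G" by (auto simp: FactGroup_def RCOSETS_def)
  interpret Q: comm_group ?Q
  proof (rule group.group_comm_groupI[OF N.factorgroup_is_group])
    fix x y assume "x \<in> carrier ?Q" "y \<in> carrier ?Q"
    then obtain D E where DE: "D \<in> carrier ?G" "E \<in> carrier ?G" "x = ?h D" "y = ?h E" unfolding carQ by blast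
    have "?h (D \<otimes>\<^bsub>?G\<^esub> E) = x \<otimes>\<^bsub>?Q\<^esub> y" "?h (E \<otimes>\<^bsub>?G\<^esub> D) = y \<otimes>\<^bsub>?Q\<^esub> x"
      using hom DE by (simp_all add: hom_def)
    then show "x \<otimes>\<^bsub>?Q\<^esub> y = y \<otimes>\<^bsub>?Q\<^esub> x" using G.m_comm[OF DE(1,2)] by simp
  qed
  have fin: "finite B" and BQ: "B \<subseteq> carrier ?Q"
    and ind: "\<And>c :: _ \<Rightarrow> int. finprod ?Q (\<lambda>b. b [^]\<^bsub>?Q\<^esub> c b) B = \<one>\<^bsub>?Q\<^esub> \<Longrightarrow> \<forall>b\<in>B. c b = 0"
    using B unfolding independent_in_def picard_group_def by blast+
  have "\<forall>b\<in>B. \<exists>D. D \<in> carrier ?G \<and> b = ?h D" using BQ unfolding carQ by blast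
  then have "\<exists>D. \<forall>b\<in>B. D b \<in> carrier ?G \<and> b = ?h (D b)" by (rule bchoice)
  then obtain D where D: "\<And>b. b \<in> B \<Longrightarrow> D b \<in> carrier ?G \<and> b = ?h (D b)" by blast
  have Dc: "cartier (toric_surface \<Sigma>) (D b)" if "b \<in> B" for b using D[OF that] by (simp add: cartier_group_def)
  obtain c g where c: "\<exists>b\<in>B. c b \<noteq> 0" "g \<noteq> 0" "(\<lambda>R. \<Sum>b\<in>B. c b * D b R) = principal_divisor (toric_surface \<Sigma>) g"
    by (rule picard_relation[OF fin Dc span]) (use n in auto)
  have sum_in: "(\<lambda>R. \<Sum>b\<in>C. c b * D b R) \<in> carrier ?G \<and> finprod ?Q (\<lambda>b. b [^]\<^bsub>?Q\<^esub> c b) C = ?h (\<lambda>R. \<Sum>b\<in>C. c b * D b R)"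
    if "finite C" "C \<subseteq> B" for C
    using that
  proof (induction C rule: finite_induct)
    case empty
    have "?h \<one>\<^bsub>?G\<^esub> = \<one>\<^bsub>?Q\<^esub>" using hom G.is_group Q.is_group by (metis hom_one)
    moreover have "\<one>\<^bsub>?G\<^esub> = (\<lambda>R. 0)" by (simp add: cartier_group_def)
    ultimately show ?case using G.one_closed by simp
  next
    case (insert b C)
    have b: "b \<in> B" "D b \<in> carrier ?G" "b = ?h (D b)" "b \<in> carrier ?Q" using insert.prems D BQ by auto
    have pw: "D b [^]\<^bsub>?G\<^esub> c b = (\<lambda>R. c b * D b R)" by (rule cartier_group_int_pow[OF b(2)])
    have pwc: "(\<lambda>R. c b * D b R) \<in> carrier ?G" using G.int_pow_closed[OF b(2), of "c b"] by (simp only: pw)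
    have "?h (D b) [^]\<^bsub>?Q\<^esub> c b = ?h (D b [^]\<^bsub>?G\<^esub> c b)"
      by (rule hom_int_pow[OF hom b(2) G.is_group Q.is_group, symmetric])
    then have hb: "b [^]\<^bsub>?Q\<^esub> c b = ?h (\<lambda>R. c b * D b R)" unfolding pw b(3)[symmetric] .
    have IH: "(\<lambda>R. \<Sum>b\<in>C. c b * D b R) \<in> carrier ?G" "finprod ?Q (\<lambda>b. b [^]\<^bsub>?Q\<^esub> c b) C = ?h (\<lambda>R. \<Sum>b\<in>C. c b * D b R)"
      using insert by auto
    have sm: "(\<lambda>R. \<Sum>b\<in>insert b C. c b * D b R) = (\<lambda>R. c b * D b R) \<otimes>\<^bsub>?G\<^esub> (\<lambda>R. \<Sum>b\<in>C. c b * D b R)"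
      using insert.hyps by (simp add: cartier_group_def)
    have "finprod ?Q (\<lambda>b. b [^]\<^bsub>?Q\<^esub> c b) (insert b C) = b [^]\<^bsub>?Q\<^esub> c b \<otimes>\<^bsub>?Q\<^esub> finprod ?Q (\<lambda>b. b [^]\<^bsub>?Q\<^esub> c b) C"
      using insert.hyps insert.prems BQ b by (intro Q.finprod_insert) auto
    also have "\<dots> = ?h (\<lambda>R. \<Sum>b\<in>insert b C. c b * D b R)"
      unfolding sm hb IH(2) using hom pwc IH(1) by (simp add: hom_def)
    moreover have "(\<lambda>R. \<Sum>b\<in>insert b C. c b * D b R) \<in> carrier ?G"
      unfolding sm by (rule G.m_closed[OF pwc IH(1)])
    ultimately show ?case by blast
  qed
  have "principal_divisor (toric_surface \<Sigma>) g \<in> ?N" using c(2) by blast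
  then have "?h (principal_divisor (toric_surface \<Sigma>) g) = ?N"
    using G.coset_join2 subgroup_principal sum_in[OF fin order_refl] c(3) by simp
  then have "finprod ?Q (\<lambda>b. b [^]\<^bsub>?Q\<^esub> c b) B = \<one>\<^bsub>?Q\<^esub>"
    using sum_in[OF fin order_refl] c(3) by (simp add: FactGroup_def)
  then show False using ind c(1) by blast
qed

lemma picard_number_le:
  assumes span: "\<And>m. (\<And>u. u \<in> rays \<Sigma> \<Longrightarrow> dot m u = 0) \<Longrightarrow> m = 0"
  shows "picard_number (toric_surface \<Sigma>) \<le> enat (card (rays \<Sigma>) - 2)"
  unfolding picard_number_def abelian_rank_def
proof (rule SUP_least)
  fix B assume "B \<in> {B. independent_in (picard_group (toric_surface \<Sigma>)) B}"
  then have "card B + 2 \<le> card (rays \<Sigma>)" using independent_in_picard[OF _ span] by blast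
  then show "enat (card B) \<le> enat (card (rays \<Sigma>) - 2)" by simp
qed

end

section \<open>Derivations and the canonical divisor\<close>

definition poly_derivation :: "(complex poly poly \<Rightarrow> complex poly poly) \<Rightarrow> bool" where
  "poly_derivation d \<longleftrightarrow> (\<forall>a b. d (a + b) = d a + d b) \<and> (\<forall>a b. d (a * b) = d a * b + a * d b)"

lemma poly_derivation_pderiv: "poly_derivation pderiv"
  by (simp add: poly_derivation_def pderiv_add pderiv_mult algebra_simps)

lemma pderiv_sum: "pderiv (\<Sum>i\<in>I. f i) = (\<Sum>i\<in>I. pderiv (f i))"
  by (induction I rule: infinite_finite_induct) (simp_all add: pderiv_add)

lemma poly_derivation_map_pderiv: "poly_derivation (map_poly pderiv)"
  unfolding poly_derivation_def
proof (intro conjI allI)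
  fix a b :: "complex poly poly"
  show "map_poly pderiv (a + b) = map_poly pderiv a + map_poly pderiv b"
    by (rule poly_eqI) (simp add: coeff_map_poly pderiv_add)
  show "map_poly pderiv (a * b) = map_poly pderiv a * b + a * map_poly pderiv b"
  proof -
    have "pderiv (p * q) = pderiv p * q + p * pderiv q" for p q :: "complex poly"
      by (simp add: pderiv_mult mult.commute)
    then show ?thesis
      by (intro poly_eqI) (simp add: coeff_map_poly coeff_mult pderiv_sum sum.distrib)
  qed
qed

definition derivation :: "(ratfun \<Rightarrow> ratfun) \<Rightarrow> bool" where
  "derivation D \<longleftrightarrow> (\<forall>f g. D (f + g) = D f + D g) \<and> (\<forall>f g. D (f * g) = D f * g + f * D g)"

text \<open>\<open>quotient_rule\<close> reads off the reduced representative of a fraction.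
  Differentiating \<open>a * b' = a' * b\<close> shows that any other representative gives the same
  value.\<close>

lemma quotient_rule_fraction:
  assumes d: "poly_derivation d" and b: "b \<noteq> 0"
  shows "quotient_rule d (to_fract a / to_fract b) =
    (to_fract (d a) * to_fract b - to_fract a * to_fract (d b)) / (to_fract b)\<^sup>2"
proof -
  let ?f = "to_fract a / to_fract b"
  obtain a' b' where q: "quot_of_fract ?f = (a', b')" by (cases "quot_of_fract ?f")
  have b': "b' \<noteq> 0" using snd_quot_of_fract_nonzero[of ?f] q by simp
  have "?f = to_fract a' / to_fract b'"
    using Fract_quot_of_fract[of ?f] q by (simp add: Fract_conv_to_fract)
  then have "to_fract a * to_fract b' = to_fract a' * to_fract b" using b b' by (simp add: field_simps)
  then have e: "a * b' = a' * b" by (simp only: to_fract_mult[symmetric] to_fract_eq_iff)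
  have l: "d a * b' + a * d b' = d a' * b + a' * d b"
    using arg_cong[OF e, of d] d by (simp add: poly_derivation_def)
  have "(d a * b - a * d b) * b'\<^sup>2 = b * b' * (d a * b' + a * d b') - b * (a * b') * d b' - (a * b') * d b * b'"
    by (simp add: algebra_simps power2_eq_square)
  also have "\<dots> = b * b' * (d a' * b + a' * d b) - b * (a' * b) * d b' - (a' * b) * d b * b'" unfolding l e ..
  also have "\<dots> = (d a' * b' - a' * d b') * b\<^sup>2" by (simp add: algebra_simps power2_eq_square)
  finally have "to_fract (d a * b - a * d b) * to_fract b' ^ 2 = to_fract (d a' * b' - a' * d b') * to_fract b ^ 2"
    by (simp only: to_fract_mult[symmetric] to_fract_power[symmetric])
  then have "to_fract (d a * b - a * d b) / to_fract b ^ 2 = to_fract (d a' * b' - a' * d b') / to_fract b' ^ 2"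
    using b b' by (simp add: frac_eq_eq)
  then show ?thesis using q by (simp add: quotient_rule_def to_fract_power to_fract_mult to_fract_diff)
qed

lemma derivation_quotient_rule:
  assumes d: "poly_derivation d" shows "derivation (quotient_rule d)"
  unfolding derivation_def
proof (intro conjI allI)
  fix f g :: ratfun
  obtain a b where f: "f = to_fract a / to_fract b" "b \<noteq> 0" by (rule ratfun_cases)
  obtain c e where g: "g = to_fract c / to_fract e" "e \<noteq> 0" by (rule ratfun_cases)
  have nz: "to_fract b \<noteq> 0" "to_fract e \<noteq> 0" "b * e \<noteq> 0" using f g by simp_all
  have "f + g = to_fract (a * e + c * b) / to_fract (b * e)" "f * g = to_fract (a * c) / to_fract (b * e)"
    unfolding f(1) g(1) using nz by (simp_all add: to_fract_mult to_fract_add field_simps)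
  note fg = this
  have dd: "d (a * e + c * b) = d a * e + a * d e + (d c * b + c * d b)" "d (b * e) = d b * e + b * d e" "d (a * c) = d a * c + a * d c"
    using d by (simp_all add: poly_derivation_def)
  note Df = quotient_rule_fraction[OF d f(2), of a]
  note Dg = quotient_rule_fraction[OF d g(2), of c]
  show "quotient_rule d (f + g) = quotient_rule d f + quotient_rule d g"
    unfolding fg(1) quotient_rule_fraction[OF d nz(3)] dd unfolding f(1) g(1) Df Dg
    using nz(1,2) by (simp add: to_fract_mult to_fract_add divide_simps) (simp add: algebra_simps power2_eq_square)
  show "quotient_rule d (f * g) = quotient_rule d f * g + f * quotient_rule d g"
    unfolding fg(2) quotient_rule_fraction[OF d nz(3)] dd unfolding f(1) g(1) Df Dg
    using nz(1,2) by (simp add: to_fract_mult to_fract_add divide_simps) (simp add: algebra_simps power2_eq_square)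
qed

lemma derivation_xy: "derivation deriv_x" "derivation deriv_y"
  unfolding deriv_x_def deriv_y_def
  by (rule derivation_quotient_rule, rule poly_derivation_map_pderiv poly_derivation_pderiv)+

lemma derivation_basic:
  assumes D: "derivation D"
  shows "D (f + g) = D f + D g" "D (f * g) = D f * g + f * D g" "D 0 = 0" "D 1 = 0" "D (- f) = - D f"
    "D (\<Sum>i\<in>I. h i) = (\<Sum>i\<in>I. D (h i))" "s \<noteq> 0 \<Longrightarrow> D (f / s) = (D f * s - f * D s) / s\<^sup>2"
proof -
  show add: "D (f + g) = D f + D g" for f g using D by (simp add: derivation_def)
  show mult: "D (f * g) = D f * g + f * D g" for f g using D by (simp add: derivation_def)
  have "D 0 + D 0 = D 0 + 0" using add[of 0 0] by simp
  then show zero: "D 0 = 0" by (simp only: add_left_cancel)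
  have "D 1 + D 1 = D 1 + 0" using mult[of 1 1] by simp
  then show "D 1 = 0" by (simp only: add_left_cancel)
  have "D f + D (- f) = 0" using add[of f "- f"] zero by simp
  then show "D (- f) = - D f" by (simp add: eq_neg_iff_add_eq_0 add.commute)
  show "D (\<Sum>i\<in>I. h i) = (\<Sum>i\<in>I. D (h i))"
    by (induction I rule: infinite_finite_induct) (simp_all add: zero add)
  assume s: "s \<noteq> 0"
  have "D (f / s * s) = D (f / s) * s + f / s * D s" by (rule mult)
  then have "D f = D (f / s) * s + f / s * D s" using s by simp
  then show "D (f / s) = (D f * s - f * D s) / s\<^sup>2" using s by (simp add: field_simps power2_eq_square)
qed

lemma derivation_combination:
  assumes "derivation D" "derivation E" shows "derivation (\<lambda>f. a * D f + b * E f)"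
  using derivation_basic(1,2)[OF assms(1)] derivation_basic(1,2)[OF assms(2)]
  by (simp add: derivation_def algebra_simps)

lemma derivation_powi:
  assumes D: "derivation D" and f: "f \<noteq> 0" "D f = c * f"
  shows "D (f powi n) = of_int n * c * f powi n"
proof -
  note basic = derivation_basic[OF D]
  have nat: "D (f ^ k) = of_nat k * c * f ^ k" for k
    by (induction k) (simp_all add: basic f algebra_simps)
  show ?thesis
  proof (cases "0 \<le> n")
    case True
    then show ?thesis using nat[of "nat n"] by (simp add: power_int_def of_nat_nat)
  next
    case False
    define k where "k = nat (- n)"
    have n: "n = - int k" using False by (simp add: k_def)
    have "D (1 / f ^ k) = (D 1 * f ^ k - 1 * D (f ^ k)) / (f ^ k)\<^sup>2" by (rule basic(7)) (use f in simp)
    also have "\<dots> = - (of_nat k * c) * (1 / f ^ k)" using f by (simp add: nat basic power2_eq_square)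
    finally show ?thesis by (simp add: n power_int_minus divide_inverse)
  qed
qed

lemma poly_derivation_one: "poly_derivation d \<Longrightarrow> d 1 = 0"
proof -
  assume "poly_derivation d"
  then have "d (1 * 1) = d 1 * 1 + 1 * d 1" unfolding poly_derivation_def by blast
  then have "d 1 + d 1 = d 1 + 0" by simp
  then show ?thesis by (simp only: add_left_cancel)
qed

lemma quotient_rule_to_fract:
  assumes "poly_derivation d" shows "quotient_rule d (to_fract a) = to_fract (d a)"
  using quotient_rule_fraction[OF assms, of 1 a] poly_derivation_one[OF assms] by simp

lemma deriv_values: "deriv_x fn_x = 1" "deriv_x fn_y = 0" "deriv_y fn_x = 0" "deriv_y fn_y = 1"
  "deriv_x (const_fn c) = 0" "deriv_y (const_fn c) = 0"
  unfolding deriv_x_def deriv_y_def fn_x_def fn_y_def const_fn_def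
    quotient_rule_to_fract[OF poly_derivation_map_pderiv] quotient_rule_to_fract[OF poly_derivation_pderiv]
  by (simp_all add: pderiv_pCons map_poly_pCons poly_derivation_one[OF poly_derivation_map_pderiv]
      flip: one_pCons)

text \<open>The invariant derivation \<open>\<chi>\<^sup>m \<mapsto> \<langle>m, u\<rangle> \<chi>\<^sup>m\<close>.\<close>

definition euler :: "int \<times> int \<Rightarrow> ratfun \<Rightarrow> ratfun" where
  "euler u f = (of_int (fst u) * fn_x) * deriv_x f + (of_int (snd u) * fn_y) * deriv_y f"

lemma derivation_euler: "derivation (euler u)"
  unfolding euler_def[abs_def] by (rule derivation_combination[OF derivation_xy])

lemma euler_character: "euler u (character m) = of_int (dot m u) * character m"
proof -
  have x: "euler u fn_x = of_int (fst u) * fn_x" "euler u fn_y = of_int (snd u) * fn_y"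
    by (simp_all add: euler_def deriv_values)
  show ?thesis
    unfolding character_def derivation_basic(2)[OF derivation_euler]
      derivation_powi[OF derivation_euler fn_nonzero(1) x(1)] derivation_powi[OF derivation_euler fn_nonzero(2) x(2)]
    by (simp add: dot_def algebra_simps)
qed

lemma euler_const: "euler u (const_fn c) = 0"
  by (simp add: euler_def deriv_values)

lemma const_fn_of_int: "const_fn (of_int k) = of_int k"
proof -
  have "const_fn (of_nat n) = of_nat n" for n by (induction n) (simp_all add: const_fn_simps)
  then show ?thesis by (cases k rule: int_cases2) (simp_all add: const_fn_simps)
qed

lemma euler_semigroup_algebra:
  assumes "f \<in> semigroup_algebra S" shows "euler u f \<in> semigroup_algebra {m \<in> S. dot m u \<noteq> 0}"
proof -
  obtain I c where I: "finite I" "I \<subseteq> S" "f = (\<Sum>m\<in>I. const_fn (c m) * character m)"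
    using assms by (rule semigroup_algebraE)
  have "euler u f = (\<Sum>m\<in>I. const_fn (c m * of_int (dot m u)) * character m)"
    unfolding I(3) derivation_basic(6)[OF derivation_euler]
    by (simp add: derivation_basic(2)[OF derivation_euler] euler_const euler_character const_fn_simps const_fn_of_int mult.assoc)
  also have "\<dots> \<in> semigroup_algebra {m \<in> S. dot m u \<noteq> 0}"
  proof (rule semigroup_algebra_sum)
    fix m assume "m \<in> I"
    then show "const_fn (c m * of_int (dot m u)) * character m \<in> semigroup_algebra {m \<in> S. dot m u \<noteq> 0}"
    proof (cases "dot m u = 0")
      case True
      then show ?thesis by (simp add: const_fn_simps(1) semigroup_algebra_zero)
    next
      case False
      then show ?thesis using I(2) \<open>m \<in> I\<close> by (intro semigroup_algebra_term) auto
    qed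
  qed
  finally show ?thesis .
qed

text \<open>\<open>fn_x * fn_y * jacobian f g\<close> is the coefficient of
  \<open>df \<and> dg\<close> with respect to the invariant form \<open>dx/x \<and> dy/y\<close>,
  and evaluating that form on the vector fields of \<open>u\<close> and \<open>w\<close> gives their
  determinant.\<close>

lemma euler_wedge:
  "euler u f * euler w g - euler w f * euler u g = of_int (cross u w) * (fn_x * fn_y * jacobian f g)"
  by (simp add: euler_def jacobian_def cross_def algebra_simps)

text \<open>Invariant derivations preserve weights and therefore the local ring. The one belonging
  to \<open>u\<close> kills the part of weight 0, so its values are divisible by the
  uniformizer.\<close>

lemma euler_ray_ring:
  assumes m0: "dot m0 u = 1" and f: "f \<in> ray_ring u"
  shows "euler w f \<in> ray_ring u" "\<exists>g\<in>ray_ring u. euler u f = character m0 * g"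
proof -
  note dvr = ray_dvr[OF m0]
  note sub = is_subringD[OF dvr_basics(1)[OF dvr]]
  obtain a s where as: "f = a / s" "a \<in> ray_alg u" "s \<in> ray_alg u - ray_ideal u"
    using f unfolding ray_ring_def localization_at_def by blast
  have su: "s \<in> unit_set (ray_ring u)" using ray_unit[OF m0 as(3)] .
  then have s: "s \<noteq> 0" "inverse s \<in> ray_ring u" using unit_setD by blast+
  have A: "ray_alg u \<subseteq> ray_ring u" by (rule ray_alg_subset_ring[OF m0])
  have eq: "euler w f = (euler w a * s - a * euler w s) * (inverse s * inverse s)" for w
    unfolding as(1) derivation_basic(7)[OF derivation_euler s(1)] by (simp add: power2_eq_square divide_inverse)
  have eA: "euler w b \<in> ray_alg u" if "b \<in> ray_alg u" for b w
    using euler_semigroup_algebra[of b "{m. 0 \<le> dot m u}" w] that semigroup_algebra_mono[of "{m \<in> {m. 0 \<le> dot m u}. dot m w \<noteq> 0}" "{m. 0 \<le> dot m u}"]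
    unfolding ray_alg_def by blast
  have eI: "euler u b \<in> ray_ideal u" if "b \<in> ray_alg u" for b
  proof -
    have "{m \<in> {m. 0 \<le> dot m u}. dot m u \<noteq> 0} = {m. 0 < dot m u}" by auto
    then show ?thesis
      using euler_semigroup_algebra[of b "{m. 0 \<le> dot m u}" u] that unfolding ray_alg_def ray_ideal_def by (simp only:)
  qed
  have "euler w a * s - a * euler w s \<in> ray_alg u"
    using as by (intro is_subringD(5,6)[OF is_subring_ray_alg] eA) simp_all
  then have "euler w a * s - a * euler w s \<in> ray_ring u" using A by blast
  then show "euler w f \<in> ray_ring u" unfolding eq by (intro sub(5) s(2))
  have "s * euler u a + - 1 * (a * euler u s) \<in> ray_ideal u"
  proof (rule ray_ideal_add)
    show "s * euler u a \<in> ray_ideal u" using as by (intro ray_alg_mult_ideal eI) simp_all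
    have "a * euler u s \<in> ray_ideal u" using as by (intro ray_alg_mult_ideal eI) simp_all
    then have "- (a * euler u s) \<in> ray_ideal u" unfolding ray_ideal_def by (rule semigroup_algebra_uminus)
    then show "- 1 * (a * euler u s) \<in> ray_ideal u" by simp
  qed
  then have I: "euler u a * s - a * euler u s \<in> ray_ideal u" by (simp add: mult.commute)
  then have "euler u a * s - a * euler u s \<in> semigroup_algebra {m. 1 \<le> dot m u}"
    unfolding ray_ideal_def by (rule subsetD[OF semigroup_algebra_mono, rotated]) auto
  then have "(euler u a * s - a * euler u s) * character m0 powi (- 1) \<in> ray_alg u"
    by (simp only: weight_shift(1)[OF m0])
  then have "(euler u a * s - a * euler u s) * character m0 powi (- 1) \<in> ray_ring u" using A by blast
  then have "(euler u a * s - a * euler u s) * character m0 powi (- 1) * (inverse s * inverse s) \<in> ray_ring u"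
    by (rule sub(5)[OF _ sub(5)[OF s(2) s(2)]])
  moreover have "euler u f = character m0 * ((euler u a * s - a * euler u s) * character m0 powi (- 1) * (inverse s * inverse s))"
    unfolding eq by (simp add: power_int_minus)
  ultimately show "\<exists>g\<in>ray_ring u. euler u f = character m0 * g" by blast
qed

text \<open>Two generators of the module of regular 2-forms divide each other in the valuation ring,
  so they have the same order and the \<open>THE\<close> in \<open>ord_form\<close> is
  determined.\<close>

lemma ord_form_eqI:
  assumes dvr: "is_dvr R t" and fg: "f \<in> R" "g \<in> R" "jacobian f g \<noteq> 0"
    and gen: "\<And>u v. u \<in> R \<Longrightarrow> v \<in> R \<Longrightarrow> jacobian u v / jacobian f g \<in> R"
  shows "ord_form R = - ord_at R (jacobian f g)"
  unfolding ord_form_def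
proof (rule the_equality)
  show "\<exists>u\<in>R. \<exists>v\<in>R. jacobian u v \<noteq> 0 \<and> (\<forall>u'\<in>R. \<forall>v'\<in>R. jacobian u' v' / jacobian u v \<in> R) \<and>
      - ord_at R (jacobian f g) = - ord_at R (jacobian u v)"
    using fg gen by blast
  fix n assume "\<exists>u\<in>R. \<exists>v\<in>R. jacobian u v \<noteq> 0 \<and> (\<forall>u'\<in>R. \<forall>v'\<in>R. jacobian u' v' / jacobian u v \<in> R) \<and>
      n = - ord_at R (jacobian u v)"
  then obtain u v where uv: "u \<in> R" "v \<in> R" "jacobian u v \<noteq> 0" "jacobian f g / jacobian u v \<in> R"
    "n = - ord_at R (jacobian u v)" using fg by blast
  have "0 \<le> ord_at R (jacobian f g / jacobian u v)" "0 \<le> ord_at R (jacobian u v / jacobian f g)"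
    using in_dvr_iff[OF dvr] uv(3,4) fg(3) gen[OF uv(1,2)] by simp_all
  then show "n = - ord_at R (jacobian f g)"
    using uv(5) ord_at_divide[OF dvr] uv(3) fg(3) by simp
qed

text \<open>\<open>dx/x \<and> dy/y\<close> has a simple pole along every invariant divisor, whence
  the \<open>- 1\<close>, and the factor \<open>x y\<close> contributes its order
  \<open>fst u + snd u\<close>. The local coordinates are the uniformizer of \<open>m0\<close> and
  the character of \<open>m1\<close>, a unit because \<open>m1\<close> vanishes on
  \<open>u\<close>.\<close>

lemma ord_form_ray:
  assumes m0: "dot m0 u = 1" shows "ord_form (ray_ring u) = fst u + snd u - 1"
proof -
  note dvr = ray_dvr[OF m0]
  note sub = is_subringD[OF dvr_basics(1)[OF dvr]]
  define m1 where "m1 = (- snd u, fst u)"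
  have m1: "dot m1 u = 0" "cross m1 m0 = - 1" using m0 by (simp_all add: m1_def dot_def cross_def algebra_simps)
  have c: "character m1 \<in> ray_ring u" "character m0 \<in> ray_ring u"
    using in_dvr_iff[OF dvr] ord_ray_character[OF m0] m0 m1 by simp_all
  have xy: "fn_x * fn_y = character (1, 1)" by (simp add: character_def)
  have e1: "euler (1, 0) (character m) = of_int (fst m) * character m" "euler (0, 1) (character m) = of_int (snd m) * character m" for m
    by (simp_all add: euler_character dot_def)
  have "fn_x * fn_y * jacobian (character m1) (character m0) = of_int (cross m1 m0) * character (m1 + m0)"
    using euler_wedge[of "(1, 0)" "character m1" "(0, 1)" "character m0"]
    unfolding e1 character_add by (simp add: cross_def algebra_simps)
  then have jac: "fn_x * fn_y * jacobian (character m1) (character m0) = - character (m1 + m0)" by (simp add: m1)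
  then have j0: "jacobian (character m1) (character m0) \<noteq> 0" using character_nonzero[of "m1 + m0"] by auto
  have jd: "jacobian (character m1) (character m0) = - 1 * (character (m1 + m0) / character (1, 1))"
    using jac unfolding xy by (simp add: field_simps)
  have unit: "- 1 \<in> unit_set (ray_ring u)" using sub(1) sub(3)[OF sub(1)] by (simp add: unit_set_def)
  have ordj: "ord_at (ray_ring u) (jacobian (character m1) (character m0)) = 1 - (fst u + snd u)"
  proof -
    have "ord_at (ray_ring u) (- 1 * (character (m1 + m0) / character (1, 1))) = 0 + (dot (m1 + m0) u - dot (1, 1) u)"
      using ord_at_mult[OF dvr, of "- 1" "character (m1 + m0) / character (1, 1)"] ord_at_unit[OF dvr unit]
        ord_at_divide[OF dvr character_nonzero character_nonzero] ord_ray_character[OF m0] by simp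
    then show ?thesis unfolding jd by (simp add: m0 m1 dot_def[of "(1, 1)"])
  qed
  have gen: "jacobian f g / jacobian (character m1) (character m0) \<in> ray_ring u"
    if fg: "f \<in> ray_ring u" "g \<in> ray_ring u" for f g
  proof -
    \<comment> \<open>Completes \<open>u\<close> to a unimodular pair, so that
      \<open>euler_wedge\<close> has the factor 1. Each product in it contains one derivative along
      \<open>u\<close>, which supplies the factor \<open>character m0\<close>.\<close>
    define w where "w = (- snd m0, fst m0)"
    have w: "cross u w = 1" using m0 by (simp add: w_def cross_def dot_def algebra_simps)
    obtain f' where f': "f' \<in> ray_ring u" "euler u f = character m0 * f'" using euler_ray_ring(2)[OF m0 fg(1)] by blast
    obtain g' where g': "g' \<in> ray_ring u" "euler u g = character m0 * g'" using euler_ray_ring(2)[OF m0 fg(2)] by blast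
    define h where "h = f' * euler w g - euler w f * g'"
    have h: "h \<in> ray_ring u"
      unfolding h_def by (intro sub(5,6) f'(1) g'(1) euler_ray_ring(1)[OF m0] fg)
    have fg': "fn_x * fn_y * jacobian f g = character m0 * h"
      using euler_wedge[of u f w g] unfolding w f' g' by (simp add: h_def algebra_simps)
    have "jacobian f g / jacobian (character m1) (character m0) =
        (fn_x * fn_y * jacobian f g) / (fn_x * fn_y * jacobian (character m1) (character m0))"
      using fn_nonzero by simp
    also have "\<dots> = - (character m0 * h) / character (m1 + m0)" unfolding fg' jac by simp
    also have "\<dots> = - (h * character (- m1))" by (simp add: character_add character_uminus divide_inverse)
    also have "\<dots> \<in> ray_ring u"
    proof -
      have "character (- m1) \<in> ray_ring u" using in_dvr_iff[OF dvr] ord_ray_character[OF m0, of "- m1"] m1 by simp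
      then show ?thesis by (intro sub(3,5) h)
    qed
    finally show ?thesis .
  qed
  show ?thesis using ord_form_eqI[OF dvr c j0 gen] ordj by simp
qed

lemma deriv_poly_local:
  assumes p: "prime_elem p" and d: "poly_derivation d" and f: "f \<in> poly_local p"
  shows "quotient_rule d f \<in> poly_local p"
proof -
  obtain a b where ab: "f = to_fract a / to_fract b" "\<not> p dvd b" using f unfolding poly_local_def by blast
  then have "b \<noteq> 0" by auto
  then have "quotient_rule d f = to_fract (d a * b - a * d b) / to_fract (b\<^sup>2)"
    unfolding ab(1) quotient_rule_fraction[OF d \<open>b \<noteq> 0\<close>] by (simp add: to_fract_mult to_fract_diff to_fract_power)
  moreover have "\<not> p dvd b\<^sup>2" using ab(2) p prime_elem_dvd_power by blast
  ultimately show ?thesis unfolding poly_local_def by blast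
qed

text \<open>The partial derivatives preserve the local ring, so \<open>dx \<and> dy\<close> itself
  generates the regular 2-forms along a curve in the torus.\<close>

lemma ord_form_poly_local:
  assumes p: "prime_elem p" shows "ord_form (poly_local p) = 0"
proof -
  note dvr = poly_local_dvr[OF p]
  note sub = is_subringD[OF dvr_basics(1)[OF dvr]]
  have j: "jacobian fn_x fn_y = 1" by (simp add: jacobian_def deriv_values)
  have xy: "fn_x \<in> poly_local p" "fn_y \<in> poly_local p" unfolding fn_x_def fn_y_def by (rule to_fract_in_poly_local[OF p])+
  have "jacobian f g \<in> poly_local p" if "f \<in> poly_local p" "g \<in> poly_local p" for f g
    unfolding jacobian_def deriv_x_def deriv_y_def
    by (intro sub(5,6) deriv_poly_local[OF p] poly_derivation_map_pderiv poly_derivation_pderiv that)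
  then have "ord_form (poly_local p) = - ord_at (poly_local p) (jacobian fn_x fn_y)"
    by (intro ord_form_eqI[OF dvr xy]) (simp_all add: j)
  then show ?thesis using j ord_at_one[OF dvr] by simp
qed

lemma canonical_divisor_toric:
  assumes \<Sigma>: "toric_fan \<Sigma>"
  shows "u \<in> rays \<Sigma> \<Longrightarrow> canonical_divisor (toric_surface \<Sigma>) (ray_ring u) = fst u + snd u - 1"
    and "torus_prime p \<Longrightarrow> canonical_divisor (toric_surface \<Sigma>) (poly_local p) = 0"
proof -
  assume u: "u \<in> rays \<Sigma>"
  then obtain m where "dot m u = 1" using ray_ring_dvr by blast
  moreover have "ray_ring u \<in> prime_divisors (toric_surface \<Sigma>)" using u unfolding prime_divisors_toric[OF \<Sigma>] by blast
  ultimately show "canonical_divisor (toric_surface \<Sigma>) (ray_ring u) = fst u + snd u - 1"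
    using ord_form_ray by (simp add: canonical_divisor_def)
next
  assume p: "torus_prime p"
  then show "canonical_divisor (toric_surface \<Sigma>) (poly_local p) = 0"
    using ord_form_poly_local[OF torus_primeD[OF p]] by (simp add: canonical_divisor_def)
qed

section \<open>The index\<close>

lemma openin_zariski_basic:
  "openin (zariski X) {R \<in> X. f \<in> R}"
  unfolding zariski_def by (rule topology_generated_by_Basis) blast

text \<open>A larger local ring belongs to a more general point, and open sets are stable under
  generization.\<close>

lemma openin_zariski_upward:
  assumes "openin (zariski X) V" "P \<in> V" "P \<subseteq> R" "R \<in> X" shows "R \<in> V"
proof -
  have "generate_topology_on (range (\<lambda>f. {R \<in> X. f \<in> R})) V"
    using assms(1) unfolding zariski_def openin_topology_generated_by_iff .
  then have "\<forall>P\<in>V. \<forall>R\<in>X. P \<subseteq> R \<longrightarrow> R \<in> V"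
  proof induction
    case (Basis s)
    then show ?case by blast
  qed blast+
  then show ?thesis using assms by blast
qed

context
  fixes Q assumes Q: "LDP_polygon Q"
begin

abbreviation "polygon_surface \<equiv> toric_surface (polygon_fan Q)"

lemma edge_exists: "\<exists>a b. edge Q a b"
  using cone2_cover[OF Q, of "(1, 0)"] by (auto simp: prod_eq_iff)

lemma toric_fan_polygon: "toric_fan (polygon_fan Q)"
  unfolding toric_fan_def
proof (intro conjI ballI)
  have "polygon_fan Q \<subseteq> cone_of ` Pow (vertices Q)" unfolding polygon_fan_eq[OF Q] edge_def by blast
  then show "finite (polygon_fan Q)" using finite_vertices[OF Q] finite_subset by blast
  have "cone_of {} \<in> polygon_fan Q" using edge_exists unfolding polygon_fan_eq[OF Q] by blast
  then show "{0} \<in> polygon_fan Q" by simp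
  fix \<sigma> assume "\<sigma> \<in> polygon_fan Q"
  then obtain a b B where B: "\<sigma> = cone_of B" "edge Q a b" "B \<subseteq> {a, b}" unfolding polygon_fan_eq[OF Q] by blast
  have "w \<in> rays (polygon_fan Q)" if "w \<in> B" for w
  proof -
    have "{w} \<subseteq> {a, b}" using B(3) that by blast
    then have "cone_of {w} \<in> polygon_fan Q" using B(2) unfolding polygon_fan_eq[OF Q] by blast
    moreover have "w \<in> vertices Q" using B(2,3) that by (auto simp: edge_def)
    ultimately show ?thesis using primitive_vertex[OF Q] by (simp add: rays_def)
  qed
  moreover have "finite B" using B(3) finite_subset by blast
  ultimately show "\<exists>B\<subseteq>rays (polygon_fan Q). finite B \<and> \<sigma> = cone_of B" using B(1) by blast
qed

lemma rays_polygon_fan: "rays (polygon_fan Q) \<subseteq> vertices Q"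
proof
  fix u assume "u \<in> rays (polygon_fan Q)"
  then obtain a b B where u: "primitive u" "cone_of {u} = cone_of B" "edge Q a b" "B \<subseteq> {a, b}"
    unfolding rays_def polygon_fan_eq[OF Q] by blast
  have ab: "a \<in> vertices Q" "b \<in> vertices Q" "0 < cross a b" using u(3) by (auto simp: edge_def)
  have u0: "lvec u \<noteq> 0" using u(1) by (auto simp: primitive_def)
  have uB: "lvec w \<in> cone_of {u}" if "w \<in> B" for w using cone_of_inc[OF that] u(2) by simp
  have eq: "w = u" if w: "w \<in> B" for w
  proof -
    obtain c where "0 \<le> c" "lvec w = c *\<^sub>R lvec u" using uB[OF w] unfolding cone_of_singleton by blast
    moreover have "primitive w" using w u(4) ab primitive_vertex[OF Q] by blast
    ultimately show ?thesis using primitive_positive_multiple u(1) by blast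
  qed
  have "B \<noteq> {}"
  proof
    assume "B = {}"
    then have "lvec u \<in> {0}" using cone_of_inc[of u "{u}"] u(2) by simp
    then show False using u0 by simp
  qed
  then show "u \<in> vertices Q" using eq u(4) ab by blast
qed

text \<open>The closed point of the chart of an edge.\<close>

definition edge_ideal :: "int \<times> int \<Rightarrow> int \<times> int \<Rightarrow> ratfun set" where
  "edge_ideal a b = semigroup_algebra ({m. \<forall>w\<in>{a, b}. 0 \<le> dot m w} - {0})"

lemma dot_eq_zero_pair:
  assumes "0 < cross a b" "dot m a = 0" "dot m b = 0" shows "m = 0"
proof -
  have "fst m * cross a b = dot m a * snd b - dot m b * snd a" "snd m * cross a b = dot m b * fst a - dot m a * fst b"
    by (simp_all add: dot_def cross_def algebra_simps)
  then show ?thesis using assms by (simp add: prod_eq_iff)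
qed

text \<open>The cone is two-dimensional, so its dual semigroup is pointed: zero is a face, with the
  nonzero exponents as complement.\<close>

lemma prime_edge_ideal:
  assumes ab: "0 < cross a b" shows "prime_in (edge_ideal a b) (cone_alg {a, b})"
proof -
  let ?S = "{m. \<forall>w\<in>{a, b}. 0 \<le> dot m w}"
  have S: "?S = {0} \<union> (?S - {0})" by auto
  have "prime_in (semigroup_algebra (?S - {0})) (semigroup_algebra ({0} \<union> (?S - {0})))"
  proof (rule prime_in_face)
    fix s t assume st: "s \<in> {0} \<union> (?S - {0})" "t \<in> ?S - {0}"
    have "s + t \<noteq> 0"
    proof
      assume s: "s + t = 0"
      have "dot s a + dot t a = 0" "dot s b + dot t b = 0" using arg_cong[OF s, of "\<lambda>m. dot m a"] arg_cong[OF s, of "\<lambda>m. dot m b"] by simp_all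
      then have "dot t a = 0" "dot t b = 0" using st by auto
      then show False using dot_eq_zero_pair[OF ab] st(2) by blast
    qed
    then show "s + t \<in> ?S - {0}" using st by auto
  qed auto
  then show ?thesis unfolding edge_ideal_def cone_alg_def by (simp only: S[symmetric])
qed

lemma const_unit_ray_ring:
  assumes "dot m0 u = 1" "c \<noteq> 0" shows "ord_at (ray_ring u) (const_fn c) = 0"
proof -
  have c: "const_fn d \<in> ray_ring u" for d
    using semigroup_algebra_term[of 0 "{m. 0 \<le> dot m u}" d] ray_alg_subset_ring[OF assms(1)] by (auto simp: ray_alg_def)
  have "const_fn c * const_fn (inverse c) = 1" using assms(2) by (simp add: const_fn_simps flip: const_fn_simps(4))
  then have "inverse (const_fn c) = const_fn (inverse c)" by (metis inverse_unique)
  then have "const_fn c \<in> unit_set (ray_ring u)" using c assms(2) by (simp add: unit_set_def)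
  then show ?thesis by (rule ord_at_unit[OF ray_dvr[OF assms(1)]])
qed

text \<open>A curve that misses the closed point of the chart of an edge has a Newton polygon with a vertex
  dual to the cone: the orders of its equation along the two boundary divisors are those of a
  single character.\<close>

lemma missed_curve_vertex:
  assumes ab: "0 < cross a b" and a: "dot ma a = 1" and b: "dot mb b = 1" and p: "torus_prime p"
    and missed: "\<not> localization_at (cone_alg {a, b}) (edge_ideal a b) \<subseteq> poly_local p"
  shows "\<exists>m. ord_at (ray_ring a) (to_fract p) = dot m a \<and> ord_at (ray_ring b) (to_fract p) = dot m b"
proof (rule ccontr)
  assume no: "\<not> ?thesis"
  let ?S = "{m. \<forall>w\<in>{a, b}. 0 \<le> dot m w}"
  note pe = torus_primeD[OF p]
  have sub: "cone_alg {a, b} \<subseteq> poly_local p" using cone_alg_subset_laurent laurent_subset_poly_local[OF p] by blast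
  \<comment> \<open>A regular function of the chart that does not vanish at the closed point, hence
    has a constant term, but vanishes on the curve.\<close>
  then obtain s where s: "s \<in> cone_alg {a, b} - edge_ideal a b" "s \<notin> unit_set (poly_local p)"
    using missed localization_subset[OF is_subring_poly_local[OF pe] sub] by blast
  have sL: "s \<in> laurent" using s(1) cone_alg_subset_laurent by blast
  then obtain k g where g: "s = character k * to_fract g" by (rule laurent_clear_denominators)
  have "p dvd g"
  proof (rule ccontr)
    assume "\<not> p dvd g"
    then have "s \<in> unit_set (poly_local p)"
      unfolding g by (intro unit_set_mult[OF is_subring_poly_local[OF pe]] character_unit_poly_local[OF p] poly_local_unit[OF pe])
    then show False using s(2) by blast
  qed
  then obtain g' where "g = p * g'" by blast
  define h where "h = character k * to_fract g'"
  have sh: "s = to_fract p * h" unfolding g h_def \<open>g = p * g'\<close> by (simp add: to_fract_mult)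
  have hL: "h \<in> laurent"
    unfolding h_def by (intro is_subringD(5)[OF is_subring_laurent] semigroup_algebra_character poly_in_laurent UNIV_I)
  have s0: "s \<noteq> 0" using s(1) semigroup_algebra_zero by (auto simp: edge_ideal_def)
  then have nz: "to_fract p \<noteq> 0" "h \<noteq> 0" unfolding sh by auto
  have weights: "to_fract p \<in> semigroup_algebra {m. ord_at (ray_ring w) (to_fract p) \<le> dot m w}"
    "h \<in> semigroup_algebra {m. - ord_at (ray_ring w) (to_fract p) \<le> dot m w}"
    if w: "w \<in> {a, b}" "dot mw w = 1" for w mw
  proof -
    note dvr = ray_dvr[OF w(2)]
    show "to_fract p \<in> semigroup_algebra {m. ord_at (ray_ring w) (to_fract p) \<le> dot m w}"
      by (rule ord_ray(1)[OF w(2) poly_in_laurent nz(1)])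
    have "s \<in> semigroup_algebra ?S" using s(1) by (simp add: cone_alg_def)
    then have "s \<in> semigroup_algebra {m. 0 \<le> dot m w}"
      by (rule subsetD[OF semigroup_algebra_mono, rotated]) (use w(1) in blast)
    then have "0 \<le> ord_at (ray_ring w) s" by (rule ord_ray(2)[OF w(2) sL s0])
    then have "- ord_at (ray_ring w) (to_fract p) \<le> ord_at (ray_ring w) h"
      unfolding sh ord_at_mult[OF dvr nz] by simp
    then have "{m. ord_at (ray_ring w) h \<le> dot m w} \<subseteq> {m. - ord_at (ray_ring w) (to_fract p) \<le> dot m w}" by auto
    then show "h \<in> semigroup_algebra {m. - ord_at (ray_ring w) (to_fract p) \<le> dot m w}"
      using ord_ray(1)[OF w(2) hL nz(2)] semigroup_algebra_mono by blast
  qed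
  let ?\<alpha> = "ord_at (ray_ring a) (to_fract p)" and ?\<beta> = "ord_at (ray_ring b) (to_fract p)"
  have "to_fract p \<in> semigroup_algebra ({m. ?\<alpha> \<le> dot m a} \<inter> {m. ?\<beta> \<le> dot m b})"
    by (intro semigroup_algebra_Int weights(1)[OF _ a] weights(1)[OF _ b]) auto
  moreover have "h \<in> semigroup_algebra ({m. - ?\<alpha> \<le> dot m a} \<inter> {m. - ?\<beta> \<le> dot m b})"
    by (intro semigroup_algebra_Int weights(2)[OF _ a] weights(2)[OF _ b]) auto
  \<comment> \<open>If no exponent attained both orders of \<open>p\<close> at once, no term of
    \<open>p\<close> and no term of \<open>h\<close> could have opposite exponents, and
    \<open>s\<close> would lose its constant term.\<close>
  ultimately have "s \<in> semigroup_algebra (UNIV - {0})"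
    unfolding sh
  proof (rule semigroup_algebra_mult)
    fix m n assume mn: "m \<in> {m. ?\<alpha> \<le> dot m a} \<inter> {m. ?\<beta> \<le> dot m b}" "n \<in> {m. - ?\<alpha> \<le> dot m a} \<inter> {m. - ?\<beta> \<le> dot m b}"
    have "m + n \<noteq> 0"
    proof
      assume z: "m + n = 0"
      have "dot m a + dot n a = 0" "dot m b + dot n b = 0" using arg_cong[OF z, of "\<lambda>m. dot m a"] arg_cong[OF z, of "\<lambda>m. dot m b"] by simp_all
      then have "?\<alpha> = dot m a" "?\<beta> = dot m b" using mn by auto
      then show False using no by blast
    qed
    then show "m + n \<in> UNIV - {0}" by blast
  qed
  moreover have "s \<in> semigroup_algebra ?S" using s(1) by (simp add: cone_alg_def)
  ultimately have "s \<in> semigroup_algebra (?S \<inter> (UNIV - {0}))" by (intro semigroup_algebra_Int)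
  also have "?S \<inter> (UNIV - {0}) = ?S - {0}" by blast
  finally show False using s(1) by (simp add: edge_ideal_def)
qed

text \<open>The canonical divisor is supported on the boundary. A torus curve through the closed
  point of the chart therefore has order 0 in the local equation \<open>f\<close>, and all torus
  curves that occur in \<open>f\<close> miss that point.\<close>

lemma cartier_index_functional:
  assumes e: "edge Q a b" and C: "cartier polygon_surface (\<lambda>R. l * canonical_divisor polygon_surface R)"
  shows "\<exists>m. dot m a = l \<and> dot m b = l"
proof -
  note \<Sigma> = toric_fan_polygon
  have ab: "0 < cross a b" "a \<in> vertices Q" "b \<in> vertices Q" using e by (auto simp: edge_def)
  have rays: "a \<in> rays (polygon_fan Q)" "b \<in> rays (polygon_fan Q)"
    using e primitive_vertex[OF Q] ab unfolding rays_def polygon_fan_eq[OF Q] by blast+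
  obtain ma where ma: "dot ma a = 1" using ray_ring_dvr[OF rays(1)] by blast
  obtain mb where mb: "dot mb b = 1" using ray_ring_dvr[OF rays(2)] by blast
  note dvra = ray_dvr[OF ma] and dvrb = ray_dvr[OF mb]
  note prime = prime_edge_ideal[OF ab(1)]
  define P where "P = localization_at (cone_alg {a, b}) (edge_ideal a b)"
  have PX: "P \<in> polygon_surface"
    unfolding P_def by (rule toric_surface_pointI[OF _ prime]) (use e in \<open>unfold polygon_fan_eq[OF Q], blast\<close>)
  obtain V f where V: "openin (zariski polygon_surface) V" "P \<in> V" "f \<noteq> 0"
    "\<And>R. R \<in> prime_divisors polygon_surface \<Longrightarrow> R \<in> V \<Longrightarrow> l * canonical_divisor polygon_surface R = principal_divisor polygon_surface f R"
    using C PX unfolding cartier_def by blast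
  have ord_f: "l * canonical_divisor polygon_surface R = ord_at R f"
    if R: "R \<in> prime_divisors polygon_surface" "P \<subseteq> R" for R
  proof -
    have "R \<in> polygon_surface" using R(1) by (simp add: prime_divisors_def)
    then have "R \<in> V" using openin_zariski_upward[OF V(1,2) R(2)] by blast
    then show ?thesis using V(4)[OF R(1)] R(1) by (simp add: principal_divisor_def)
  qed
  have below: "P \<subseteq> ray_ring w" if w: "w \<in> {a, b}" "dot mw w = 1" for w mw
    unfolding P_def
  proof (rule point_below_ray[OF prime w(1) _ w(2)])
    fix m assume "\<And>b'. b' \<in> {a, b} \<Longrightarrow> 0 \<le> dot m b'" "0 < dot m w"
    then show "character m \<in> edge_ideal a b" unfolding edge_ideal_def by (intro semigroup_algebra_character) auto
  qed
  have ray_ord: "ord_at (ray_ring w) f = l * (fst w + snd w - 1)" if w: "w \<in> {a, b}" "dot mw w = 1" for w mw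
  proof -
    have wr: "w \<in> rays (polygon_fan Q)" using w(1) rays by blast
    then have "ray_ring w \<in> prime_divisors polygon_surface" unfolding prime_divisors_toric[OF \<Sigma>] by blast
    then show ?thesis using ord_f[OF _ below[OF w]] canonical_divisor_toric(1)[OF \<Sigma> wr] by simp
  qed
  \<comment> \<open>A multiplicative group that contains constants and characters, so it suffices to
    place the prime factors of \<open>f\<close> in it.\<close>
  define G where "G = {g. g \<noteq> 0 \<and> (\<exists>m. ord_at (ray_ring a) g = dot m a \<and> ord_at (ray_ring b) g = dot m b)}"
  have G_mult: "g * h \<in> G" if gh: "g \<in> G" "h \<in> G" for g h
  proof -
    obtain m n where "ord_at (ray_ring a) g = dot m a" "ord_at (ray_ring b) g = dot m b"
      "ord_at (ray_ring a) h = dot n a" "ord_at (ray_ring b) h = dot n b" "g \<noteq> 0" "h \<noteq> 0"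
      using gh unfolding G_def by blast
    then have "g * h \<noteq> 0 \<and> ord_at (ray_ring a) (g * h) = dot (m + n) a \<and> ord_at (ray_ring b) (g * h) = dot (m + n) b"
      using ord_at_mult[OF dvra] ord_at_mult[OF dvrb] by simp
    then show ?thesis unfolding G_def by blast
  qed
  have G_inverse: "inverse g \<in> G" if g: "g \<in> G" for g
  proof -
    obtain m where "ord_at (ray_ring a) g = dot m a" "ord_at (ray_ring b) g = dot m b" "g \<noteq> 0"
      using g unfolding G_def by blast
    then have "inverse g \<noteq> 0 \<and> ord_at (ray_ring a) (inverse g) = dot (- m) a \<and> ord_at (ray_ring b) (inverse g) = dot (- m) b"
      using ord_at_inverse[OF dvra] ord_at_inverse[OF dvrb] by simp
    then show ?thesis unfolding G_def by blast
  qed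
  have G_const: "const_fn c \<in> G" if "c \<noteq> 0" for c
    unfolding G_def mem_Collect_eq
    by (intro conjI exI[of _ 0]) (simp_all add: that const_unit_ray_ring[OF ma] const_unit_ray_ring[OF mb])
  have G_char: "character m \<in> G" for m
    unfolding G_def mem_Collect_eq
    by (intro conjI exI[of _ m]) (simp_all add: ord_ray_character[OF ma] ord_ray_character[OF mb])
  have G_unit: "to_fract g \<in> G" if g: "is_unit g" for g
  proof -
    obtain p where p: "g = [:p:]" "is_unit p" using iffD1[OF is_unit_poly_iff g] by blast
    obtain c where c: "p = [:c:]" "is_unit c" using iffD1[OF is_unit_poly_iff p(2)] by blast
    have "g = [:[:c:]:]" "c \<noteq> 0" using p c by auto
    then show ?thesis using G_const[of c] by (simp add: const_fn_def)
  qed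
  have G_prime: "to_fract q \<in> G" if q: "prime q" "ord_at (poly_local q) f \<noteq> 0" for q
  proof (cases "torus_prime q")
    case True
    have "poly_local q \<in> prime_divisors polygon_surface" unfolding prime_divisors_toric[OF \<Sigma>] using True by blast
    then have "\<not> P \<subseteq> poly_local q" using ord_f[of "poly_local q"] canonical_divisor_toric(2)[OF \<Sigma> True] q(2) by auto
    then show ?thesis
      using missed_curve_vertex[OF ab(1) ma mb True] q(1) unfolding P_def G_def by auto
  next
    case False
    \<comment> \<open>A prime that is not a \<open>torus_prime\<close> is associated with a
      coordinate function, which is a character.\<close>
    then obtain z where z: "z = [:[:0, 1:]:] \<or> z = [:0, 1:]" "q dvd z" using q(1) by (auto simp: torus_prime_def)
    have zG: "to_fract z \<in> G"
      using z(1) G_char[of "(1, 0)"] G_char[of "(0, 1)"] by (auto simp: character_def fn_x_def fn_y_def)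
    have root: "[:0, 1:] dvd r \<longleftrightarrow> poly r 0 = 0" for r :: "complex poly poly"
      using poly_eq_0_iff_dvd[of r 0] by simp
    have "prime_elem ([:0, 1:] :: complex poly poly)"
      unfolding prime_elem_def root by (simp add: is_unit_poly_iff)
    moreover have "prime_elem ([:[:0, 1:]:] :: complex poly poly)"
      by (rule lift_prime_elem_poly[OF prime_elem_linear_field_poly]) simp
    ultimately have "prime_elem z" using z(1) by (elim disjE) simp_all
    then have irr: "irreducible z" by (rule prime_elem_imp_irreducible)
    obtain c where c: "z = q * c" using z(2) by blast
    have "is_unit c" using irreducibleD[OF irr c] q(1) by auto
    then have "to_fract z * inverse (to_fract c) \<in> G" using G_mult G_inverse G_unit zG by blast
    moreover have "to_fract c \<noteq> 0" using \<open>is_unit c\<close> by auto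
    ultimately show ?thesis unfolding c to_fract_mult mult.assoc by simp
  qed
  have G_poly: "(\<And>q. prime q \<Longrightarrow> q dvd g \<Longrightarrow> to_fract q \<in> G) \<Longrightarrow> g \<noteq> 0 \<Longrightarrow> to_fract g \<in> G" for g
  proof (induction g rule: prime_divisors_induct)
    case (factor q g)
    then have "to_fract q \<in> G" "to_fract g \<in> G" by auto
    then show ?case using G_mult by (simp add: to_fract_mult)
  qed (use G_unit in auto)
  \<comment> \<open>The fraction is reduced, so a prime factor of \<open>g\<close> or
    \<open>h\<close> cannot cancel and has nonzero order in \<open>f\<close>, as
    \<open>G_prime\<close> requires.\<close>
  obtain g h where gh: "quot_of_fract f = (g, h)" by (cases "quot_of_fract f")
  have cop: "coprime g h" using coprime_quot_of_fract[of f] gh by simp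
  have f_eq: "f = to_fract g / to_fract h" using Fract_quot_of_fract[of f] gh by (simp add: Fract_conv_to_fract)
  have nz: "g \<noteq> 0" "h \<noteq> 0" "to_fract g \<noteq> 0" "to_fract h \<noteq> 0" using V(3) unfolding f_eq by auto
  have ord_q: "ord_at (poly_local q) f \<noteq> 0" if q: "prime q" "q dvd g \<or> q dvd h" for q
  proof
    assume "ord_at (poly_local q) f = 0"
    have qe: "prime_elem q" using q(1) by simp
    note dvr = poly_local_dvr[OF qe]
    have eq: "ord_at (poly_local q) (to_fract g) = ord_at (poly_local q) (to_fract h)"
      using \<open>ord_at (poly_local q) f = 0\<close> ord_at_divide[OF dvr nz(3,4)] unfolding f_eq by simp
    have "q dvd g \<longleftrightarrow> q dvd h"
      using to_fract_unit_iff[OF qe, of g] to_fract_unit_iff[OF qe, of h] in_unit_set_iff[OF dvr] eq nz by auto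
    then have "q dvd g" "q dvd h" using q(2) by auto
    then have "is_unit q" using cop coprime_common_divisor by blast
    then show False using qe by (simp add: prime_elem_def)
  qed
  have "to_fract g \<in> G" "to_fract h \<in> G" using G_poly G_prime ord_q nz by blast+
  then have "f \<in> G" unfolding f_eq divide_inverse by (intro G_mult G_inverse)
  then obtain m where m: "ord_at (ray_ring a) f = dot m a" "ord_at (ray_ring b) f = dot m b" unfolding G_def by blast
  \<comment> \<open>The order of \<open>f\<close> along the divisor of \<open>w\<close> is
    \<open>l * (fst w + snd w - 1)\<close>, that is \<open>dot (l, l) w - l\<close>.\<close>
  have "dot ((l, l) - m) a = l" "dot ((l, l) - m) b = l"
    using ray_ord[OF _ ma] ray_ord[OF _ mb] m by (simp_all add: dot_def algebra_simps)
  then show ?thesis by blast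
qed

text \<open>Provides a multiple of the canonical divisor that is Cartier, so that the
  \<open>LEAST\<close> in the index is attained. On the chart of an edge the local equation is a
  character: the normal \<open>m\<close> of the edge has the value \<open>cross a b\<close> at both
  ends and can be rescaled to the value \<open>l\<close>.\<close>

lemma canonical_multiple_cartier:
  assumes l: "\<And>a b. edge Q a b \<Longrightarrow> cross a b dvd l"
  shows "cartier polygon_surface (\<lambda>R. l * canonical_divisor polygon_surface R)"
  unfolding cartier_def
proof (intro conjI ballI)
  note \<Sigma> = toric_fan_polygon
  have supp: "{R. l * canonical_divisor polygon_surface R \<noteq> 0} \<subseteq> ray_ring ` rays (polygon_fan Q)"
  proof
    fix R assume "R \<in> {R. l * canonical_divisor polygon_surface R \<noteq> 0}"
    then have "R \<in> prime_divisors polygon_surface" "canonical_divisor polygon_surface R \<noteq> 0"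
      by (auto simp: canonical_divisor_def split: if_splits)
    then show "R \<in> ray_ring ` rays (polygon_fan Q)"
      using canonical_divisor_toric(2)[OF \<Sigma>] unfolding prime_divisors_toric[OF \<Sigma>] by blast
  qed
  then show "(\<lambda>R. l * canonical_divisor polygon_surface R) \<in> weil_divisors polygon_surface"
    unfolding weil_divisors_def prime_divisors_toric[OF \<Sigma>] using finite_ray_set[OF \<Sigma>] finite_subset by blast
  fix P assume "P \<in> polygon_surface"
  then obtain B I where B: "B \<subseteq> rays (polygon_fan Q)" "finite B" "cone_of B \<in> polygon_fan Q" "prime_in I (cone_alg B)" "P = localization_at (cone_alg B) I"
    using toric_surface_point[OF \<Sigma>] by metis
  obtain a b C where ab: "cone_of B = cone_of C" "edge Q a b" "C \<subseteq> {a, b}" using B(3) unfolding polygon_fan_eq[OF Q] by blast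
  have D: "0 < cross a b" using ab(2) by (simp add: edge_def)
  have Bab: "lvec w \<in> cone2 a b" if "w \<in> B" for w
    using cone_of_inc[OF that] ab(1) cone_of_mono[OF ab(3)] cone_of_pair[OF D] by auto
  define k where "k = l div cross a b"
  have k: "l = k * cross a b" using l[OF ab(2)] by (simp add: k_def)
  define m where "m = (snd b - snd a, fst a - fst b)"
  have m: "dot m a = cross a b" "dot m b = cross a b" by (simp_all add: m_def dot_def cross_def algebra_simps)
  define f where "f = character ((l, l) + (- k * fst m, - k * snd m))"
  define na where "na = (- snd a, fst a)"
  define nb where "nb = (snd b, - fst b)"
  have n: "dot na w = cross a w" "dot nb w = cross w b" for w
    by (simp_all add: na_def nb_def dot_def cross_def algebra_simps)
  \<comment> \<open>\<open>na\<close> and \<open>nb\<close> are the inner normals of the two sides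
    of the cone, so a boundary divisor that meets \<open>V\<close> has its ray in the cone of the
    edge.\<close>
  define V where "V = {R \<in> polygon_surface. character na \<in> R} \<inter> {R \<in> polygon_surface. character nb \<in> R}"
  have "openin (zariski polygon_surface) V"
    unfolding V_def by (intro openin_Int openin_zariski_basic)
  moreover have "P \<in> V"
  proof -
    have "character na \<in> cone_alg B" "character nb \<in> cone_alg B"
      by (rule cone_alg_character; use Bab in \<open>auto simp: n cone2_def\<close>)+
    then show ?thesis
      using subset_localization[OF is_subring_cone_alg B(4)] \<open>P \<in> polygon_surface\<close> unfolding V_def B(5) by blast
  qed
  moreover have "f \<noteq> 0" by (simp add: f_def)
  moreover have "l * canonical_divisor polygon_surface R = principal_divisor polygon_surface f R"
    if R: "R \<in> prime_divisors polygon_surface" "R \<in> V" for R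
  proof -
    have pd: "principal_divisor polygon_surface f R = ord_at R f" using R(1) by (simp add: principal_divisor_def)
    consider w where "w \<in> rays (polygon_fan Q)" "R = ray_ring w" | p where "torus_prime p" "R = poly_local p"
      using R(1) unfolding prime_divisors_toric[OF \<Sigma>] by blast
    then show ?thesis
    proof cases
      case 1
      obtain mw where mw: "dot mw w = 1" using ray_ring_dvr[OF 1(1)] by blast
      note dvr = ray_dvr[OF mw]
      have "0 \<le> dot na w" "0 \<le> dot nb w"
        using R(2) in_dvr_iff[OF dvr character_nonzero] ord_ray_character[OF mw] unfolding V_def 1(2) by auto
      then have "lvec w \<in> cone2 a b" by (simp add: n cone2_def)
      moreover have "w \<in> vertices Q" using 1(1) rays_polygon_fan by blast
      ultimately have "dot m w = cross a b" using vertex_in_cone2[OF Q ab(2) m D] by blast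
      then have "ord_at R f = l * (fst w + snd w - 1)"
        unfolding 1(2) f_def ord_ray_character[OF mw] dot_add dot_scale
        by (simp add: k dot_def[of "(_, _)"] algebra_simps)
      then show ?thesis using pd canonical_divisor_toric(1)[OF \<Sigma> 1(1)] 1(2) by simp
    next
      case 2
      have "ord_at R f = 0"
        unfolding 2(2) f_def by (rule ord_at_unit[OF poly_local_dvr[OF torus_primeD[OF 2(1)]] character_unit_poly_local[OF 2(1)]])
      then show ?thesis using pd canonical_divisor_toric(2)[OF \<Sigma> 2(1)] 2(2) by simp
    qed
  qed
  ultimately show "\<exists>V f. openin (zariski polygon_surface) V \<and> P \<in> V \<and> f \<noteq> 0 \<and>
      (\<forall>R\<in>prime_divisors polygon_surface \<inter> V. l * canonical_divisor polygon_surface R = principal_divisor polygon_surface f R)"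
    by blast
qed

text \<open>The product of the determinants of all edges is a common multiple of them, and it is
  positive because every edge is ordered counterclockwise.\<close>

lemma surface_index_polygon:
  assumes "l = surface_index polygon_surface"
  shows "0 < l" "edge Q a b \<Longrightarrow> \<exists>m. dot m a = int l \<and> dot m b = int l"
proof -
  define E where "E = {(a, b). edge Q a b}"
  have "E \<subseteq> vertices Q \<times> vertices Q" by (auto simp: E_def edge_def)
  then have fin: "finite E" using finite_vertices[OF Q] by (meson finite_SigmaI finite_subset)
  define L where "L = (\<Prod>(a, b)\<in>E. cross a b)"
  have L: "0 < L" unfolding L_def by (rule prod_pos) (auto simp: E_def edge_def)
  have dvd: "cross a b dvd int (nat L)" if "edge Q a b" for a b
    using dvd_prodI[OF fin, of "(a, b)" "\<lambda>(a, b). cross a b"] that L by (simp add: L_def E_def)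
  have "0 < nat L \<and> cartier polygon_surface (\<lambda>R. int (nat L) * canonical_divisor polygon_surface R)"
    using L canonical_multiple_cartier[OF dvd] by simp
  then have *: "0 < l \<and> cartier polygon_surface (\<lambda>R. int l * canonical_divisor polygon_surface R)"
    unfolding assms surface_index_def by (rule LeastI)
  then show "0 < l" by blast
  show "edge Q a b \<Longrightarrow> \<exists>m. dot m a = int l \<and> dot m b = int l" using cartier_index_functional * by blast
qed

end

section \<open>Smooth complete fans and the final estimate\<close>

lemma toric_fan_smooth:
  assumes "fan \<Delta>" "\<And>\<sigma>. \<sigma> \<in> \<Delta> \<Longrightarrow> smooth_cone \<sigma>"
  shows "toric_fan \<Delta>"
proof -
  have cone: "\<exists>B\<subseteq>rays \<Delta>. finite B \<and> \<sigma> = cone_of B \<and> {0} \<in> \<Delta>" if \<sigma>: "\<sigma> \<in> \<Delta>" for \<sigma>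
  proof -
    obtain u v B where B: "lattice_basis u v" "B \<subseteq> {u, v}" "\<sigma> = cone_of B"
      using assms(2)[OF \<sigma>] unfolding smooth_cone_def cone_of_def by blast
    have "\<exists>u v. cross u v = 1 \<and> B \<subseteq> {u, v}"
      using cross_lattice_basis[OF B(1)] B(2) by (metis insert_commute)
    then obtain u v where uv: "cross u v = 1" "B \<subseteq> {u, v}" by blast
    have face: "cone_of C \<in> \<Delta>" if "C \<subseteq> B" for C
    proof -
      have "cone_of C face_of \<sigma>" unfolding B(3) using face_of_cone_of[OF _ that uv(2)] uv(1) by simp
      moreover have "cone_of C \<noteq> {}" using convex_cone_contains_0[OF convex_cone_cone_of] by blast
      ultimately show ?thesis using assms(1) \<sigma> unfolding fan_def by blast
    qed
    have "primitive w" if "w \<in> B" for w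
    proof -
      have "w = u \<or> w = v" using that uv(2) by blast
      moreover have "cross v (- u) = 1" using uv(1) cross_swap[of v u] by simp
      ultimately show ?thesis using uv(1) unfolding primitive_iff by blast
    qed
    then have "B \<subseteq> rays \<Delta>" using face by (auto simp: rays_def)
    moreover have "finite B" using uv(2) finite_subset by blast
    moreover have "{0} \<in> \<Delta>" using face[of "{}"] by simp
    ultimately show ?thesis using B(3) by blast
  qed
  moreover have "finite \<Delta>" "\<Delta> \<noteq> {}" using assms(1) by (auto simp: fan_def)
  ultimately show ?thesis unfolding toric_fan_def by blast
qed

text \<open>The vector \<open>m\<close> lies in some cone of the fan, and the generators of this
  cone are orthogonal to it; so \<open>m\<close> is orthogonal to itself.\<close>

lemma complete_fan_spans:
  assumes \<Delta>: "toric_fan \<Delta>" "\<Union> \<Delta> = UNIV" and m: "\<And>u. u \<in> rays \<Delta> \<Longrightarrow> dot m u = 0"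
  shows "m = 0"
proof -
  have "lvec m \<in> \<Union> \<Delta>" using \<Delta>(2) by simp
  then obtain \<sigma> where \<sigma>: "\<sigma> \<in> \<Delta>" "lvec m \<in> \<sigma>" by blast
  then have "\<exists>B\<subseteq>rays \<Delta>. finite B \<and> \<sigma> = cone_of B" using \<Delta>(1) by (simp add: toric_fan_def)
  then obtain B where B: "B \<subseteq> rays \<Delta>" "\<sigma> = cone_of B" by blast
  have "lvec ` B \<subseteq> {x. lvec m \<bullet> x \<le> 0}" using m B(1) by auto
  then have "cone_of B \<subseteq> {x. lvec m \<bullet> x \<le> 0}"
    unfolding cone_of_def by (rule hull_minimal[where S = convex_cone]) (rule convex_cone_halfspace_le)
  then have "lvec m \<bullet> lvec m \<le> 0" using \<sigma>(2) B(2) by blast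
  then have "lvec m = 0" by (metis inner_gt_zero_iff not_less)
  then show ?thesis by (simp only: lvec_zero)
qed

theorem theorem1p2:
  fixes Q :: "(real \<times> real) set" and \<Delta> :: "(real \<times> real) set set" and l :: nat
  assumes "LDP_polygon Q"
    and "l = surface_index (toric_surface (polygon_fan Q))"
    and "coarsest_smooth_refinement \<Delta> (polygon_fan Q)"
  shows "picard_number (toric_surface \<Delta>) \<le> enat (if l = 1 then 7 else 8 * l\<^sup>2 - 6 * l + 3)"
proof -
  note Q = assms(1)
  have l: "1 \<le> int l" using surface_index_polygon(1)[OF Q assms(2)] by simp
  obtain U where U: "smooth_cycle U" "vertices Q \<subseteq> U"
    and bound: "int (card U) - 2 \<le> (if int l = 1 then 7 else 8 * (int l)\<^sup>2 - 6 * int l + 3)"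
    using polygon_cycle_bound[OF Q l surface_index_polygon(2)[OF Q assms(2)]] by blast
  \<comment> \<open>The fan of \<open>U\<close> is one smooth refinement among others. Being
    coarsest, \<open>\<Delta>\<close> is refined by it, and this bounds the rays of
    \<open>\<Delta>\<close> by those of \<open>U\<close>.\<close>
  have \<Delta>: "smooth_refinement \<Delta> (polygon_fan Q)" "refines (cycle_fan U) \<Delta>"
    using assms(3) smooth_refinement_cycle_fan[OF Q U] unfolding coarsest_smooth_refinement_def by blast+
  have fan: "fan \<Delta>" and T: "toric_fan \<Delta>"
    using \<Delta>(1) toric_fan_smooth unfolding smooth_refinement_def by blast+
  have "\<Union> \<Delta> = UNIV"
    using \<Delta>(1) Union_polygon_fan[OF Q] unfolding smooth_refinement_def refines_def by simp
  then have "picard_number (toric_surface \<Delta>) \<le> enat (card (rays \<Delta>) - 2)"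
    using picard_number_le[OF T complete_fan_spans[OF T]] by blast
  also have "card (rays \<Delta>) \<le> card U"
    using rays_subset_cycle[OF fan \<Delta>(2) U(1)] finite_cycle[OF U(1)] by (rule card_mono[rotated])
  then have "card (rays \<Delta>) - 2 \<le> (if l = 1 then 7 else 8 * l\<^sup>2 - 6 * l + 3)"
  proof -
    \<comment> \<open>Makes the subtraction of natural numbers in the statement exact.\<close>
    have "6 * l \<le> 8 * l\<^sup>2" using l by (simp add: power2_eq_square)
    then have "int (8 * l\<^sup>2 - 6 * l + 3) = 8 * (int l)\<^sup>2 - 6 * int l + 3" by (simp add: of_nat_diff)
    then show ?thesis using bound \<open>card (rays \<Delta>) \<le> card U\<close> by (auto split: if_splits)
  qed
  finally show ?thesis by simp
qed

end
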